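(* Let $p$ be an odd prime, let $F=\mathbb{F}_p$, and let $A$ be the adjacency matrix of $\Gamma(4,p)$, with characteristic polynomial $\phi(x)=\det(xI_{p^4}-A)$. (i) For $p=3$, $\phi(x)=x^{18}(x-6)(x-3)^{12}(x+3)^{14}(x^3-9x-9)^{12}$. (ii) For $p=5$, $\phi(x)=x^{220}(x-20)(x-5)^{80}(x+5)^{164}(x^2-5x-25)^{80}$. (iii) For $p>5$ with $p\equiv 2 \bmod 3$, $$\phi(x)=x^{3p(p-1)}\bigl(x-p(p-1)\bigr)(x-p)^{p(p-1)^2}(x+p)^{(p-1)(2p^2-2p+1)}\prod_{c=1}^{p-1}\bigl(x+p-\varepsilon_{t^3+ct}^2\bigr)^{p(p-1)^2}$$ with $p+3$ distinct roots and multiplicities as indicated by the exponents. (iv) For $p\equiv 1\bmod 3$, with $\omega\in F$ a primitive element (a generator of $F^\times$), $$\phi(x)=x^{3p(p-1)}\bigl(x-p(p-1)\bigr)(x-p)^{p(p-1)^2}(x+p)^{(p-1)(p^2-p+1)}\bigl[(x+p-\varepsilon_{t^3}^2)(x+p-\varepsilon_{\omega t^3}^2)(x+p-\varepsilon_{\omega^2t^3}^2)\bigr]^{p(p-1)^2/3}\prod_{a=1}^{p-1}\bigl(x+p-\varepsilon_{at^3+t}^2\bigr)^{p(p-1)^2}$$ with $p+6$ distinct roots and multiplicities as indicated by the exponents.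
   Context: The graph $D(4,p)$ is the bipartite graph with $p^4$ points $P(p_1,p_2,p_3,p_4)$ and $p^4$ lines $L(\ell_1,\ell_2,\ell_3,\ell_4)$ (all coordinates in $F=\mathbb{F}_p$), where a point and a line are incident (adjacent) iff $p_2+\ell_2=p_1\ell_1$, $p_3+\ell_3=p_1\ell_2$ and $p_4+\ell_4=p_2\ell_1$. The graph $\Gamma(4,p)$ is the point collinearity graph of $D(4,p)$: its vertices are the $p^4$ points of $D(4,p)$, and two points are adjacent iff they are distinct and collinear (both incident with a common line). Equivalently, $P(p_1,p_2,p_3,p_4)$ and $P(p_1',p_2',p_3',p_4')$ are adjacent iff $p_1\neq p_1'$, $(p_1-p_1')(p_4-p_4')=(p_2-p_2')^2$ and $p_3-p_3'=p_2p_1'-p_1p_2'$. For $f\in F[t]$ (or any function $f:F\to F$), the exponential sum is $\varepsilon_f=\sum_{a\in F}\zeta^{f(a)}$, where $\zeta=e^{2\pi i/p}\in\mathbb{C}$. The indices $a,c\in\{1,\dots,p-1\}$ are viewed as nonzero elements of $F$. *)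

theory Defs
  imports
    Complex_Main
    "HOL-Number_Theory.Cong"
    "Jordan_Normal_Form.Char_Poly"
    "Berlekamp_Zassenhaus.Finite_Field"
begin

text \<open>
  The prime field with \<open>p\<close> elements is the type \<open>'p mod_ring\<close> with \<open>'p\<close> of class
  \<open>prime_card\<close>, where \<open>p = CARD('p)\<close>. Points and lines are both coordinate quadruples.
\<close>

type_synonym 'p point = "'p mod_ring \<times> 'p mod_ring \<times> 'p mod_ring \<times> 'p mod_ring"
type_synonym 'p line = "'p mod_ring \<times> 'p mod_ring \<times> 'p mod_ring \<times> 'p mod_ring"

fun D4_incident :: "'p::prime_card point \<Rightarrow> 'p line \<Rightarrow> bool" where
  "D4_incident (p1, p2, p3, p4) (l1, l2, l3, l4) \<longleftrightarrow>
     p2 + l2 = p1 * l1 \<and> p3 + l3 = p1 * l2 \<and> p4 + l4 = p2 * l1"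

definition Gamma4_adj :: "'p::prime_card point \<Rightarrow> 'p point \<Rightarrow> bool" where
  "Gamma4_adj P Q \<longleftrightarrow> P \<noteq> Q \<and> (\<exists>L. D4_incident P L \<and> D4_incident Q L)"

text \<open>
  The adjacency matrix with respect to an ordering of the vertices, given as a list
  that contains every vertex exactly once.
\<close>

definition adjacency_matrix :: "'v list \<Rightarrow> ('v \<Rightarrow> 'v \<Rightarrow> bool) \<Rightarrow> complex mat" where
  "adjacency_matrix vs E =
     mat (length vs) (length vs) (\<lambda>(i, j). if E (vs ! i) (vs ! j) then 1 else 0)"

text \<open>
  The value of \<open>to_int_mod_ring\<close> is the representative in \<open>{0..<p}\<close>; since \<open>\<zeta>\<close> is a
  \<open>p\<close>-th root of unity, the choice of representative does not matter.
\<close>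

definition exp_sum :: "('p::prime_card mod_ring \<Rightarrow> 'p mod_ring) \<Rightarrow> complex" where
  "exp_sum f =
     (\<Sum>a\<in>UNIV. exp (2 * of_real pi * \<i> / of_nat CARD('p)) powi to_int_mod_ring (f a))"

definition primitive_element :: "'a::field \<Rightarrow> bool" where
  "primitive_element w \<longleftrightarrow> w \<noteq> 0 \<and> (\<forall>x. x \<noteq> 0 \<longrightarrow> (\<exists>k::int. x = w powi k))"

end

theory Submission
  imports Defs
begin

text \<open>
  A neighbour of \<open>(x, y, z, w)\<close> on the line with first coordinate \<open>t\<close> is
  \<open>(x + s, y + s t, z - s (y - t x), w + s t\<^sup>2)\<close> with \<open>s \<noteq> 0\<close>. With \<open>\<psi>\<close> the additive character of the
  prime field, functions of the form \<open>\<psi> (k z + m w + k x y + v y) G x\<close> are mapped to functions of the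
  same form, and on \<open>G\<close> the operator \<open>A + p I\<close> has kernel
  \<open>\<Sum>t. \<psi> (k (x'\<^sup>2 - x\<^sup>2) t + v (x' - x) t + m (x' - x) t\<^sup>2)\<close>. For \<open>k = 0\<close> the characters \<open>G\<close> are eigenvectors and
  the eigenvalue counts the roots of a quadratic. For \<open>k, m \<noteq> 0\<close>, rescaling \<open>t\<close> turns the kernel into
  \<open>\<Sum>t. \<psi> (c (x'\<^sup>2 t + x' t\<^sup>2)) / \<psi> (c (x\<^sup>2 t + x t\<^sup>2))\<close> with \<open>c = k\<^sup>2 / m\<close>. As
  \<open>x\<^sup>2 t + x t\<^sup>2 = ((x + t)\<^sup>3 - x\<^sup>3 - t\<^sup>3) / 3\<close>, it is, up to conjugation by the cubic phase \<open>h x = \<psi> (c x\<^sup>3 / 3)\<close>, a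
  circulant times its adjoint, whence the squares of cubic exponential sums. All these eigenvectors are
  orthogonal and there are \<open>p\<^sup>4\<close> of them.

  For the distinctness of the eigenvalues, an integer relation \<open>\<Sum>v. N v * \<psi> v = 0\<close> forces \<open>N\<close> to be constant
  (irreducibility of the cyclotomic polynomial), hence \<open>\<Sum>v. N v * v ^ j = 0\<close> in the prime field for
  \<open>0 < j < p - 1\<close>. A coincidence of squares of exponential sums thus yields relations between the power sums
  \<open>\<Sum>t. (a t\<^sup>3 + b t) ^ j\<close>, and those with \<open>j\<close> slightly above \<open>p / 3\<close> determine the coefficients.
\<close>

section \<open>Additive characters\<close>

lemma of_nat_mod_ring_eq_0_iff: "(of_nat n :: 'p::prime_card mod_ring) = 0 \<longleftrightarrow> CARD('p) dvd n"
  using of_nat_0_mod_ring_dvd of_nat_card_eq_0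
  by (metis dvd_def mult_zero_left of_nat_mult)

lemma of_int_mod_ring_surj: "of_int (to_int_mod_ring a) = (a :: 'p::prime_card mod_ring)"
  by (simp add: of_int_of_int_mod_ring)

lemma of_int_mod_ring_eq_iff:
  "(of_int m :: 'p::prime_card mod_ring) = of_int n \<longleftrightarrow> int CARD('p) dvd m - n"
proof -
  have *: "(of_nat n :: 'p mod_ring) = 0 \<longleftrightarrow> int CARD('p) dvd int n" for n
    by (simp only: of_nat_mod_ring_eq_0_iff int_dvd_int_iff)
  have "(of_int k :: 'p mod_ring) = 0 \<longleftrightarrow> int CARD('p) dvd k" for k
  proof (cases k rule: int_cases2)
    case (nonneg n)
    then show ?thesis using *[of n] by simp
  next
    case (nonpos n)
    then show ?thesis using *[of n] by simp
  qed
  from this[of "m - n"] show ?thesis by simp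
qed

definition addchar :: "'p::prime_card mod_ring \<Rightarrow> complex" where
  "addchar a = cis (2 * pi * of_int (to_int_mod_ring a) / real CARD('p))"

lemma exp_sum_addchar: "exp_sum f = (\<Sum>a\<in>UNIV. addchar (f a))"
proof -
  have "exp (2 * of_real pi * \<i> / of_nat CARD('a)) powi n = cis (2 * pi * of_int n / real CARD('a))" for n
  proof -
    have "exp (2 * of_real pi * \<i> / of_nat CARD('a)) = cis (2 * pi / real CARD('a))"
      by (simp add: cis_conv_exp mult_ac)
    then show ?thesis by (simp add: cis_power_int mult_ac)
  qed
  then show ?thesis by (simp add: exp_sum_def addchar_def)
qed

text \<open>Two integer representatives of one residue differ by a multiple of p, which turns the
  angle by full circles.\<close>

lemma addchar_of_int:
  "addchar (of_int n :: 'p::prime_card mod_ring) = cis (2 * pi * of_int n / real CARD('p))"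
proof -
  define m where "m = to_int_mod_ring (of_int n :: 'p mod_ring)"
  have "(of_int m :: 'p mod_ring) = of_int n" by (simp add: m_def of_int_mod_ring_surj)
  then obtain k where k: "m = n + int CARD('p) * k"
    by (auto simp: of_int_mod_ring_eq_iff dvd_def algebra_simps)
  have "cis (2 * pi * of_int m / real CARD('p)) 
      = cis (2 * pi * of_int n / real CARD('p)) * cis (2 * pi * of_int k)"
    unfolding cis_mult k by (simp add: field_simps)
  also have "cis (2 * pi * of_int k) = 1" using cis_multiple_2pi[of "of_int k"] by (simp add: mult_ac)
  finally show ?thesis by (simp add: addchar_def m_def)
qed

lemma addchar_add: "addchar (a + b) = addchar a * addchar (b :: 'p::prime_card mod_ring)"
proof -
  have "a + b = of_int (to_int_mod_ring a + to_int_mod_ring b)" 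
    by (simp add: of_int_mod_ring_surj)
  then show ?thesis 
    by (simp only: addchar_of_int) (simp add: addchar_def cis_mult add_divide_distrib distrib_left)
qed

lemma addchar_0 [simp]: "addchar 0 = 1"
  using addchar_of_int[of 0] by simp

lemma addchar_minus: "addchar (- a) = cnj (addchar (a :: 'p::prime_card mod_ring))"
proof -
  have "- a = of_int (- to_int_mod_ring a)" by (simp add: of_int_mod_ring_surj)
  then show ?thesis by (simp only: addchar_of_int) (simp add: addchar_def cis_cnj)
qed

lemma norm_addchar [simp]: "norm (addchar a) = 1"
  by (simp add: addchar_def)

lemma addchar_nonzero [simp]: "addchar a \<noteq> 0"
  using norm_addchar[of a] by (metis norm_zero zero_neq_one)

lemma addchar_diff: "addchar (a - b) = addchar a * cnj (addchar (b :: 'p::prime_card mod_ring))"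
  using addchar_add[of a "-b"] by (simp add: addchar_minus)

lemma addchar_eq_1_iff: "addchar a = 1 \<longleftrightarrow> a = (0 :: 'p::prime_card mod_ring)"
proof
  assume "addchar a = 1"
  then have "cos (2 * pi * of_int (to_int_mod_ring a) / real CARD('p)) = 1"
    by (simp add: addchar_def complex_eq_iff)
  then obtain k :: int where k: "2 * pi * of_int (to_int_mod_ring a) / real CARD('p) = of_int k * 2 * pi"
    by (auto simp: cos_one_2pi_int)
  then have "real_of_int (to_int_mod_ring a) = of_int (k * int CARD('p))"
    by (simp add: field_simps)
  then have "int CARD('p) dvd to_int_mod_ring a - 0" by (simp only: of_int_eq_iff) simp
  then show "a = 0" using of_int_mod_ring_eq_iff[of "to_int_mod_ring a" 0, where 'p='p] 
    by (simp add: of_int_mod_ring_surj)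
qed simp

text \<open>Translating the summation variable by 1 multiplies the sum by \<open>addchar c\<close>,
  which is different from 1 unless c = 0.\<close>

lemma sum_addchar_mult:
  fixes c :: "'p::prime_card mod_ring"
  shows "(\<Sum>a\<in>UNIV. addchar (c * a)) = (if c = 0 then of_nat CARD('p) else 0)"
proof (cases "c = 0")
  case False
  let ?S = "\<Sum>a\<in>UNIV. addchar (c * a)"
  have "?S = (\<Sum>a\<in>UNIV. addchar (c * (a + 1)))"
    by (rule sum.reindex_bij_witness[of _ "\<lambda>a. a + 1" "\<lambda>a. a - 1"]) auto
  also have "\<dots> = addchar c * ?S"
    by (simp add: sum_distrib_left distrib_left addchar_add mult_ac)
  finally have "(1 - addchar c) * ?S = 0" by (simp add: algebra_simps)
  then show ?thesis using False addchar_eq_1_iff[of c] by auto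
qed simp

section \<open>Linear independence of roots of unity\<close>

text \<open>Eisenstein's criterion. Let i and j be the first indices at which q does not divide the
  coefficient of \<open>g\<close> and \<open>h\<close>. Then q does not divide the coefficient of
  \<open>f\<close> at i + j, so i + j is the full degree and i, j are the degrees of
  \<open>g\<close>, \<open>h\<close>. If both were positive, q would divide both constant
  coefficients, and q^2 their product.\<close>

lemma eisenstein_irreducible:
  fixes f :: "int poly"
  assumes q: "prime q" and lead: "\<not> q dvd lead_coeff f"
    and low: "\<And>i. i < degree f \<Longrightarrow> q dvd Polynomial.coeff f i" and c0: "\<not> q\<^sup>2 dvd Polynomial.coeff f 0"
    and f: "f = g * h"
  shows "degree g = 0 \<or> degree h = 0"
proof (rule ccontr)
  assume "\<not> (degree g = 0 \<or> degree h = 0)"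
  then have dg: "0 < degree g" and dh: "0 < degree h" by auto
  have lgh: "\<not> q dvd lead_coeff g" "\<not> q dvd lead_coeff h"
    using lead by (auto simp: f lead_coeff_mult)
  define i where "i = (LEAST i. \<not> q dvd Polynomial.coeff g i)"
  define j where "j = (LEAST j. \<not> q dvd Polynomial.coeff h j)"
  have i: "\<not> q dvd Polynomial.coeff g i" "i \<le> degree g" "\<And>k. k < i \<Longrightarrow> q dvd Polynomial.coeff g k"
    unfolding i_def using lgh(1) by (rule LeastI, rule Least_le) (use not_less_Least in blast)
  have j: "\<not> q dvd Polynomial.coeff h j" "j \<le> degree h" "\<And>k. k < j \<Longrightarrow> q dvd Polynomial.coeff h k"
    unfolding j_def using lgh(2) by (rule LeastI, rule Least_le) (use not_less_Least in blast)
  have "Polynomial.coeff f (i + j) = Polynomial.coeff g i * Polynomial.coeff h j + (\<Sum>k\<in>{..i + j} - {i}. Polynomial.coeff g k * Polynomial.coeff h (i + j - k))"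
    unfolding f coeff_mult by (subst sum.remove[of _ i]) auto
  moreover have "q dvd (\<Sum>k\<in>{..i + j} - {i}. Polynomial.coeff g k * Polynomial.coeff h (i + j - k))"
  proof (rule dvd_sum)
    fix k assume "k \<in> {..i + j} - {i}"
    then have "k < i \<or> i + j - k < j" by auto
    then show "q dvd Polynomial.coeff g k * Polynomial.coeff h (i + j - k)" using i(3) j(3) by auto
  qed
  moreover have "\<not> q dvd Polynomial.coeff g i * Polynomial.coeff h j" using i(1) j(1) q by (simp add: prime_dvd_mult_iff)
  ultimately have "\<not> q dvd Polynomial.coeff f (i + j)" by (simp add: dvd_add_left_iff)
  then have "\<not> i + j < degree f" using low by blast
  moreover have "degree f = degree g + degree h"
    unfolding f by (rule degree_mult_eq) (use dg dh in auto)
  ultimately have "i > 0" "j > 0" using i(2) j(2) dg dh by auto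
  then have "q dvd Polynomial.coeff g 0" "q dvd Polynomial.coeff h 0" using i(3) j(3) by auto
  then have "q\<^sup>2 dvd Polynomial.coeff f 0" by (simp add: f coeff_mult power2_eq_square mult_dvd_mono)
  with c0 show False by simp
qed

text \<open>The polynomial \<open>((x + 1) ^ p - 1) / x\<close>.\<close>

definition shifted_cyclotomic :: "nat \<Rightarrow> int poly" where
  "shifted_cyclotomic p = (\<Sum>k<p. Polynomial.monom (int (p choose Suc k)) k)"

lemma coeff_shifted_cyclotomic:
  "Polynomial.coeff (shifted_cyclotomic p) k = (if k < p then int (p choose Suc k) else 0)"
  by (simp add: shifted_cyclotomic_def coeff_sum)

lemma degree_shifted_cyclotomic: "p > 0 \<Longrightarrow> degree (shifted_cyclotomic p) = p - 1"
  by (rule antisym[OF degree_le le_degree]) (auto simp: coeff_shifted_cyclotomic)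

text \<open>Below the leading coefficient 1 stand the binomials \<open>p choose k\<close> with 0 < k
  < p, all divisible by p, and the constant one is p itself.\<close>

lemma irreducible_shifted_cyclotomic:
  assumes "prime p" "shifted_cyclotomic p = g * h"
  shows "degree g = 0 \<or> degree h = 0"
proof (rule eisenstein_irreducible[of "int p" "shifted_cyclotomic p"])
  have p: "p > 1" using assms(1) by (rule prime_gt_1_nat)
  note d = degree_shifted_cyclotomic[of p]
  show "prime (int p)" using assms by simp
  show "\<not> int p dvd lead_coeff (shifted_cyclotomic p)"
    using p d by (simp add: coeff_shifted_cyclotomic)
  show "int p dvd Polynomial.coeff (shifted_cyclotomic p) i" if "i < degree (shifted_cyclotomic p)" for i
    using that p d assms(1) by (auto simp: coeff_shifted_cyclotomic intro!: dvd_choose_prime)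
  show "\<not> (int p)\<^sup>2 dvd Polynomial.coeff (shifted_cyclotomic p) 0"
    using p by (auto simp: coeff_shifted_cyclotomic power2_eq_square dest: zdvd_imp_le)
qed (use assms in simp)

lemma poly_shifted_cyclotomic:
  fixes z :: "'a::comm_ring_1"
  shows "z * poly (of_int_poly (shifted_cyclotomic p)) z = (z + 1) ^ p - 1"
proof -
  have "poly (of_int_poly (shifted_cyclotomic p)) z = (\<Sum>k<p. of_nat (p choose Suc k) * z ^ k)"
    by (simp add: shifted_cyclotomic_def of_int_poly_hom.hom_sum poly_sum poly_monom map_poly_monom)
  moreover have "(z + 1) ^ p = (\<Sum>k<Suc p. of_nat (p choose k) * z ^ k)"
    by (subst binomial_ring) (simp add: lessThan_Suc_atMost)
  ultimately show ?thesis
    by (simp only: sum.lessThan_Suc_shift) (simp add: sum_distrib_left mult_ac)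
qed

text \<open>Gauss's lemma, applied to a nonzero integer polynomial \<open>g\<close> of least degree
  with root \<open>z\<close>. By minimality pseudo-division of \<open>E\<close> by \<open>g\<close>
  leaves no remainder, so a constant multiple of \<open>E\<close> equals \<open>g * q\<close>;
  passing to primitive parts removes the constant and factors \<open>E\<close> itself, with a factor
  of degree strictly between 0 and the degree of \<open>E\<close>.\<close>

lemma irreducible_int_poly_minimal:
  fixes z :: complex and E f :: "int poly"
  assumes irr: "\<And>g h. E = g * h \<Longrightarrow> degree g = 0 \<or> degree h = 0"
    and cE: "content E = 1" and Ez: "poly (of_int_poly E) z = 0"
    and f: "poly (of_int_poly f) z = 0" "degree f < degree E"
  shows "f = 0"
proof (rule ccontr)
  assume "f \<noteq> 0"
  let ?P = "\<lambda>g. g \<noteq> 0 \<and> poly (of_int_poly g) z = 0"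
  obtain g where g: "?P g" "\<And>h. ?P h \<Longrightarrow> degree g \<le> degree h"
    using ex_has_least_nat[of ?P f degree] f \<open>f \<noteq> 0\<close> by blast
  have dg: "degree g < degree E" using g(2)[of f] f \<open>f \<noteq> 0\<close> by simp
  have dg0: "degree g \<noteq> 0"
  proof
    assume "degree g = 0"
    then obtain c where "g = [:c:]" by (rule degree_eq_zeroE)
    with g(1) show False by (simp add: hom_distribs)
  qed
  obtain q r where qr: "pseudo_divmod E g = (q, r)" by force
  let ?c = "lead_coeff g ^ (Suc (degree E) - degree g)"
  have c0: "?c \<noteq> 0" using g(1) by simp
  have eq: "Polynomial.smult ?c E = g * q + r" and r: "r = 0 \<or> degree r < degree g"
    using pseudo_divmod[OF _ qr] g(1) by auto
  have "poly (of_int_poly (Polynomial.smult ?c E)) z = poly (of_int_poly (g * q + r)) z" using eq by simp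
  then have "poly (of_int_poly r) z = 0" using Ez g(1) by (simp add: hom_distribs)
  then have "r = 0" using r g(2)[of r] by fastforce
  then have eq: "Polynomial.smult ?c E = g * q" using eq by simp
  have "content (Polynomial.smult ?c E) = content g * content q" unfolding eq by (rule content_mult)
  then have ct: "normalize ?c = content g * content q" by (simp add: cE)
  \<comment> \<open>Contents are nonnegative, so \<open>ct\<close> determines \<open>?c\<close> only
    up to its sign, which \<open>u\<close> restores.\<close>
  define u where "u = unit_factor ?c"
  have u: "u * u = 1" using c0 by (simp add: u_def sgn_if flip: power2_eq_square)
  have "content g * content q * u = ?c" 
    unfolding u_def ct[symmetric] by (rule normalize_mult_unit_factor)
  then have "Polynomial.smult (content g * content q) (Polynomial.smult u E) = Polynomial.smult ?c E"
    by simp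
  also have "\<dots> = Polynomial.smult (content g * content q) (primitive_part g * primitive_part q)"
    unfolding eq by (metis content_times_primitive_part mult_smult_left mult_smult_right smult_smult mult.commute)
  finally have "Polynomial.smult u E = primitive_part g * primitive_part q"
    using ct c0 by (metis normalize_eq_0_iff smult_cancel)
  then have "E = Polynomial.smult u (primitive_part g) * primitive_part q"
    using u by (metis mult_smult_left smult_1_left smult_smult)
  moreover have "u \<noteq> 0" using u by auto
  ultimately have "degree g = 0 \<or> degree q = 0" using irr by fastforce
  with dg0 have "degree q = 0" by simp
  moreover have "degree E = degree g + degree q"
    using arg_cong[OF eq, of degree] c0 dg g(1) by (metis degree_mult_eq degree_smult_eq degree_0 mult_zero_right not_less_zero)
  ultimately show False using dg by simp
qed

text \<open>The substitution x -> x + 1 moves the root \<open>z\<close> to \<open>z - 1\<close>,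
  which is a root of the irreducible polynomial \<open>shifted_cyclotomic p\<close> of degree p -
  1.\<close>

lemma cyclotomic_independent:
  fixes z :: complex and f :: "int poly"
  assumes p: "prime p" and z: "z ^ p = 1" "z \<noteq> 1"
    and f: "poly (of_int_poly f) z = 0" "degree f < p - 1"
  shows "f = 0"
proof -
  have p1: "p > 1" using p by (rule prime_gt_1_nat)
  then have dE: "degree (shifted_cyclotomic p) = p - 1" by (simp add: degree_shifted_cyclotomic)
  define g where "g = pcompose f [:1, 1:]"
  have "g = 0"
  proof (rule irreducible_int_poly_minimal)
    show "degree a = 0 \<or> degree b = 0" if "shifted_cyclotomic p = a * b" for a b
      using p that by (rule irreducible_shifted_cyclotomic)
    have "content (shifted_cyclotomic p) dvd 1"
      using content_dvd_coeff[of "shifted_cyclotomic p" "p - 1"] p1 by (simp add: coeff_shifted_cyclotomic)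
    then show "content (shifted_cyclotomic p) = 1"
      by (metis is_unit_normalize normalize_content)
    show "poly (of_int_poly (shifted_cyclotomic p)) (z - 1) = 0"
      using poly_shifted_cyclotomic[of "z - 1" p] z by simp
    have "of_int_poly g = pcompose (of_int_poly f) [:1, 1 :: complex:]"
      by (simp add: g_def hom_distribs)
    then show "poly (of_int_poly g) (z - 1) = 0" using f by (simp add: poly_pcompose)
    show "degree g < degree (shifted_cyclotomic p)" using f by (simp add: dE g_def degree_pcompose)
  qed
  then show ?thesis by (simp add: g_def pcompose_eq_0_iff)
qed

section \<open>Integer relations between the values of the additive character\<close>

lemma bij_betw_of_nat_mod_ring: 
  "bij_betw of_nat {..<CARD('p)} (UNIV :: 'p::prime_card mod_ring set)"
proof -
  have "(UNIV :: 'p mod_ring set) \<subseteq> of_nat ` {..<CARD('p)}" 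
    using surj_of_nat_mod_ring by blast
  then have s: "of_nat ` {..<CARD('p)} = (UNIV :: 'p mod_ring set)" by blast
  moreover have "inj_on (of_nat :: nat \<Rightarrow> 'p mod_ring) {..<CARD('p)}"
    by (rule eq_card_imp_inj_on) (simp_all only: s finite_lessThan card_lessThan CARD_mod_ring)
  ultimately show ?thesis by (simp add: bij_betw_def)
qed

lemma addchar_of_nat: "addchar (of_nat n :: 'p::prime_card mod_ring) = cis (2 * pi / real CARD('p)) ^ n"
  using addchar_of_int[of "int n", where 'p='p] by (simp add: DeMoivre mult_ac)

text \<open>Subtracting \<open>N l\<close> times the vanishing sum of all character values removes
  the power \<open>z ^ (p - 1)\<close>. What remains is an integer polynomial of degree below p - 1
  with root \<open>z\<close>, so all differences \<open>N v - N l\<close> vanish.\<close>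

lemma addchar_independent:
  fixes N :: "'p::prime_card mod_ring \<Rightarrow> int"
  assumes "(\<Sum>v\<in>UNIV. of_int (N v) * addchar v) = 0"
  shows "N v = N w"
proof -
  define p where "p = CARD('p)"
  have pr: "prime p" by (simp add: p_def prime_card)
  then have p1: "p > 1" by (rule prime_gt_1_nat)
  define l :: "'p mod_ring" where "l = of_nat (p - 1)"
  define z where "z = cis (2 * pi / real p)"
  have az: "addchar (of_nat n :: 'p mod_ring) = z ^ n" for n
    by (simp add: addchar_of_nat z_def p_def)
  have sum_eq: "(\<Sum>v\<in>UNIV. g v) = (\<Sum>i<p. g (of_nat i))" for g :: "'p mod_ring \<Rightarrow> complex"
    using sum.reindex_bij_betw[OF bij_betw_of_nat_mod_ring, of g] by (simp add: p_def)
  define f where "f = (\<Sum>i<p - 1. Polynomial.monom (N (of_nat i) - N l) i)"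
  have cf: "Polynomial.coeff f i = (if i < p - 1 then N (of_nat i) - N l else 0)" for i
    by (simp add: f_def coeff_sum)
  have z: "z ^ p = 1" "z \<noteq> 1"
    using az[of p] az[of 1] addchar_eq_1_iff[of "1 :: 'p mod_ring"] by (auto simp: p_def)
  have "poly (of_int_poly f) z = (\<Sum>i<p - 1. of_int (N (of_nat i) - N l) * z ^ i)"
    by (simp add: f_def of_int_poly_hom.hom_sum poly_sum poly_monom map_poly_monom)
  also have "\<dots> = (\<Sum>i<Suc (p - 1). of_int (N (of_nat i) - N l) * z ^ i)"
    by (simp add: l_def)
  also have "\<dots> = (\<Sum>v\<in>UNIV. of_int (N v - N l) * addchar v)"
    using p1 by (simp add: sum_eq az)
  also have "\<dots> = (\<Sum>v\<in>UNIV. of_int (N v) * addchar v) - of_int (N l) * (\<Sum>v\<in>UNIV. addchar (v :: 'p mod_ring))"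
    by (simp add: left_diff_distrib sum_subtractf sum_distrib_left)
  also have "\<dots> = 0" using assms sum_addchar_mult[of "1 :: 'p mod_ring"] by simp
  finally have "poly (of_int_poly f) z = 0" .
  moreover have "degree f < p - 1" 
    using p1 by (intro degree_lessI) (auto simp: cf)
  ultimately have f0: "f = 0" using cyclotomic_independent[OF pr z] by blast
  have "N u = N l" for u
  proof -
    obtain i where i: "i < p" "u = of_nat i" using surj_of_nat_mod_ring p_def by blast
    show ?thesis
    proof (cases "i = p - 1")
      case False
      then have "i < p - 1" using i by simp
      then show ?thesis using cf[of i] f0 i by simp
    qed (simp add: i l_def)
  qed
  then show ?thesis by metis
qed

section \<open>Eigenvectors of the collinearity graph\<close>

text \<open>The matrix \<open>V\<close> of eigenvector columns is inverted by its conjugate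
  transpose with each row divided by a squared norm, so the adjacency matrix is similar to the
  diagonal matrix of the \<open>l i\<close>. Indexing the eigenvectors by the vertices makes their
  number right automatically.\<close>

lemma char_poly_orthogonal_eigenvectors:
  fixes vs :: "'v::finite list" and e :: "'v \<Rightarrow> 'v \<Rightarrow> complex" and l :: "'v \<Rightarrow> complex"
  assumes vs: "distinct vs" "set vs = UNIV"
    and eigen: "\<And>i u. (\<Sum>w | E u w. e i w) = l i * e i u"
    and orth: "\<And>i j. i \<noteq> j \<Longrightarrow> (\<Sum>u\<in>UNIV. cnj (e i u) * e j u) = 0"
    and nonzero: "\<And>i. \<exists>u. e i u \<noteq> 0"
  shows "char_poly (adjacency_matrix vs E) = (\<Prod>i\<in>UNIV. [:- l i, 1:])"
proof -
  define n where "n = length vs"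
  define N where "N i = (\<Sum>u\<in>UNIV. cnj (e i u) * e i u)" for i
  have N: "N i \<noteq> 0" for i
  proof -
    have "N i = of_real (\<Sum>u\<in>UNIV. (cmod (e i u))\<^sup>2)"
      by (simp add: N_def complex_norm_square mult.commute del: of_real_power)
    moreover have "(\<Sum>u\<in>UNIV. (cmod (e i u))\<^sup>2) > 0"
      using nonzero[of i] by (auto intro!: sum_pos2)
    ultimately show ?thesis by (metis less_irrefl of_real_eq_0_iff)
  qed
  have sum_vs: "(\<Sum>k<n. f (vs ! k)) = (\<Sum>u\<in>UNIV. f u)" for f :: "'v \<Rightarrow> complex"
    unfolding n_def vs(2)[symmetric] by (simp add: sum.distinct_set_conv_list[OF vs(1)] sum_list_sum_nth atLeast0LessThan)
  have inj: "vs ! i = vs ! j \<longleftrightarrow> i = j" if "i < n" "j < n" for i j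
    using that vs(1) by (simp add: n_def nth_eq_iff_index_eq)
  let ?A = "adjacency_matrix vs E"
  define V where "V = mat n n (\<lambda>(r, c). e (vs ! c) (vs ! r))"
  define W where "W = mat n n (\<lambda>(r, c). cnj (e (vs ! r) (vs ! c)) / N (vs ! r))"
  define D where "D = mat n n (\<lambda>(r, c). if r = c then l (vs ! r) else 0)"
  have cA: "?A \<in> carrier_mat n n" and cV: "V \<in> carrier_mat n n" and cW: "W \<in> carrier_mat n n"
    and cD: "D \<in> carrier_mat n n"
    by (simp_all add: adjacency_matrix_def n_def V_def W_def D_def)
  have WV: "W * V = 1\<^sub>m n"
  proof (rule eq_matI)
    fix i j assume "i < dim_row (1\<^sub>m n)" "j < dim_col (1\<^sub>m n)"
    then have ij: "i < n" "j < n" by auto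
    then have "(W * V) $$ (i, j) = (\<Sum>k<n. cnj (e (vs ! i) (vs ! k)) * e (vs ! j) (vs ! k)) / N (vs ! i)"
      by (simp add: W_def V_def scalar_prod_def atLeast0LessThan sum_divide_distrib)
    also have "\<dots> = (\<Sum>u\<in>UNIV. cnj (e (vs ! i) u) * e (vs ! j) u) / N (vs ! i)"
      by (subst sum_vs[of "\<lambda>u. cnj (e (vs ! i) u) * e (vs ! j) u"]) simp
    also have "\<dots> = 1\<^sub>m n $$ (i, j)"
    proof (cases "i = j")
      case True
      then show ?thesis using ij N[of "vs ! j"] by (simp add: N_def)
    next
      case False
      then show ?thesis using ij orth[of "vs ! i" "vs ! j"] inj[of i j] by simp
    qed
    finally show "(W * V) $$ (i, j) = 1\<^sub>m n $$ (i, j)" .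
  qed (use cW cV in auto)
  have VW: "V * W = 1\<^sub>m n" by (rule mat_mult_left_right_inverse[OF cW cV WV])
  have AV: "?A * V = V * D"
  proof (rule eq_matI)
    fix i j assume "i < dim_row (V * D)" "j < dim_col (V * D)"
    then have ij: "i < n" "j < n" using cV cD by auto
    then have "(?A * V) $$ (i, j) = (\<Sum>k<n. if E (vs ! i) (vs ! k) then e (vs ! j) (vs ! k) else 0)"
      by (simp add: adjacency_matrix_def V_def n_def scalar_prod_def atLeast0LessThan if_distrib[of "\<lambda>x. x * _"] cong: if_cong)
    also have "\<dots> = (\<Sum>w\<in>UNIV. if E (vs ! i) w then e (vs ! j) w else 0)"
      by (rule sum_vs)
    also have "\<dots> = l (vs ! j) * e (vs ! j) (vs ! i)"
      by (simp add: sum.If_cases eigen)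
    also have "\<dots> = (\<Sum>k<n. if k = j then e (vs ! k) (vs ! i) * l (vs ! k) else 0)"
      using ij by (simp add: mult.commute)
    also have "\<dots> = (\<Sum>k<n. e (vs ! k) (vs ! i) * (if k = j then l (vs ! k) else 0))"
      by (rule sum.cong) auto
    also have "\<dots> = (V * D) $$ (i, j)"
      using ij by (simp add: V_def D_def scalar_prod_def atLeast0LessThan)
    finally show "(?A * V) $$ (i, j) = (V * D) $$ (i, j)" .
  qed (use cA cV cD in auto)
  have "?A = ?A * (V * W)" using VW cA by simp
  also have "\<dots> = V * D * W" using assoc_mult_mat[OF cA cV cW] AV by simp
  finally have "similar_mat_wit ?A D V W"
    using VW WV cA cV cW cD by (intro similar_mat_witI) auto
  then have "char_poly ?A = char_poly D" by (intro char_poly_similar) (auto simp: similar_mat_def)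
  also have "\<dots> = (\<Prod>a\<leftarrow>diag_mat D. [:- a, 1:])"
    by (rule char_poly_upper_triangular[OF cD]) (auto simp: upper_triangular_def D_def)
  also have "diag_mat D = map (\<lambda>i. l (vs ! i)) [0..<n]" by (auto simp: diag_mat_def D_def)
  also have "\<dots> = map l vs" by (simp add: n_def map_nth flip: map_map[unfolded o_def])
  also have "(\<Prod>a\<leftarrow>map l vs. [:- a, 1:]) = (\<Prod>i\<in>set vs. [:- l i, 1:])"
    by (simp add: prod.distinct_set_conv_list[OF vs(1)] o_def)
  finally show ?thesis by (simp add: vs(2))
qed

text \<open>Here \<open>t\<close> is the first coordinate of the line and \<open>s\<close> the
  displacement of the first coordinate of the point. For s nonzero the neighbour determines both, so
  nothing is counted twice; s = 0 gives back the point itself once for each of its p lines, which is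
  the subtracted term.\<close>

lemma sum_line_neighbours:
  fixes f :: "'p::prime_card point \<Rightarrow> complex" and x y z w :: "'p mod_ring"
  shows "(\<Sum>Q | Gamma4_adj (x, y, z, w) Q. f Q)
       = (\<Sum>t\<in>UNIV. \<Sum>s\<in>UNIV. f (x + s, y + s * t, z - s * (y - t * x), w + s * t\<^sup>2))
         - of_nat CARD('p) * f (x, y, z, w)"
proof -
  define g where "g = (\<lambda>(t, s). (x + s, y + s * t, z - s * (y - t * x), w + s * t\<^sup>2))"
  have adj: "Gamma4_adj (x, y, z, w) Q \<longleftrightarrow> (\<exists>t s. s \<noteq> 0 \<and> Q = g (t, s))" for Q
  proof
    assume "Gamma4_adj (x, y, z, w) Q"
    then obtain L where ne: "(x, y, z, w) \<noteq> Q" and L: "D4_incident (x, y, z, w) L" "D4_incident Q L"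
      by (auto simp: Gamma4_adj_def)
    obtain t l2 l3 l4 where Ld: "L = (t, l2, l3, l4)" by (metis prod.collapse)
    obtain x' y' z' w' where Qd: "Q = (x', y', z', w')" by (metis prod.collapse)
    have l: "l2 = x * t - y" "l3 = x * l2 - z" "l4 = y * t - w" 
      "y' = x' * t - l2" "z' = x' * l2 - l3" "w' = y' * t - l4"
      using L by (auto simp: Ld Qd algebra_simps eq_diff_eq)
    have "Q = g (t, x' - x)" by (simp add: Qd g_def l algebra_simps power2_eq_square)
    moreover from this ne have "x' - x \<noteq> 0" by (auto simp: g_def)
    ultimately show "\<exists>t s. s \<noteq> 0 \<and> Q = g (t, s)" by blast
  next
    assume "\<exists>t s. s \<noteq> 0 \<and> Q = g (t, s)"
    then obtain t s where s: "s \<noteq> 0" and Q: "Q = g (t, s)" by blast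
    \<comment> \<open>A point and the first coordinate \<open>t\<close> determine a line: the three
      incidence equations are solved one after the other.\<close>
    let ?L = "(t, x * t - y, x * (x * t - y) - z, y * t - w)"
    have "D4_incident (x, y, z, w) ?L" "D4_incident Q ?L"
      by (simp_all add: Q g_def algebra_simps power2_eq_square)
    moreover have "(x, y, z, w) \<noteq> Q" using s by (simp add: Q g_def)
    ultimately show "Gamma4_adj (x, y, z, w) Q" unfolding Gamma4_adj_def by blast
  qed
  have inj: "inj_on g (UNIV \<times> (UNIV - {0}))" by (auto simp: inj_on_def g_def)
  have "{Q. Gamma4_adj (x, y, z, w) Q} = g ` (UNIV \<times> (UNIV - {0}))" by (auto simp: adj)
  then have "(\<Sum>Q | Gamma4_adj (x, y, z, w) Q. f Q) = (\<Sum>t\<in>UNIV. \<Sum>s\<in>UNIV - {0}. f (g (t, s)))"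
    using inj by (simp add: sum.reindex sum.cartesian_product)
  also have "\<dots> = (\<Sum>t\<in>UNIV. (\<Sum>s\<in>UNIV. f (g (t, s))) - f (g (t, 0)))"
    by (simp add: sum.remove[of UNIV 0])
  also have "\<dots> = (\<Sum>t\<in>UNIV. \<Sum>s\<in>UNIV. f (g (t, s))) - of_nat CARD('p) * f (x, y, z, w)"
    by (simp add: sum_subtractf g_def)
  finally show ?thesis by (simp add: g_def)
qed

lemma unit_mult_cnj: "norm z = 1 \<Longrightarrow> z * cnj z = 1"
  by (metis complex_norm_square of_real_1 power_one)

text \<open>Values of norm 1 are inverted by conjugation, so the cocycle identity can be solved for
  the character.\<close>

lemma addchar_cocycle:
  fixes h :: "'p::prime_card mod_ring \<Rightarrow> complex"
  assumes "\<And>x y. h (x + y) = addchar (c * (x\<^sup>2 * y + x * y\<^sup>2)) * h x * h y" "\<And>x. norm (h x) = 1"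
  shows "addchar (c * (x\<^sup>2 * y + x * y\<^sup>2)) = h (x + y) * cnj (h x) * cnj (h y)"
proof -
  have hh: "h x * cnj (h x) = 1" for x using assms(2) by (rule unit_mult_cnj)
  have "h (x + y) * cnj (h x) * cnj (h y) = addchar (c * (x\<^sup>2 * y + x * y\<^sup>2)) * (h x * cnj (h x)) * (h y * cnj (h y))"
    unfolding assms(1)[of x y] by (simp only: mult_ac)
  then show ?thesis by (simp only: hh mult_1_left mult_1_right)
qed

text \<open>An arbitrary choice of one element from each pair \<open>{b, - b}\<close> with \<open>b \<noteq> 0\<close>.\<close>

definition positive_half :: "'p::prime_card mod_ring \<Rightarrow> bool" where
  "positive_half b \<longleftrightarrow> to_int_mod_ring b < to_int_mod_ring (- b)"

text \<open>Dependence of an eigenvector on the first coordinate. For \<open>k \<noteq> 0\<close>, translation by \<open>v / (2 * k)\<close> removes \<open>v\<close>;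
  for \<open>m = 0\<close> the remaining operator is then \<open>p\<close> times the indicator of \<open>x'\<^sup>2 = x\<^sup>2\<close>.\<close>

definition profile ::
  "('p::prime_card mod_ring \<Rightarrow> 'p mod_ring \<Rightarrow> complex) \<Rightarrow> 'p mod_ring \<Rightarrow> 'p mod_ring \<Rightarrow> 'p mod_ring
     \<Rightarrow> 'p mod_ring \<Rightarrow> 'p mod_ring \<Rightarrow> complex" where
  "profile h k m v b x =
     (if k = 0 then addchar (b * x)
      else if m = 0 then
        of_bool (x + v / (2 * k) = b)
          + (if b = 0 \<or> positive_half b then 1 else - 1) * of_bool (x + v / (2 * k) = - b)
      else h (k\<^sup>2 / m) (x + v / (2 * k)) * addchar (b * (x + v / (2 * k))))"

text \<open>The summand \<open>k * x * y\<close> is chosen so that its change along a line cancels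
  the dependence on y in the change of \<open>k * z\<close>; the operator then acts on the first
  coordinate alone. The parameters form a quadruple of field elements, hence there are as many
  eigenvectors as points.\<close>

fun collinearity_eigenvector ::
  "('p::prime_card mod_ring \<Rightarrow> 'p mod_ring \<Rightarrow> complex) \<Rightarrow> 'p point \<Rightarrow> 'p point \<Rightarrow> complex" where
  "collinearity_eigenvector h (k, m, v, b) (x, y, z, w) =
     addchar (k * z + m * w + k * x * y + v * y) * profile h k m v b x"

text \<open>These are the eigenvalues of \<open>A + p I\<close>, the sum over all lines through a point of the points on them.\<close>

fun line_eigenvalue ::
  "('p::prime_card mod_ring \<Rightarrow> 'p mod_ring \<Rightarrow> complex) \<Rightarrow> 'p point \<Rightarrow> complex" where
  "line_eigenvalue h (k, m, v, b) =
     (if k = 0 then of_nat (CARD('p) * card {t. b + v * t + m * t\<^sup>2 = 0})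
      else if m = 0 then
        (if b = 0 then of_nat CARD('p) else if positive_half b then of_nat (2 * CARD('p)) else 0)
      else of_real ((cmod (\<Sum>z\<in>UNIV. h (k\<^sup>2 / m) z * addchar (b * z)))\<^sup>2))"

lemma sum_UNIV_shift: "(\<Sum>x\<in>UNIV. f (x + a)) = (\<Sum>x\<in>UNIV. f (x :: 'p::prime_card mod_ring))"
  by (rule sum.reindex_bij_witness[of _ "\<lambda>x. x - a" "\<lambda>x. x + a"]) auto

lemma sum_UNIV_scale:
  assumes "a \<noteq> 0"
  shows "(\<Sum>x\<in>UNIV. f (a * x)) = (\<Sum>x\<in>UNIV. f (x :: 'p::prime_card mod_ring))"
  by (rule sum.reindex_bij_witness[of _ "\<lambda>x. x / a" "\<lambda>x. a * x"]) (use assms in auto)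

lemma sum_of_bool_eq_mult: "(\<Sum>u\<in>UNIV. of_bool (u = a) * g u) = (g a :: complex)" for a :: "'a::finite"
proof -
  have "(\<Sum>u\<in>UNIV. of_bool (u = a) * g u) = (\<Sum>u\<in>UNIV. if u = a then g u else 0)"
    by (rule sum.cong) auto
  then show ?thesis by simp
qed

lemma two_nonzero_mod_ring:
  assumes "odd CARD('p::prime_card)"
  shows "(2 :: 'p mod_ring) \<noteq> 0"
proof
  assume "(2 :: 'p mod_ring) = 0"
  then have "CARD('p) dvd 2" using of_nat_mod_ring_eq_0_iff[of 2, where 'p='p] by simp
  then have "CARD('p) \<le> 2" by (rule dvd_imp_le) simp
  moreover have "CARD('p) > 1" using prime_card[where 'a='p] by (rule prime_gt_1_nat)
  ultimately show False using assms by (cases "CARD('p) = 2") auto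
qed

lemma eq_minus_iff_mod_ring:
  assumes "odd CARD('p::prime_card)"
  shows "b = - b \<longleftrightarrow> b = (0 :: 'p mod_ring)"
proof
  assume "b = - b"
  then have "2 * b = 0" by (metis add.right_inverse mult_2)
  then show "b = 0" using two_nonzero_mod_ring[OF assms] by simp
qed simp

lemma positive_half_minus:
  assumes "odd CARD('p::prime_card)" "b \<noteq> (0 :: 'p mod_ring)"
  shows "positive_half (- b) \<longleftrightarrow> \<not> positive_half b"
proof -
  have "to_int_mod_ring b \<noteq> to_int_mod_ring (- b)"
    using eq_minus_iff_mod_ring[OF assms(1)] assms(2) by (metis of_int_mod_ring_surj)
  then show ?thesis unfolding positive_half_def minus_minus by linarith
qed

text \<open>The phase \<open>h\<close> stays abstract because it is built differently in
  characteristic 3. All that enters is that the cubic cocycle is its coboundary and that its values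
  have norm 1.\<close>

context
  fixes h :: "'p::prime_card mod_ring \<Rightarrow> 'p mod_ring \<Rightarrow> complex"
  assumes odd_p: "odd CARD('p)"
    and cocycle: "\<And>c x y. c \<noteq> 0 \<Longrightarrow> h c (x + y) = addchar (c * (x\<^sup>2 * y + x * y\<^sup>2)) * h c x * h c y"
    and norm_h: "\<And>c x. c \<noteq> 0 \<Longrightarrow> norm (h c x) = 1"
begin

text \<open>For fixed \<open>t\<close> the sum over \<open>s\<close> is a complete character sum of
  frequency \<open>b + v * t + m * t\<^sup>2\<close>, so each root \<open>t\<close> of this
  polynomial contributes p and every other \<open>t\<close> nothing.\<close>

lemma profile_eigen_zero:
  "(\<Sum>t\<in>UNIV. \<Sum>s\<in>UNIV. addchar (v * s * t + m * s * t\<^sup>2) * profile h 0 m v b (x + s))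
   = line_eigenvalue h (0, m, v, b) * profile h 0 m v b x"
proof -
  have "(\<Sum>s\<in>UNIV. addchar (v * s * t + m * s * t\<^sup>2) * profile h 0 m v b (x + s))
      = addchar (b * x) * (of_nat CARD('p) * of_bool (b + v * t + m * t\<^sup>2 = 0))" for t
  proof -
    have "(\<Sum>s\<in>UNIV. addchar (v * s * t + m * s * t\<^sup>2) * profile h 0 m v b (x + s))
      = (\<Sum>s\<in>UNIV. addchar (b * x) * addchar ((b + v * t + m * t\<^sup>2) * s))"
      by (rule sum.cong[OF refl]) (simp add: profile_def algebra_simps flip: addchar_add)
    then show ?thesis by (simp add: sum_addchar_mult flip: sum_distrib_left)
  qed
  then show ?thesis 
    by (simp add: profile_def mult_ac flip: sum_distrib_left of_nat_sum)
qed

lemma profile_eigen_nonzero: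
  assumes k: "k \<noteq> 0"
  shows "(\<Sum>t\<in>UNIV. \<Sum>s\<in>UNIV. addchar (k * (2 * s * x + s\<^sup>2) * t + v * s * t + m * s * t\<^sup>2) * profile h k m v b (x + s))
   = line_eigenvalue h (k, m, v, b) * profile h k m v b x" (is "?L = _")
proof -
  have two: "(2 :: 'p mod_ring) \<noteq> 0" by (rule two_nonzero_mod_ring[OF odd_p])
  define a where "a = v / (2 * k)"
  have v: "v = 2 * k * a" using k two by (simp add: a_def)
  define z where "z = x + a"
  define P where "P u = profile h k m v b (u - a)" for u
  have "?L = (\<Sum>t\<in>UNIV. \<Sum>s\<in>UNIV. addchar (k * ((s + z)\<^sup>2 - z\<^sup>2) * t + m * (s + z - z) * t\<^sup>2) * P (s + z))"
  proof (intro sum.cong refl)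
    fix t s
    have e: "k * (2 * s * x + s\<^sup>2) * t + v * s * t + m * s * t\<^sup>2 = k * ((s + z)\<^sup>2 - z\<^sup>2) * t + m * (s + z - z) * t\<^sup>2"
      by (simp add: v z_def algebra_simps power2_eq_square)
    show "addchar (k * (2 * s * x + s\<^sup>2) * t + v * s * t + m * s * t\<^sup>2) * profile h k m v b (x + s)
      = addchar (k * ((s + z)\<^sup>2 - z\<^sup>2) * t + m * (s + z - z) * t\<^sup>2) * P (s + z)"
      unfolding e by (simp add: P_def z_def algebra_simps)
  qed
  also have "\<dots> = (\<Sum>t\<in>UNIV. \<Sum>u\<in>UNIV. addchar (k * (u\<^sup>2 - z\<^sup>2) * t + m * (u - z) * t\<^sup>2) * P u)"
    by (rule sum.cong[OF refl], rule sum_UNIV_shift)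
  also have "\<dots> = line_eigenvalue h (k, m, v, b) * P z"
  proof (cases "m = 0")
    case True
    have P: "P u = of_bool (u = b) + (if b = 0 \<or> positive_half b then 1 else - 1) * of_bool (u = - b)" for u
      using k True by (simp add: P_def profile_def flip: a_def)
    \<comment> \<open>The operator sends the point masses at b and - b to the same function. The odd
      combination (\<sigma> = - 1) is therefore killed and the even one gets 2 p; for b = 0 the two
      masses already coincide in \<open>P\<close>, which leaves p.\<close>
    define \<sigma> :: complex where "\<sigma> = (if b = 0 \<or> positive_half b then 1 else - 1)"
    have "(\<Sum>t\<in>UNIV. \<Sum>u\<in>UNIV. addchar (k * (u\<^sup>2 - z\<^sup>2) * t + m * (u - z) * t\<^sup>2) * P u)
       = (\<Sum>u\<in>UNIV. P u * (\<Sum>t\<in>UNIV. addchar (k * (u\<^sup>2 - z\<^sup>2) * t)))"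
      unfolding True by (subst sum.swap) (simp add: sum_distrib_left mult.commute)
    also have "\<dots> = (\<Sum>u\<in>UNIV. P u * (of_nat CARD('p) * of_bool (u = z \<or> u = - z)))"
      using k by (auto intro!: sum.cong simp: sum_addchar_mult power2_eq_iff)
    also have "\<dots> = (\<Sum>u\<in>UNIV. of_bool (u = b) * (of_nat CARD('p) * of_bool (u = z \<or> u = - z)))
       + \<sigma> * (\<Sum>u\<in>UNIV. of_bool (u = - b) * (of_nat CARD('p) * of_bool (u = z \<or> u = - z)))"
      by (simp only: P \<sigma>_def[symmetric] distrib_right sum.distrib sum_distrib_left mult.assoc)
    also have "\<dots> = of_nat CARD('p) * of_bool (b = z \<or> b = - z) * (1 + \<sigma>)"
      by (simp only: sum_of_bool_eq_mult) (auto simp: minus_equation_iff algebra_simps)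
    also have "\<dots> = line_eigenvalue h (k, m, v, b) * P z"
    proof (cases "b = 0")
      case True
      then show ?thesis using k \<open>m = 0\<close> by (auto simp: P \<sigma>_def)
    next
      case False
      then show ?thesis using k \<open>m = 0\<close> eq_minus_iff_mod_ring[OF odd_p, of b] by (auto simp: P \<sigma>_def)
    qed
    finally show ?thesis .
  next
    case False
    define c where "c = k\<^sup>2 / m"
    have c: "c \<noteq> 0" using k False by (simp add: c_def)
    have P: "P u = h c u * addchar (b * u)" for u
      using k False by (simp add: P_def profile_def c_def flip: a_def)
    have hh: "h c u * cnj (h c u) = 1" for u
      using norm_h[OF c] by (rule unit_mult_cnj)
    note coc = addchar_cocycle[of "h c" c, OF cocycle[OF c] norm_h[OF c]]
    define S where "S = (\<Sum>u\<in>UNIV. h c u * addchar (b * u))"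
    have shift: "(\<Sum>u\<in>UNIV. h c (u + t) * addchar (b * u)) = S * cnj (addchar (b * t))" for t
    proof -
      have "S = (\<Sum>u\<in>UNIV. h c (u + t) * addchar (b * (u + t)))"
        unfolding S_def by (rule sum_UNIV_shift[symmetric])
      also have "\<dots> = (\<Sum>u\<in>UNIV. h c (u + t) * addchar (b * u)) * addchar (b * t)"
        by (simp add: distrib_left addchar_add sum_distrib_right mult.assoc)
      finally have "S * cnj (addchar (b * t)) = (\<Sum>u\<in>UNIV. h c (u + t) * addchar (b * u)) * (addchar (b * t) * cnj (addchar (b * t)))"
        by (simp add: mult.assoc)
      also have "addchar (b * t) * cnj (addchar (b * t)) = 1" by (simp add: flip: addchar_diff)
      finally show ?thesis by simp
    qed
    \<comment> \<open>Replacing t by (k / m) t gives the quadratic and the linear part of the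
      exponent the common coefficient \<open>c\<close>.\<close>
    have "(\<Sum>t\<in>UNIV. \<Sum>u\<in>UNIV. addchar (k * (u\<^sup>2 - z\<^sup>2) * t + m * (u - z) * t\<^sup>2) * P u)
      = (\<Sum>t\<in>UNIV. \<Sum>u\<in>UNIV. addchar (k * (u\<^sup>2 - z\<^sup>2) * (k / m * t) + m * (u - z) * (k / m * t)\<^sup>2) * P u)"
      by (rule sum_UNIV_scale[symmetric]) (use k False in simp)
    also have "\<dots> = (\<Sum>t\<in>UNIV. \<Sum>u\<in>UNIV. h c z * cnj (h c (z + t)) * (h c (u + t) * addchar (b * u)))"
    proof (intro sum.cong refl)
      fix t u
      have "k * (u\<^sup>2 - z\<^sup>2) * (k / m * t) + m * (u - z) * (k / m * t)\<^sup>2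
         = c * (u\<^sup>2 * t + u * t\<^sup>2) - c * (z\<^sup>2 * t + z * t\<^sup>2)"
        using False by (simp add: c_def field_simps power2_eq_square)
      then have "addchar (k * (u\<^sup>2 - z\<^sup>2) * (k / m * t) + m * (u - z) * (k / m * t)\<^sup>2)
         = (h c (u + t) * cnj (h c u) * cnj (h c t)) * cnj (h c (z + t) * cnj (h c z) * cnj (h c t))"
        by (simp add: addchar_diff coc)
      \<comment> \<open>Both cocycle expressions contain \<open>h c t\<close>, which cancels against
        its conjugate, and the phase in \<open>P u\<close> cancels \<open>cnj (h c u)\<close>. The
        kernel thereby separates into a factor in z and a factor in u.\<close>
      then have "addchar (k * (u\<^sup>2 - z\<^sup>2) * (k / m * t) + m * (u - z) * (k / m * t)\<^sup>2) * P u
         = h c z * cnj (h c (z + t)) * (h c (u + t) * addchar (b * u)) * (h c u * cnj (h c u)) * (h c t * cnj (h c t))"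
        by (simp add: P mult_ac)
      then show "addchar (k * (u\<^sup>2 - z\<^sup>2) * (k / m * t) + m * (u - z) * (k / m * t)\<^sup>2) * P u
         = h c z * cnj (h c (z + t)) * (h c (u + t) * addchar (b * u))" by (simp add: hh)
    qed
    also have "\<dots> = (\<Sum>t\<in>UNIV. h c z * cnj (h c (z + t)) * (S * cnj (addchar (b * t))))"
      by (simp only: shift sum_distrib_left[symmetric])
    \<comment> \<open>The remaining sum over \<open>t\<close> is the conjugate of the same shifted
      transform, now with shift z; it supplies the factor \<open>cnj S\<close>.\<close>
    also have "\<dots> = (\<Sum>t\<in>UNIV. h c z * S * cnj (h c (t + z) * addchar (b * t)))"
      by (simp add: mult_ac add.commute[of z])
    also have "\<dots> = h c z * S * cnj (\<Sum>t\<in>UNIV. h c (t + z) * addchar (b * t))"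
      by (simp only: cnj_sum sum_distrib_left)
    also have "\<dots> = (S * cnj S) * P z" unfolding shift P by (simp add: mult_ac)
    also have "S * cnj S = line_eigenvalue h (k, m, v, b)"
      using k False by (simp add: complex_norm_square S_def c_def del: of_real_power)
    finally show ?thesis .
  qed
  finally show ?thesis by (simp add: P_def z_def)
qed

lemma collinearity_eigenvector_eigen:
  "(\<Sum>Q | Gamma4_adj P Q. collinearity_eigenvector h i Q)
   = (line_eigenvalue h i - of_nat CARD('p)) * collinearity_eigenvector h i P"
proof -
  obtain k m v b where i: "i = (k, m, v, b)" by (metis prod.collapse)
  obtain x y z w where P: "P = (x, y, z, w)" by (metis prod.collapse)
  let ?c = "addchar (k * z + m * w + k * x * y + v * y)"
  have "(\<Sum>t\<in>UNIV. \<Sum>s\<in>UNIV. collinearity_eigenvector h i (x + s, y + s * t, z - s * (y - t * x), w + s * t\<^sup>2))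
     = (\<Sum>t\<in>UNIV. \<Sum>s\<in>UNIV. ?c * (addchar (k * (2 * s * x + s\<^sup>2) * t + v * s * t + m * s * t\<^sup>2) * profile h k m v b (x + s)))"
  proof (intro sum.cong refl)
    fix t s
    have "k * (z - s * (y - t * x)) + m * (w + s * t\<^sup>2) + k * (x + s) * (y + s * t) + v * (y + s * t)
      = (k * z + m * w + k * x * y + v * y) + (k * (2 * s * x + s\<^sup>2) * t + v * s * t + m * s * t\<^sup>2)"
      by (simp add: algebra_simps power2_eq_square)
    then have e: "addchar (k * (z - s * (y - t * x)) + m * (w + s * t\<^sup>2) + k * (x + s) * (y + s * t) + v * (y + s * t))
      = ?c * addchar (k * (2 * s * x + s\<^sup>2) * t + v * s * t + m * s * t\<^sup>2)"
      by (simp only: addchar_add)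
    show "collinearity_eigenvector h i (x + s, y + s * t, z - s * (y - t * x), w + s * t\<^sup>2)
      = ?c * (addchar (k * (2 * s * x + s\<^sup>2) * t + v * s * t + m * s * t\<^sup>2) * profile h k m v b (x + s))"
      unfolding i collinearity_eigenvector.simps e by (rule mult.assoc)
  qed
  also have "\<dots> = ?c * (line_eigenvalue h i * profile h k m v b x)"
    using profile_eigen_zero[of v m b x] profile_eigen_nonzero[of k x v m b]
    by (cases "k = 0") (simp_all add: i flip: sum_distrib_left del: line_eigenvalue.simps)
  finally show ?thesis
    by (simp add: P sum_line_neighbours i algebra_simps del: line_eigenvalue.simps)
qed

section \<open>Orthogonality of the eigenvectors and the resulting characteristic polynomial\<close>

lemma profile_orthogonal:
  assumes "b \<noteq> b'"
  shows "(\<Sum>x\<in>UNIV. cnj (profile h k m v b x) * profile h k m v b' x) = 0"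
proof -
  have char_orth: "(\<Sum>x\<in>UNIV. cnj (addchar (b * x)) * addchar (b' * x)) = 0"
  proof -
    have "(\<Sum>x\<in>UNIV. cnj (addchar (b * x)) * addchar (b' * x)) = (\<Sum>x\<in>UNIV. addchar ((b' - b) * x))"
      by (simp add: left_diff_distrib addchar_diff mult.commute[of "cnj _"])
    then show ?thesis using assms by (simp add: sum_addchar_mult)
  qed
  have shift: "(\<Sum>x\<in>UNIV. f (x + v / (2 * k))) = (\<Sum>x\<in>UNIV. f x)" for f :: "'p mod_ring \<Rightarrow> complex"
    by (rule sum_UNIV_shift)
  consider "k = 0" | "k \<noteq> 0" "m = 0" | "k \<noteq> 0" "m \<noteq> 0" by blast
  then show ?thesis
  proof cases
    case 1
    then show ?thesis using char_orth by (simp add: profile_def)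
  next
    case 2
    have cnj_of_bool: "cnj (of_bool Q) = of_bool Q" for Q by (cases Q) auto
    define \<sigma> :: "'p mod_ring \<Rightarrow> complex" where "\<sigma> b = (if b = 0 \<or> positive_half b then 1 else - 1)" for b
    have "(\<Sum>x\<in>UNIV. cnj (profile h k m v b x) * profile h k m v b' x)
      = (\<Sum>x\<in>UNIV. cnj (of_bool (x = b) + \<sigma> b * of_bool (x = - b)) * (of_bool (x = b') + \<sigma> b' * of_bool (x = - b')))"
      using 2 shift[of "\<lambda>x. cnj (of_bool (x = b) + \<sigma> b * of_bool (x = - b)) * (of_bool (x = b') + \<sigma> b' * of_bool (x = - b'))"]
      by (simp add: profile_def \<sigma>_def)
    also have "\<dots> = (\<Sum>x\<in>UNIV. of_bool (x = b) * (of_bool (x = b') + \<sigma> b' * of_bool (x = - b')))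
        + cnj (\<sigma> b) * (\<Sum>x\<in>UNIV. of_bool (x = - b) * (of_bool (x = b') + \<sigma> b' * of_bool (x = - b')))"
      by (simp only: cnj_of_bool complex_cnj_add complex_cnj_mult distrib_right sum.distrib sum_distrib_left mult.assoc)
    also have "\<dots> = (of_bool (b = b') + \<sigma> b' * of_bool (b = - b')) + cnj (\<sigma> b) * (of_bool (- b = b') + \<sigma> b' * of_bool (- b = - b'))"
      by (simp only: sum_of_bool_eq_mult)
    also have "\<dots> = 0"
    \<comment> \<open>Different profiles overlap only if they sit on the same pair b, - b; one of
      them is then even and the other odd, so the two contributions cancel.\<close>
    proof (cases "b = - b'")
      case True
      then have "b \<noteq> 0" using assms by auto
      then have "\<sigma> b' + cnj (\<sigma> b) = 0" using positive_half_minus[OF odd_p, of b'] True by (auto simp: \<sigma>_def)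
      then show ?thesis using True assms by simp
    next
      case False
      then show ?thesis using assms by (auto simp: minus_equation_iff)
    qed
    finally show ?thesis .
  next
    case 3
    define c where "c = k\<^sup>2 / m"
    have c: "c \<noteq> 0" using 3 by (simp add: c_def)
    have hh: "cnj (h c u) * h c u = 1" for u
      using unit_mult_cnj[OF norm_h[OF c]] by (simp only: mult.commute)
    have "(\<Sum>x\<in>UNIV. cnj (profile h k m v b x) * profile h k m v b' x)
      = (\<Sum>x\<in>UNIV. cnj (h c x * addchar (b * x)) * (h c x * addchar (b' * x)))"
      using 3 shift[of "\<lambda>x. cnj (h c x * addchar (b * x)) * (h c x * addchar (b' * x))"]
      by (simp add: profile_def c_def)
    also have "\<dots> = (\<Sum>x\<in>UNIV. (cnj (h c x) * h c x) * (cnj (addchar (b * x)) * addchar (b' * x)))"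
      by (simp add: mult_ac)
    finally show ?thesis using char_orth by (simp add: hh)
  qed
qed

lemma profile_nonzero: "\<exists>x. profile h k m v b x \<noteq> 0"
proof -
  define a where "a = v / (2 * k)"
  \<comment> \<open>At this argument the shifted coordinate is b. The second point mass interferes
    only if b = - b, hence b = 0, where its sign is positive.\<close>
  have "profile h k m v b (b - a) \<noteq> 0"
  proof (cases "m = 0 \<or> k = 0")
    case True
    then show ?thesis using eq_minus_iff_mod_ring[OF odd_p, of b] by (auto simp: profile_def a_def)
  next
    case False
    then have "k\<^sup>2 / m \<noteq> 0" by simp
    then have "h (k\<^sup>2 / m) b \<noteq> 0" using norm_h by (metis norm_zero zero_neq_one)
    then show ?thesis using False by (simp add: profile_def a_def)
  qed
  then show ?thesis by blast
qed

lemma sum_point: "(\<Sum>u\<in>UNIV. f u) = (\<Sum>x\<in>UNIV. \<Sum>y\<in>UNIV. \<Sum>z\<in>UNIV. \<Sum>w\<in>UNIV. f (x, y, z, w))"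
  for f :: "'a::finite \<times> 'b::finite \<times> 'c::finite \<times> 'd::finite \<Rightarrow> complex"
  by (simp add: sum.cartesian_product case_prod_beta)

text \<open>The sums over z and w vanish unless k and m agree; then the sum over y vanishes unless v
  agrees; what is left is the orthogonality of profiles with different b.\<close>

lemma collinearity_eigenvector_orthogonal:
  assumes "i \<noteq> j"
  shows "(\<Sum>u\<in>UNIV. cnj (collinearity_eigenvector h i u) * collinearity_eigenvector h j u) = 0"
proof -
  obtain k m v b where i: "i = (k, m, v, b)" by (metis prod.collapse)
  obtain k' m' v' b' where j: "j = (k', m', v', b')" by (metis prod.collapse)
  let ?d = "\<lambda>a. \<Sum>z\<in>UNIV. addchar (a * z)"
  have "(\<Sum>u\<in>UNIV. cnj (collinearity_eigenvector h i u) * collinearity_eigenvector h j u)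
    = (\<Sum>x\<in>UNIV. \<Sum>y\<in>UNIV. \<Sum>z\<in>UNIV. \<Sum>w\<in>UNIV.
        addchar ((k' - k) * x * y + (v' - v) * y) * cnj (profile h k m v b x) * profile h k' m' v' b' x 
        * (addchar ((k' - k) * z) * addchar ((m' - m) * w)))"
    unfolding sum_point i j collinearity_eigenvector.simps
  proof (intro sum.cong refl)
    fix x y z w
    have "addchar ((k' - k) * x * y + (v' - v) * y) * (addchar ((k' - k) * z) * addchar ((m' - m) * w))
      = addchar ((k' * z + m' * w + k' * x * y + v' * y) - (k * z + m * w + k * x * y + v * y))"
      unfolding addchar_add[symmetric] by (rule arg_cong[of _ _ addchar]) (simp add: algebra_simps)
    then show "cnj (addchar (k * z + m * w + k * x * y + v * y) * profile h k m v b x)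
        * (addchar (k' * z + m' * w + k' * x * y + v' * y) * profile h k' m' v' b' x)
      = addchar ((k' - k) * x * y + (v' - v) * y) * cnj (profile h k m v b x) * profile h k' m' v' b' x 
        * (addchar ((k' - k) * z) * addchar ((m' - m) * w))"
      unfolding addchar_diff[of "_ + _ + _ + _"] by (simp add: mult_ac)
  qed
  also have "\<dots> = (\<Sum>x\<in>UNIV. \<Sum>y\<in>UNIV. addchar ((k' - k) * x * y + (v' - v) * y)
        * cnj (profile h k m v b x) * profile h k' m' v' b' x * (?d (k' - k) * ?d (m' - m)))"
    by (simp only: sum_product) (simp only: sum_distrib_left)
  also have "\<dots> = 0"
  proof (cases "k = k' \<and> m = m'")
    case True
    define K where "K = ?d (k' - k) * ?d (m' - m)"
    have "(\<Sum>x\<in>UNIV. \<Sum>y\<in>UNIV. addchar ((k' - k) * x * y + (v' - v) * y)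
        * cnj (profile h k m v b x) * profile h k' m' v' b' x * K)
      = (\<Sum>x\<in>UNIV. cnj (profile h k m v b x) * profile h k m v' b' x) * ?d (v' - v) * K"
      by (simp only: sum_distrib_right, rule sum.cong[OF refl], simp add: True sum_distrib_left mult_ac)
    also have "\<dots> = 0"
    proof (cases "v = v'")
      case True
      then have "b \<noteq> b'" using assms \<open>k = k' \<and> m = m'\<close> by (simp add: i j)
      then show ?thesis using True by (simp add: profile_orthogonal)
    qed (simp add: sum_addchar_mult)
    finally show ?thesis by (simp only: K_def)
  qed (auto simp: sum_addchar_mult)
  finally show ?thesis .
qed

theorem char_poly_collinearity:
  fixes vs :: "'p point list"
  assumes vs: "distinct vs" "set vs = UNIV"
  shows "char_poly (adjacency_matrix vs Gamma4_adj)
       = (\<Prod>i\<in>UNIV. [:of_nat CARD('p) - line_eigenvalue h i, 1:])"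
proof -
  have "\<exists>u. collinearity_eigenvector h i u \<noteq> 0" for i
  proof -
    obtain k m v b where i: "i = (k, m, v, b)" by (metis prod.collapse)
    obtain x where "profile h k m v b x \<noteq> 0" using profile_nonzero by blast
    then have "collinearity_eigenvector h i (x, 0, 0, 0) \<noteq> 0" by (simp add: i)
    then show ?thesis by blast
  qed
  from char_poly_orthogonal_eigenvectors[OF vs collinearity_eigenvector_eigen collinearity_eigenvector_orthogonal this]
  show ?thesis by simp
qed

end

section \<open>Multiplicities\<close>

lemma card_UNIV_minus_zero: "card (UNIV - {0 :: 'p::prime_card mod_ring}) = CARD('p) - 1"
  by (simp add: card_Diff_subset)

text \<open>Negation exchanges the two sets, which together make up the nonzero elements.\<close>

lemma card_positive_half:
  assumes "odd CARD('p::prime_card)"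
  shows "card {b :: 'p mod_ring. positive_half b} = (CARD('p) - 1) div 2"
    and "card {b :: 'p mod_ring. b \<noteq> 0 \<and> \<not> positive_half b} = (CARD('p) - 1) div 2"
proof -
  let ?P = "{b :: 'p mod_ring. positive_half b}"
  let ?N = "{b :: 'p mod_ring. b \<noteq> 0 \<and> \<not> positive_half b}"
  have P0: "b \<noteq> 0" if "positive_half b" for b :: "'p mod_ring" using that by (auto simp: positive_half_def)
  have "bij_betw uminus ?P ?N"
    by (rule bij_betw_byWitness[of _ uminus]) (auto simp: P0 positive_half_minus[OF assms])
  then have eq: "card ?N = card ?P" by (simp add: bij_betw_same_card)
  have "UNIV - {0} = ?P \<union> ?N" using P0 by auto
  then have "CARD('p) - 1 = card (?P \<union> ?N)" using card_UNIV_minus_zero[where 'p='p] by simp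
  also have "\<dots> = card ?P + card ?N" by (rule card_Un_disjoint) auto
  finally show "card ?P = (CARD('p) - 1) div 2" "card ?N = (CARD('p) - 1) div 2" using eq by auto
qed

lemma card_roots_square:
  assumes "odd CARD('p::prime_card)"
  shows "card {t :: 'p mod_ring. t\<^sup>2 = d} = (if d = 0 then 1 else if \<exists>t. t\<^sup>2 = d then 2 else 0)"
proof -
  have "card {t. t\<^sup>2 = d} = 2" if "d \<noteq> 0" "s\<^sup>2 = d" for s
  proof -
    have "{t. t\<^sup>2 = d} = {s, - s}" using that by (auto simp: power2_eq_iff)
    moreover have "s \<noteq> - s" using that eq_minus_iff_mod_ring[OF assms, of s] by auto
    ultimately show ?thesis by simp
  qed
  then show ?thesis by auto
qed

text \<open>Counting the field along the fibres of squaring gives p = 1 + 2 n, where n is the number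
  of nonzero squares.\<close>

lemma card_nonzero_squares:
  assumes "odd CARD('p::prime_card)"
  shows "card {d :: 'p mod_ring. d \<noteq> 0 \<and> (\<exists>t. t\<^sup>2 = d)} = (CARD('p) - 1) div 2"
    and "card {d :: 'p mod_ring. d \<noteq> 0 \<and> \<not> (\<exists>t. t\<^sup>2 = d)} = (CARD('p) - 1) div 2"
proof -
  let ?S = "{d :: 'p mod_ring. d \<noteq> 0 \<and> (\<exists>t. t\<^sup>2 = d)}"
  let ?T = "{d :: 'p mod_ring. d \<noteq> 0 \<and> \<not> (\<exists>t. t\<^sup>2 = d)}"
  have "CARD('p mod_ring) = card (\<Union>d. {t :: 'p mod_ring. t\<^sup>2 = d})" by (rule arg_cong[of _ _ card]) auto
  also have "\<dots> = (\<Sum>d\<in>UNIV. card {t :: 'p mod_ring. t\<^sup>2 = d})" by (rule card_UN_disjoint) auto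
  also have "\<dots> = card {t :: 'p mod_ring. t\<^sup>2 = 0} + (\<Sum>d\<in>UNIV - {0}. card {t :: 'p mod_ring. t\<^sup>2 = d})"
    by (rule sum.remove) auto
  also have "(\<Sum>d\<in>UNIV - {0}. card {t :: 'p mod_ring. t\<^sup>2 = d}) = (\<Sum>d :: 'p mod_ring\<in>UNIV - {0}. if \<exists>t. t\<^sup>2 = d then 2 else 0)"
    by (intro sum.cong refl) (simp add: card_roots_square[OF assms])
  also have "\<dots> = 2 * card ?S"
    by (simp add: sum.If_cases Collect_conj_eq[symmetric] Int_def)
  finally have S: "CARD('p) = 1 + 2 * card ?S" by simp
  then show "card ?S = (CARD('p) - 1) div 2" by simp
  have "UNIV - {0} = ?S \<union> ?T" by auto
  then have "CARD('p) - 1 = card (?S \<union> ?T)" using card_UNIV_minus_zero[where 'p='p] by simp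
  also have "\<dots> = card ?S + card ?T" by (rule card_Un_disjoint) auto
  finally show "card ?T = (CARD('p) - 1) div 2" using S by auto
qed

lemma prod_UNIV_three_values:
  fixes a b c :: "'b::comm_monoid_mult" and P :: "'p::prime_card mod_ring \<Rightarrow> bool"
  assumes "card {d. d \<noteq> 0 \<and> P d} = n" "card {d. d \<noteq> 0 \<and> \<not> P d} = n"
  shows "(\<Prod>d\<in>UNIV. if d = 0 then a else if P d then b else c) = a * (b * c) ^ n"
proof -
  have "(\<Prod>d\<in>UNIV. if d = 0 then a else if P d then b else c)
     = a * (\<Prod>d\<in>UNIV - {0}. if d = 0 then a else if P d then b else c)"
    by (subst prod.remove[of _ 0]) auto
  also have "(\<Prod>d\<in>UNIV - {0}. if d = 0 then a else if P d then b else c) = (\<Prod>d\<in>UNIV - {0}. if P d then b else c)"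
    by (rule prod.cong) auto
  also have "\<dots> = b ^ card {d. d \<noteq> 0 \<and> P d} * c ^ card {d. d \<noteq> 0 \<and> \<not> P d}"
    by (simp add: prod.If_cases Int_def Diff_eq)
  finally show ?thesis by (simp add: assms power_mult_distrib)
qed

text \<open>Completing the square with \<open>u = v / (2 * m)\<close> turns the roots into the
  square roots of d, where \<open>b = m * (u\<^sup>2 - d)\<close>; as b runs through the field, so
  does d.\<close>

lemma prod_UNIV_quadratic_roots:
  fixes f :: "nat \<Rightarrow> 'b::comm_monoid_mult" and m v :: "'p::prime_card mod_ring"
  assumes odd: "odd CARD('p)" and m: "m \<noteq> 0"
  shows "(\<Prod>b\<in>UNIV. f (card {t. b + v * t + m * t\<^sup>2 = 0})) = f 1 * (f 2 * f 0) ^ ((CARD('p) - 1) div 2)"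
proof -
  have two: "(2 :: 'p mod_ring) \<noteq> 0" by (rule two_nonzero_mod_ring[OF odd])
  define u where "u = v / (2 * m)"
  have v: "v = 2 * m * u" using two m by (simp add: u_def)
  have card_eq: "card {t. m * (u\<^sup>2 - d) + v * t + m * t\<^sup>2 = 0} = card {t. t\<^sup>2 = d}" for d
  proof (rule bij_betw_same_card[of "\<lambda>t. t + u"], rule bij_betw_byWitness[of _ "\<lambda>t. t - u"])
    have *: "m * (u\<^sup>2 - d) + v * t + m * t\<^sup>2 = m * ((t + u)\<^sup>2 - d)" for t
      by (simp add: v algebra_simps power2_eq_square)
    show "(\<lambda>t. t + u) ` {t. m * (u\<^sup>2 - d) + v * t + m * t\<^sup>2 = 0} \<subseteq> {t. t\<^sup>2 = d}"
      using m by (auto simp: *)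
    show "(\<lambda>t. t - u) ` {t. t\<^sup>2 = d} \<subseteq> {t. m * (u\<^sup>2 - d) + v * t + m * t\<^sup>2 = 0}"
      by (auto simp: *)
  qed auto
  have "(\<Prod>b\<in>UNIV. f (card {t. b + v * t + m * t\<^sup>2 = 0}))
      = (\<Prod>d\<in>UNIV. f (card {t. m * (u\<^sup>2 - d) + v * t + m * t\<^sup>2 = 0}))"
    by (rule prod.reindex_bij_witness[of _ "\<lambda>d. m * (u\<^sup>2 - d)" "\<lambda>b. u\<^sup>2 - b / m"]) (use m in \<open>auto simp: field_simps\<close>)
  also have "\<dots> = (\<Prod>d :: 'p mod_ring\<in>UNIV. if d = 0 then f 1 else if \<exists>t. t\<^sup>2 = d then f 2 else f 0)"
    by (intro prod.cong refl) (simp add: card_eq card_roots_square[OF odd])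
  also have "\<dots> = f 1 * (f 2 * f 0) ^ ((CARD('p) - 1) div 2)"
    by (rule prod_UNIV_three_values) (rule card_nonzero_squares[OF odd])+
  finally show ?thesis .
qed

lemma prod_UNIV_linear_roots:
  fixes f :: "nat \<Rightarrow> 'b::comm_monoid_mult"
  shows "(\<Prod>v\<in>UNIV. \<Prod>b\<in>UNIV. f (card {t :: 'p::prime_card mod_ring. b + v * t = 0}))
       = f CARD('p) * f 0 ^ (CARD('p) - 1) * f 1 ^ (CARD('p) * (CARD('p) - 1))"
proof -
  have "(\<Prod>b\<in>UNIV. f (card {t :: 'p mod_ring. b + v * t = 0})) = f 1 ^ CARD('p)" if "v \<noteq> 0" for v
  proof -
    have "{t. b + v * t = 0} = {- b / v}" for b using that
      by (auto simp: field_simps add_eq_0_iff)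
    then show ?thesis by simp
  qed
  then have "(\<Prod>v\<in>UNIV - {0}. \<Prod>b\<in>UNIV. f (card {t :: 'p mod_ring. b + v * t = 0})) = f 1 ^ (CARD('p) * (CARD('p) - 1))"
    by (simp add: card_UNIV_minus_zero power_mult)
  moreover have "(\<Prod>b\<in>UNIV. f (card {t :: 'p mod_ring. b + 0 * t = 0})) = f CARD('p) * f 0 ^ (CARD('p) - 1)"
    by (subst prod.remove[of _ 0]) (simp_all add: card_UNIV_minus_zero)
  ultimately show ?thesis by (subst prod.remove[of _ 0]) simp_all
qed

text \<open>The indices are sorted by (k, m). The pair (0, 0) counts roots of linear polynomials.
  The 2 (p - 1) pairs with exactly one zero entry all give \<open>Z ^ p\<close>, although for
  different reasons. For k, m nonzero the factor depends only on c = k^2 / m, and each c comes from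
  p - 1 pairs and p values of v.\<close>

lemma prod_line_eigenvalues:
  fixes h :: "'p::prime_card mod_ring \<Rightarrow> 'p mod_ring \<Rightarrow> complex" and f :: "complex \<Rightarrow> 'b::comm_semiring_1"
  assumes odd: "odd CARD('p)"
  defines "p \<equiv> CARD('p)"
  shows "(\<Prod>i\<in>UNIV. f (line_eigenvalue h i))
    = f (of_nat (p * p)) * f 0 ^ (p - 1 + p * (p - 1)\<^sup>2) * f (of_nat p) ^ (3 * p * (p - 1))
      * f (of_nat (2 * p)) ^ (p * (p - 1)\<^sup>2)
      * (\<Prod>c\<in>UNIV - {0}. \<Prod>b\<in>UNIV. f (of_real ((cmod (\<Sum>z\<in>UNIV. h c z * addchar (b * z)))\<^sup>2))) ^ (p * (p - 1))"
proof -
  define g where "g n = f (of_nat (p * n))" for n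
  define Z where "Z = g 1 * (g 2 * g 0) ^ ((p - 1) div 2)"
  define G where "G c = (\<Prod>b\<in>UNIV. f (of_real ((cmod (\<Sum>z\<in>UNIV. h c z * addchar (b * z)))\<^sup>2)))" for c
  define e where "e k m = (\<Prod>v\<in>UNIV. \<Prod>b\<in>UNIV. f (line_eigenvalue h (k, m, v, b)))" for k m
  have cz: "card (UNIV - {0 :: 'p mod_ring}) = p - 1" by (simp add: p_def card_UNIV_minus_zero)
  have e00: "e 0 0 = g p * g 0 ^ (p - 1) * g 1 ^ (p * (p - 1))"
    using prod_UNIV_linear_roots[of g, where 'p='p] by (simp add: e_def g_def p_def)
  have e0: "e 0 m = Z ^ p" if "m \<noteq> 0" for m
    using prod_UNIV_quadratic_roots[OF odd that, of g] by (simp add: e_def g_def p_def Z_def)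
  have e1: "e k 0 = Z ^ p" if "k \<noteq> 0" for k
  proof -
    have "(\<Prod>b\<in>UNIV. f (line_eigenvalue h (k, 0, v, b))) 
       = (\<Prod>b :: 'p mod_ring\<in>UNIV. if b = 0 then g 1 else if positive_half b then g 2 else g 0)" for v
      by (intro prod.cong refl) (use that in \<open>simp add: g_def p_def mult.commute\<close>)
    also have "\<dots> = g 1 * (g 2 * g 0) ^ ((p - 1) div 2)"
    proof (rule prod_UNIV_three_values)
      have "{b :: 'p mod_ring. b \<noteq> 0 \<and> positive_half b} = {b. positive_half b}" by (auto simp: positive_half_def)
      then show "card {b :: 'p mod_ring. b \<noteq> 0 \<and> positive_half b} = (p - 1) div 2"
        using card_positive_half(1)[OF odd] by (simp add: p_def)
      show "card {b :: 'p mod_ring. b \<noteq> 0 \<and> \<not> positive_half b} = (p - 1) div 2"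
        using card_positive_half(2)[OF odd] by (simp add: p_def)
    qed
    finally show ?thesis by (simp add: e_def Z_def p_def)
  qed
  have e2: "e k m = G (k\<^sup>2 / m) ^ p" if "k \<noteq> 0" "m \<noteq> 0" for k m
    using that by (simp add: e_def G_def p_def)
  have "(\<Prod>m\<in>UNIV - {0}. e k m) = (\<Prod>c\<in>UNIV - {0}. G c) ^ p" if "k \<noteq> 0" for k
  proof -
    have "(\<Prod>m\<in>UNIV - {0}. e k m) = (\<Prod>m\<in>UNIV - {0}. G (k\<^sup>2 / m)) ^ p"
      using that by (simp add: e2 prod_power_distrib)
    also have "(\<Prod>m\<in>UNIV - {0}. G (k\<^sup>2 / m)) = (\<Prod>c\<in>UNIV - {0}. G c)"
      by (rule prod.reindex_bij_witness[of _ "\<lambda>c. k\<^sup>2 / c" "\<lambda>m. k\<^sup>2 / m"]) (use that in auto)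
    finally show ?thesis .
  qed
  then have rest: "(\<Prod>k\<in>UNIV - {0}. \<Prod>m\<in>UNIV - {0}. e k m) = (\<Prod>c\<in>UNIV - {0}. G c) ^ (p * (p - 1))"
    by (simp add: power_mult cz)
  have row: "(\<Prod>m\<in>UNIV. e k m) = e k 0 * (\<Prod>m\<in>UNIV - {0}. e k m)" for k
    by (rule prod.remove) auto
  have "(\<Prod>i\<in>UNIV. f (line_eigenvalue h i)) = (\<Prod>k\<in>UNIV. \<Prod>m\<in>UNIV. e k m)"
    by (simp add: e_def prod.cartesian_product case_prod_beta del: line_eigenvalue.simps)
  also have "\<dots> = (\<Prod>m\<in>UNIV. e 0 m) * (\<Prod>k\<in>UNIV - {0}. \<Prod>m\<in>UNIV. e k m)"
    by (rule prod.remove) auto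
  also have "\<dots> = e 0 0 * (Z ^ p) ^ (p - 1) * ((Z ^ p) ^ (p - 1) * (\<Prod>c\<in>UNIV - {0}. G c) ^ (p * (p - 1)))"
    by (simp add: row e0 e1 prod.distrib rest cz)
  also have "\<dots> = g p * g 0 ^ (p - 1) * g 1 ^ (p * (p - 1)) * (Z ^ 2) ^ (p * (p - 1)) * (\<Prod>c\<in>UNIV - {0}. G c) ^ (p * (p - 1))"
    by (simp add: e00 power2_eq_square power_mult_distrib mult_ac flip: power_mult)
  also have "Z ^ 2 = g 1 ^ 2 * (g 2 * g 0) ^ (p - 1)"
  proof -
    have "even (p - 1)" using odd by (simp add: p_def)
    then have "(p - 1) div 2 * 2 = p - 1" by simp
    then show ?thesis by (simp add: Z_def power_mult_distrib flip: power_mult)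
  qed
  also have "(g 1 ^ 2 * (g 2 * g 0) ^ (p - 1)) ^ (p * (p - 1)) 
     = g 1 ^ (2 * (p * (p - 1))) * (g 2 ^ (p * (p - 1)\<^sup>2) * g 0 ^ (p * (p - 1)\<^sup>2))"
    by (simp only: power_mult_distrib power_mult[symmetric]) (simp add: power2_eq_square mult_ac)
  also have "g p * g 0 ^ (p - 1) * g 1 ^ (p * (p - 1)) 
       * (g 1 ^ (2 * (p * (p - 1))) * (g 2 ^ (p * (p - 1)\<^sup>2) * g 0 ^ (p * (p - 1)\<^sup>2)))
       * (\<Prod>c\<in>UNIV - {0}. G c) ^ (p * (p - 1))
    = g p * g 0 ^ (p - 1 + p * (p - 1)\<^sup>2) * g 1 ^ (p * (p - 1) + 2 * (p * (p - 1))) * g 2 ^ (p * (p - 1)\<^sup>2)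
       * (\<Prod>c\<in>UNIV - {0}. G c) ^ (p * (p - 1))"
    by (simp only: power_add mult_ac)
  also have "p * (p - 1) + 2 * (p * (p - 1)) = 3 * p * (p - 1)" by simp
  finally show ?thesis by (simp add: g_def G_def mult.commute[of p 2])
qed

section \<open>Reduction to cubic exponential sums\<close>

text \<open>Multiplication by \<open>a\<close> permutes the nonzero elements, so it preserves their
  product.\<close>

lemma mod_ring_fermat:
  fixes a :: "'p::prime_card mod_ring"
  assumes "a \<noteq> 0"
  shows "a ^ (CARD('p) - 1) = 1"
proof -
  let ?U = "UNIV - {0 :: 'p mod_ring}"
  have "\<Prod>?U = (\<Prod>x\<in>?U. a * x)"
    by (rule prod.reindex_bij_witness[of _ "\<lambda>x. a * x" "\<lambda>x. x / a"]) (use assms in auto)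
  also have "\<dots> = a ^ (CARD('p) - 1) * \<Prod>?U"
    by (simp add: prod.distrib card_UNIV_minus_zero)
  finally show ?thesis by simp
qed

lemma of_nat_mod_ring_nonzero: "0 < n \<Longrightarrow> n < CARD('p::prime_card) \<Longrightarrow> (of_nat n :: 'p mod_ring) \<noteq> 0"
  by (simp add: of_nat_mod_ring_eq_0_iff nat_dvd_not_less)

lemma bij_betw_of_nat_nonzero:
  "bij_betw of_nat {1..CARD('p) - 1} (UNIV - {0 :: 'p::prime_card mod_ring})"
proof -
  have "bij_betw of_nat ({..<CARD('p)} - {0}) (UNIV - {of_nat 0 :: 'p mod_ring})"
    by (rule bij_betw_DiffI[OF bij_betw_of_nat_mod_ring]) (auto simp: prime_card prime_gt_0_nat)
  moreover have "{..<CARD('p)} - {0} = {1..CARD('p) - 1}" by auto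
  ultimately show ?thesis by simp
qed

lemma prod_of_nat_nonzero:
  "(\<Prod>c = 1..CARD('p) - 1. g (of_nat c)) = (\<Prod>c\<in>UNIV - {0 :: 'p::prime_card mod_ring}. g c)"
  by (rule prod.reindex_bij_betw[OF bij_betw_of_nat_nonzero])

text \<open>A cubic with no constant and no quadratic term is an odd function, so its exponential sum is real.\<close>

lemma exp_sum_odd_cubic_real:
  "of_real ((cmod (exp_sum (\<lambda>t :: 'p::prime_card mod_ring. a * t ^ 3 + b * t)))\<^sup>2) = (exp_sum (\<lambda>t. a * t ^ 3 + b * t))\<^sup>2"
proof -
  let ?e = "exp_sum (\<lambda>t :: 'p mod_ring. a * t ^ 3 + b * t)"
  have "cnj ?e = (\<Sum>t\<in>UNIV. addchar (a * (- t) ^ 3 + b * (- t)))"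
    by (simp add: exp_sum_addchar flip: addchar_minus)
  also have "\<dots> = ?e" unfolding exp_sum_addchar
    by (rule sum.reindex_bij_witness[of _ uminus uminus]) auto
  finally have "cnj ?e = ?e" .
  moreover have "of_real ((cmod ?e)\<^sup>2) = ?e * cnj ?e" by (simp add: complex_norm_square del: of_real_power)
  ultimately show ?thesis by (simp add: power2_eq_square)
qed

lemma exp_sum_scale:
  "s \<noteq> 0 \<Longrightarrow> exp_sum (\<lambda>t. f (s * t)) = exp_sum (f :: 'p::prime_card mod_ring \<Rightarrow> 'p mod_ring)"
  unfolding exp_sum_addchar by (rule sum_UNIV_scale)

lemma exp_sum_cubic_scale:
  "s \<noteq> 0 \<Longrightarrow> exp_sum (\<lambda>t. a * s ^ 3 * t ^ 3 + b * s * t)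
     = exp_sum (\<lambda>t :: 'p::prime_card mod_ring. a * t ^ 3 + b * t)"
  using exp_sum_scale[of s "\<lambda>t. a * t ^ 3 + b * t"] by (simp add: power_mult_distrib mult_ac)

text \<open>With 3 invertible, \<open>addchar (c / 3 * x ^ 3)\<close> is a phase with the required
  coboundary. The division by 3 disappears again when a = c / 3 is taken as the index of the
  product.\<close>

theorem char_poly_Gamma4:
  fixes vs :: "'p::prime_card point list"
  assumes odd: "odd CARD('p)" and p3: "CARD('p) \<noteq> 3" and vs: "distinct vs" "set vs = UNIV"
  defines "p \<equiv> CARD('p)"
  defines "f \<equiv> \<lambda>\<mu> :: complex. [:of_nat p - \<mu>, 1:]"
  shows "char_poly (adjacency_matrix vs Gamma4_adj)
    = f (of_nat (p * p)) * f 0 ^ (p - 1 + p * (p - 1)\<^sup>2) * f (of_nat p) ^ (3 * p * (p - 1))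
      * f (of_nat (2 * p)) ^ (p * (p - 1)\<^sup>2)
      * (\<Prod>a\<in>UNIV - {0 :: 'p mod_ring}. \<Prod>b\<in>UNIV. f ((exp_sum (\<lambda>t. a * t ^ 3 + b * t))\<^sup>2)) ^ (p * (p - 1))"
proof -
  have three: "(3 :: 'p mod_ring) \<noteq> 0"
  proof
    assume "(3 :: 'p mod_ring) = 0"
    then have "CARD('p) dvd 3" using of_nat_mod_ring_eq_0_iff[of 3, where 'p='p] by simp
    then have "CARD('p) \<le> 3" by (rule dvd_imp_le) simp
    moreover have "CARD('p) > 1" using prime_card[where 'a='p] by (rule prime_gt_1_nat)
    moreover have "CARD('p) \<noteq> 2" using odd by auto
    ultimately show False using p3 by linarith
  qed
  define h where "h c x = addchar (c / 3 * x ^ 3)" for c x :: "'p mod_ring"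
  have coc: "h c (x + y) = addchar (c * (x\<^sup>2 * y + x * y\<^sup>2)) * h c x * h c y" for c x y
    unfolding h_def addchar_add[symmetric]
    by (rule arg_cong[of _ _ addchar]) (use three in \<open>simp add: field_simps power2_eq_square power3_eq_cube\<close>)
  have nh: "norm (h c x) = 1" for c x by (simp add: h_def)
  have S: "(\<Sum>z\<in>UNIV. h c z * addchar (b * z)) = exp_sum (\<lambda>t. c / 3 * t ^ 3 + b * t)" for b c
    by (simp add: h_def exp_sum_addchar addchar_add)
  have "char_poly (adjacency_matrix vs Gamma4_adj) = (\<Prod>i\<in>UNIV. f (line_eigenvalue h i))"
    unfolding f_def p_def by (rule char_poly_collinearity[OF odd coc nh vs])
  moreover have "(\<Prod>c\<in>UNIV - {0 :: 'p mod_ring}. \<Prod>b\<in>UNIV. f ((exp_sum (\<lambda>t. c / 3 * t ^ 3 + b * t))\<^sup>2))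
      = (\<Prod>a\<in>UNIV - {0 :: 'p mod_ring}. \<Prod>b\<in>UNIV. f ((exp_sum (\<lambda>t. a * t ^ 3 + b * t))\<^sup>2))"
    by (rule prod.reindex_bij_witness[of _ "\<lambda>a. 3 * a" "\<lambda>c. c / 3"]) (use three in auto)
  ultimately show ?thesis
    unfolding p_def using prod_line_eigenvalues[OF odd, of f h] by (simp only: S exp_sum_odd_cubic_real)
qed

section \<open>Normal forms of the cubics under scaling of the variable\<close>

lemma exp_sum_bij:
  assumes "bij f"
  shows "exp_sum (f :: 'p::prime_card mod_ring \<Rightarrow> 'p mod_ring) = 0"
  using sum.reindex_bij_betw[OF assms, of addchar] sum_addchar_mult[of "1 :: 'p mod_ring"]
  by (simp add: exp_sum_addchar)

text \<open>For p = 3 k + 2 the power 2 k + 1 inverts cubing by Fermat, because 3 (2 k + 1) = 2 (p -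
  1) + 1.\<close>

lemma bij_cube:
  assumes "[CARD('p) = 2] (mod 3)"
  shows "bij (\<lambda>t :: 'p::prime_card mod_ring. t ^ 3)"
proof -
  have "CARD('p) mod 3 = 2" using assms by (simp add: cong_def)
  then have "CARD('p) = 3 * (CARD('p) div 3) + 2" using div_mult_mod_eq[of "CARD('p)" 3] by linarith
  then obtain k where k: "CARD('p) = 3 * k + 2" by blast
  have "(t ^ 3) ^ (2 * k + 1) = t" for t :: "'p mod_ring"
  proof (cases "t = 0")
    case False
    have e: "3 * (2 * k + 1) = (CARD('p) - 1) * 2 + 1" using k by simp
    have "(t ^ 3) ^ (2 * k + 1) = t ^ ((CARD('p) - 1) * 2 + 1)"
      unfolding power_mult[symmetric] e ..
    also have "\<dots> = (t ^ (CARD('p) - 1)) ^ 2 * t"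
      by (simp only: power_add power_mult power_one_right)
    finally show ?thesis using mod_ring_fermat[OF False] by simp
  qed simp
  then have "inj (\<lambda>t :: 'p mod_ring. t ^ 3)" by (metis injI)
  then show ?thesis by (simp add: bij_betw_def finite_UNIV_inj_surj)
qed

text \<open>Scaling t by a cube root s of 1 / a makes the leading coefficient 1 and sends b to c = b
  s, so each of the p - 1 values of a contributes the same product. The factor \<open>f 0\<close>
  belongs to c = 0, where the sum runs over a permutation.\<close>

lemma prod_cubics_2_mod_3:
  fixes f :: "complex \<Rightarrow> 'b::comm_monoid_mult"
  assumes "[CARD('p::prime_card) = 2] (mod 3)"
  shows "(\<Prod>a\<in>UNIV - {0 :: 'p mod_ring}. \<Prod>b\<in>UNIV. f (exp_sum (\<lambda>t. a * t ^ 3 + b * t)))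
    = (f 0 * (\<Prod>c = 1..CARD('p) - 1. f (exp_sum (\<lambda>t :: 'p mod_ring. t ^ 3 + of_nat c * t)))) ^ (CARD('p) - 1)"
proof -
  have "(\<Prod>b\<in>UNIV. f (exp_sum (\<lambda>t. a * t ^ 3 + b * t)))
    = f 0 * (\<Prod>c\<in>UNIV - {0}. f (exp_sum (\<lambda>t :: 'p mod_ring. t ^ 3 + c * t)))" if a: "a \<noteq> 0" for a :: "'p mod_ring"
  proof -
    have "surj (\<lambda>t :: 'p mod_ring. t ^ 3)" using bij_cube[OF assms] by (rule bij_is_surj)
    then obtain s where "1 / a = s ^ 3" using surjD[of "\<lambda>t :: 'p mod_ring. t ^ 3" "1 / a"] by blast
    then have s: "a * s ^ 3 = 1" "s \<noteq> 0" using a by (auto simp: field_simps)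
    have eq: "exp_sum (\<lambda>t. a * t ^ 3 + b * t) = exp_sum (\<lambda>t. t ^ 3 + b * s * t)" for b :: "'p mod_ring"
      using exp_sum_cubic_scale[OF s(2), of a b] s(1) by simp
    have "(\<Prod>b\<in>UNIV. f (exp_sum (\<lambda>t. a * t ^ 3 + b * t))) = (\<Prod>c :: 'p mod_ring\<in>UNIV. f (exp_sum (\<lambda>t. t ^ 3 + c * t)))"
      unfolding eq by (rule prod.reindex_bij_witness[of _ "\<lambda>c. c / s" "\<lambda>b. b * s"]) (use s in auto)
    also have "\<dots> = f (exp_sum (\<lambda>t :: 'p mod_ring. t ^ 3 + 0 * t)) * (\<Prod>c :: 'p mod_ring\<in>UNIV - {0}. f (exp_sum (\<lambda>t. t ^ 3 + c * t)))"
      by (rule prod.remove) auto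
    finally show ?thesis by (simp add: exp_sum_bij[OF bij_cube[OF assms]])
  qed
  then show ?thesis
    unfolding prod_of_nat_nonzero[of "\<lambda>c. f (exp_sum (\<lambda>t. t ^ 3 + c * t))"]
    by (simp add: card_UNIV_minus_zero)
qed

text \<open>The integer exponents in \<open>primitive_element\<close> are reduced modulo p - 1 by
  Fermat; injectivity then follows by counting.\<close>

lemma primitive_element_bij:
  fixes w :: "'p::prime_card mod_ring"
  assumes "primitive_element w"
  shows "bij_betw (\<lambda>k. w ^ k) {..<CARD('p) - 1} (UNIV - {0})"
proof -
  let ?n = "CARD('p) - 1"
  have w: "w \<noteq> 0" using assms by (simp add: primitive_element_def)
  have n: "?n > 0" using prime_gt_1_nat[OF prime_card[where 'a='p]] by simp
  have "\<exists>k < ?n. x = w ^ k" if "x \<noteq> 0" for x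
  proof -
    have "\<forall>x. x \<noteq> 0 \<longrightarrow> (\<exists>k::int. x = w powi k)"
      using assms unfolding primitive_element_def by (rule conjunct2)
    from this[rule_format, OF that] obtain i :: int where i: "x = w powi i" by (rule exE)
    define k where "k = nat (i mod int ?n)"
    have k: "int k = i mod int ?n" using n by (simp add: k_def)
    have "w powi i = w powi (int ?n * (i div int ?n) + int k)" unfolding k by (simp only: mult_div_mod_eq)
    also have "\<dots> = (w powi int ?n) powi (i div int ?n) * w powi int k"
      by (subst power_int_add) (use w in \<open>simp_all only: power_int_mult not_False_eq_True simp_thms\<close>)
    finally have "x = w ^ k" unfolding i power_int_of_nat mod_ring_fermat[OF w] by simp
    moreover have "k < ?n" using k n pos_mod_bound[of "int ?n" i] by linarith
    ultimately show ?thesis by blast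
  qed
  then have im: "(\<lambda>k. w ^ k) ` {..<?n} = UNIV - {0}" using w by auto
  then have "inj_on (\<lambda>k. w ^ k) {..<?n}"
    by (intro eq_card_imp_inj_on) (simp_all add: card_UNIV_minus_zero)
  with im show ?thesis by (simp add: bij_betw_def)
qed

lemma prod_mod_3:
  "(\<Prod>k<3 * n. g (k mod 3)) = (g 0 * g 1 * g (2 :: nat) :: 'b::comm_monoid_mult) ^ n"
proof (induction n)
  case (Suc n)
  have "3 * Suc n = Suc (Suc (Suc (3 * n)))" by simp
  moreover have "Suc (3 * n) mod 3 = 1" "Suc (Suc (3 * n)) mod 3 = 2" by presburger+
  ultimately have "(\<Prod>k<3 * Suc n. g (k mod 3)) = (\<Prod>k<3 * n. g (k mod 3)) * g (3 * n mod 3) * g 1 * g 2"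
    by (simp only: prod.lessThan_Suc)
  then show ?case using Suc by (simp add: mult_ac)
qed simp

text \<open>For b = 0, scaling t changes a by cubes, so only the exponent of \<open>w\<close> modulo
  3 matters. For b nonzero, scaling t by 1 / b makes the linear coefficient 1 and permutes the
  leading coefficients.\<close>

lemma prod_cubics_1_mod_3:
  fixes f :: "complex \<Rightarrow> 'b::comm_monoid_mult" and w :: "'p::prime_card mod_ring"
  assumes "[CARD('p) = 1] (mod 3)" and w: "primitive_element w"
  shows "(\<Prod>a\<in>UNIV - {0 :: 'p mod_ring}. \<Prod>b\<in>UNIV. f (exp_sum (\<lambda>t. a * t ^ 3 + b * t)))
    = (f (exp_sum (\<lambda>t :: 'p mod_ring. t ^ 3)) * f (exp_sum (\<lambda>t. w * t ^ 3)) * f (exp_sum (\<lambda>t. w\<^sup>2 * t ^ 3))) ^ ((CARD('p) - 1) div 3)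
    * (\<Prod>a = 1..CARD('p) - 1. f (exp_sum (\<lambda>t :: 'p mod_ring. of_nat a * t ^ 3 + t))) ^ (CARD('p) - 1)"
proof -
  let ?n = "CARD('p) - 1"
  have w0: "w \<noteq> 0" using w by (simp add: primitive_element_def)
  have "3 dvd ?n" using assms(1) 
    by (metis cong_altdef_nat' cong_sym cong_to_1_nat)
  then have n: "3 * (?n div 3) = ?n" by simp
  define g where "g k = f (exp_sum (\<lambda>t. w ^ k * t ^ 3))" for k
  have g: "g (k mod 3) = g k" for k
  proof -
    have "w ^ k = w ^ (k mod 3 + k div 3 * 3)" by (rule arg_cong[of _ _ "\<lambda>n. w ^ n"]) simp
    also have "\<dots> = w ^ (k mod 3) * (w ^ (k div 3)) ^ 3" by (simp only: power_add power_mult)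
    finally show ?thesis using exp_sum_cubic_scale[of "w ^ (k div 3)" "w ^ (k mod 3)" 0] w0
      by (simp add: g_def)
  qed
  have "(\<Prod>a :: 'p mod_ring\<in>UNIV - {0}. f (exp_sum (\<lambda>t. a * t ^ 3))) = (\<Prod>k<?n. g k)"
    unfolding g_def by (rule prod.reindex_bij_betw[OF primitive_element_bij[OF w], symmetric])
  also have "\<dots> = (\<Prod>k<3 * (?n div 3). g (k mod 3))" by (simp only: n g)
  also have "\<dots> = (g 0 * g 1 * g 2) ^ (?n div 3)" by (rule prod_mod_3)
  finally have b0: "(\<Prod>a :: 'p mod_ring\<in>UNIV - {0}. f (exp_sum (\<lambda>t. a * t ^ 3 + 0 * t))) = (g 0 * g 1 * g 2) ^ (?n div 3)"
    by simp
  have b: "(\<Prod>a :: 'p mod_ring\<in>UNIV - {0}. f (exp_sum (\<lambda>t. a * t ^ 3 + b * t))) = (\<Prod>a :: 'p mod_ring\<in>UNIV - {0}. f (exp_sum (\<lambda>t. a * t ^ 3 + t)))"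
    if "b \<noteq> 0" for b
  proof -
    have "exp_sum (\<lambda>t. a * t ^ 3 + b * t) = exp_sum (\<lambda>t. a / b ^ 3 * t ^ 3 + t)" for a
    proof -
      have "a * (1 / b) ^ 3 = a / b ^ 3" "b * (1 / b) = 1" "1 / b \<noteq> 0"
        using that by (simp_all add: power_divide)
      then show ?thesis using exp_sum_cubic_scale[of "1 / b" a b] by simp
    qed
    then show ?thesis
      by (intro prod.reindex_bij_witness[of _ "\<lambda>a. a * b ^ 3" "\<lambda>a. a / b ^ 3"]) (use that in auto)
  qed
  have "(\<Prod>a :: 'p mod_ring\<in>UNIV - {0}. \<Prod>b :: 'p mod_ring\<in>UNIV. f (exp_sum (\<lambda>t. a * t ^ 3 + b * t)))
      = (\<Prod>b :: 'p mod_ring\<in>UNIV. \<Prod>a :: 'p mod_ring\<in>UNIV - {0}. f (exp_sum (\<lambda>t. a * t ^ 3 + b * t)))"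
    by (rule prod.swap)
  also have "\<dots> = (\<Prod>a :: 'p mod_ring\<in>UNIV - {0}. f (exp_sum (\<lambda>t. a * t ^ 3 + 0 * t)))
      * (\<Prod>b :: 'p mod_ring\<in>UNIV - {0}. \<Prod>a :: 'p mod_ring\<in>UNIV - {0}. f (exp_sum (\<lambda>t. a * t ^ 3 + b * t)))"
    by (rule prod.remove) auto
  also have "\<dots> = (g 0 * g 1 * g 2) ^ (?n div 3) * (\<Prod>a :: 'p mod_ring\<in>UNIV - {0}. f (exp_sum (\<lambda>t. a * t ^ 3 + t))) ^ ?n"
    unfolding b0 by (simp add: b card_UNIV_minus_zero)
  finally show ?thesis
    unfolding prod_of_nat_nonzero[of "\<lambda>a. f (exp_sum (\<lambda>t. a * t ^ 3 + t))"] by (simp add: g_def)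
qed

section \<open>Power sums\<close>

text \<open>If p - 1 does not divide n, some nonzero a has \<open>a ^ n \<noteq> 1\<close>:
  otherwise x^r - 1 with r = n mod (p - 1) would have p - 1 > r roots. Scaling by this a multiplies
  the sum by \<open>a ^ n\<close>, so the sum is 0.\<close>

lemma sum_power_mod_ring:
  "(\<Sum>t\<in>UNIV. t ^ n) = (if n > 0 \<and> CARD('p) - 1 dvd n then - 1 else (0 :: 'p::prime_card mod_ring))"
proof (cases "CARD('p) - 1 dvd n")
  case True
  then obtain k where k: "n = (CARD('p) - 1) * k" by blast
  have "t ^ n = 1" if "t \<noteq> 0" for t :: "'p mod_ring"
    using mod_ring_fermat[OF that] by (simp add: k power_mult)
  then have "(\<Sum>t\<in>UNIV - {0 :: 'p mod_ring}. t ^ n) = (\<Sum>t\<in>UNIV - {0 :: 'p mod_ring}. 1)" by (intro sum.cong) auto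
  also have "\<dots> = of_nat (CARD('p) - 1)" by (simp add: card_UNIV_minus_zero del: of_nat_diff)
  also have "\<dots> = - 1"
    using prime_gt_0_nat[OF prime_card[where 'a='p]] by (simp add: of_nat_diff)
  \<comment> \<open>The term t = 0 is split off: for n = 0 it is \<open>0 ^ 0 = 1\<close> and
    cancels the - 1, for n > 0 it is 0.\<close>
  finally have "(\<Sum>t\<in>UNIV. t ^ n) = 0 ^ n + (- 1 :: 'p mod_ring)"
    by (subst sum.remove[of _ 0]) auto
  then show ?thesis using True by (cases "n = 0") auto
next
  case False
  define r where "r = n mod (CARD('p) - 1)"
  have p1: "CARD('p) - 1 > 0" using prime_gt_1_nat[OF prime_card[where 'a='p]] by simp
  have r: "0 < r" "r < CARD('p) - 1" using False p1 by (simp_all add: r_def mod_greater_zero_iff_not_dvd)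
  have "\<exists>a :: 'p mod_ring. a \<noteq> 0 \<and> a ^ n \<noteq> 1"
  proof (rule ccontr)
    assume "\<not> ?thesis"
    then have one: "a ^ n = 1" if "a \<noteq> 0" for a :: "'p mod_ring" using that by blast
    define q where "q = Polynomial.monom (1 :: 'p mod_ring) r - 1"
    have cq: "Polynomial.coeff q r = 1" using r by (simp add: q_def coeff_1)
    then have q0: "q \<noteq> 0" by auto
    have "degree q \<le> r" using r unfolding q_def by (intro degree_diff_le degree_monom_le) auto
    have "UNIV - {0} \<subseteq> {a. poly q a = 0}"
    proof
      fix a :: "'p mod_ring" assume "a \<in> UNIV - {0}"
      then have a: "a \<noteq> 0" by simp
      have "a ^ n = a ^ ((CARD('p) - 1) * (n div (CARD('p) - 1)) + r)"
        unfolding r_def by (simp only: mult_div_mod_eq)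
      also have "\<dots> = a ^ r" unfolding power_add power_mult mod_ring_fermat[OF a] by simp
      finally show "a \<in> {a. poly q a = 0}" using one[OF a] by (simp add: q_def poly_monom)
    qed
    then have "card (UNIV - {0 :: 'p mod_ring}) \<le> card {a. poly q a = 0}"
      by (rule card_mono[rotated]) simp
    also have "\<dots> \<le> degree q" by (rule card_poly_roots_bound[OF q0])
    finally show False using r \<open>degree q \<le> r\<close> by (simp add: card_UNIV_minus_zero)
  qed
  then obtain a :: "'p mod_ring" where a: "a \<noteq> 0" "a ^ n \<noteq> 1" by blast
  have "(\<Sum>t :: 'p mod_ring\<in>UNIV. t ^ n) = (\<Sum>t\<in>UNIV. (a * t) ^ n)" by (rule sum_UNIV_scale[OF a(1), symmetric])
  also have "\<dots> = a ^ n * (\<Sum>t :: 'p mod_ring\<in>UNIV. t ^ n)" by (simp add: power_mult_distrib sum_distrib_left)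
  finally have "(1 - a ^ n) * (\<Sum>t :: 'p mod_ring\<in>UNIV. t ^ n) = 0" by (simp add: algebra_simps)
  then show ?thesis using a(2) False by auto
qed

lemma addchar_independent_power_sum:
  fixes N :: "'p::prime_card mod_ring \<Rightarrow> int"
  assumes "(\<Sum>v\<in>UNIV. of_int (N v) * addchar v) = 0" and j: "0 < j" "j < CARD('p) - 1"
  shows "(\<Sum>v\<in>UNIV. of_int (N v) * v ^ j) = (0 :: 'p mod_ring)"
proof -
  obtain c where "N v = c" for v using addchar_independent[OF assms(1)] by blast
  then have "(\<Sum>v\<in>UNIV. of_int (N v) * v ^ j) = of_int c * (\<Sum>v\<in>UNIV. v ^ j :: 'p mod_ring)"
    by (simp add: sum_distrib_left)
  moreover have "\<not> CARD('p) - 1 dvd j" using j by (auto dest: dvd_imp_le)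
  ultimately show ?thesis by (simp add: sum_power_mod_ring)
qed

text \<open>Exponential sums and power sums both depend on \<open>F\<close> only through its fibre
  sizes. These integers are the coefficients to which the linear independence of character values
  applies.\<close>

lemma sum_compose_count:
  fixes F :: "'i::finite \<Rightarrow> 'a::finite" and g :: "'a \<Rightarrow> 'b::comm_ring_1"
  shows "(\<Sum>i\<in>UNIV. g (F i)) = (\<Sum>v\<in>UNIV. of_int (int (card {i. F i = v})) * g v)"
proof -
  have "(\<Sum>i\<in>UNIV. g (F i)) = (\<Sum>v\<in>UNIV. \<Sum>i\<in>{i \<in> UNIV. F i = v}. g (F i))"
    by (rule sum.group[symmetric]) auto
  also have "\<dots> = (\<Sum>v\<in>UNIV. of_int (int (card {i. F i = v})) * g v)" by (intro sum.cong refl) simp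
  finally show ?thesis .
qed

lemma sum_pairs_add:
  "(\<Sum>i\<in>UNIV. g ((\<lambda>(a, b). f a + f b) i)) = (\<Sum>a\<in>UNIV. \<Sum>b\<in>UNIV. g (f a + f b))"
  for f :: "'a::finite \<Rightarrow> 'b::plus"
  by (simp add: sum.cartesian_product case_prod_beta)

definition power_sum :: "('p::prime_card mod_ring \<Rightarrow> 'p mod_ring) \<Rightarrow> nat \<Rightarrow> 'p mod_ring" where
  "power_sum f j = (\<Sum>a\<in>UNIV. f a ^ j)"

lemma power_sum_0: "power_sum f 0 = 0"
  by (simp add: power_sum_def)

lemma exp_sum_eq_imp_power_sum_eq:
  fixes f g :: "'p::prime_card mod_ring \<Rightarrow> 'p mod_ring"
  assumes "exp_sum f = exp_sum g" and j: "0 < j" "j < CARD('p) - 1"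
  shows "power_sum f j = power_sum g j"
proof -
  let ?N = "\<lambda>v. int (card {a. f a = v}) - int (card {a. g a = v})"
  have "(\<Sum>v\<in>UNIV. of_int (?N v) * addchar v) = exp_sum f - exp_sum g"
    unfolding exp_sum_addchar sum_compose_count[of addchar]
    by (simp only: of_int_diff left_diff_distrib sum_subtractf)
  then have "(\<Sum>v\<in>UNIV. of_int (?N v) * v ^ j) = (0 :: 'p mod_ring)"
    using assms(1) by (intro addchar_independent_power_sum j) simp
  then have "power_sum f j - power_sum g j = 0"
    unfolding power_sum_def sum_compose_count[of "\<lambda>v. v ^ j"]
    by (simp only: of_int_diff left_diff_distrib sum_subtractf)
  then show ?thesis by simp
qed

lemma exp_sum_eq_minus_imp_power_sum_eq_minus:
  fixes f g :: "'p::prime_card mod_ring \<Rightarrow> 'p mod_ring"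
  assumes "exp_sum f = - exp_sum g" and j: "0 < j" "j < CARD('p) - 1"
  shows "power_sum f j = - power_sum g j"
proof -
  let ?N = "\<lambda>v. int (card {a. f a = v}) + int (card {a. g a = v})"
  have "(\<Sum>v\<in>UNIV. of_int (?N v) * addchar v) = exp_sum f + exp_sum g"
    unfolding exp_sum_addchar sum_compose_count[of addchar]
    by (simp only: of_int_add distrib_right sum.distrib)
  then have "(\<Sum>v\<in>UNIV. of_int (?N v) * v ^ j) = (0 :: 'p mod_ring)"
    using assms(1) by (intro addchar_independent_power_sum j) simp
  then have "power_sum f j + power_sum g j = 0"
    unfolding power_sum_def sum_compose_count[of "\<lambda>v. v ^ j"]
    by (simp only: of_int_add distrib_right sum.distrib)
  then show ?thesis by (simp add: eq_neg_iff_add_eq_0)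
qed

text \<open>The binomial coefficient divides n!, and a prime above n does not.\<close>

lemma of_nat_choose_nonzero:
  assumes "n < CARD('p)" "k \<le> n"
  shows "(of_nat (n choose k) :: 'p::prime_card mod_ring) \<noteq> 0"
proof
  assume "(of_nat (n choose k) :: 'p mod_ring) = 0"
  then have "CARD('p) dvd n choose k" by (simp only: of_nat_mod_ring_eq_0_iff)
  then have "CARD('p) dvd fact n" using binomial_fact_lemma[OF assms(2)] by (metis dvd_mult)
  then show False using assms(1) prime_card[where 'a='p] by (simp add: prime_dvd_fact_iff)
qed

text \<open>If \<open>j\<close> is minimal with nonzero power sum, then the double power sum of order \<open>2 * j\<close>
  attached to the square of the exponential sum has a single nonzero term, the middle one.\<close>

lemma exp_sum_square_not_integer:
  fixes f :: "'p::prime_card mod_ring \<Rightarrow> 'p mod_ring"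
  assumes low: "\<And>i. 0 < i \<Longrightarrow> i < j \<Longrightarrow> power_sum f i = 0" and nz: "power_sum f j \<noteq> 0"
    and j: "2 * j < CARD('p) - 1"
  shows "(exp_sum f)\<^sup>2 \<noteq> of_int n"
proof
  assume sq: "(exp_sum f)\<^sup>2 = of_int n"
  have j0: "0 < j" using nz by (cases "j = 0") (auto simp: power_sum_0)
  define F where "F = (\<lambda>(a, b). f a + f b)"
  \<comment> \<open>Since \<open>addchar 0 = 1\<close>, the integer n is absorbed into the
    coefficient at v = 0, where it does not affect power sums of positive order.\<close>
  let ?N = "\<lambda>v. int (card {i. F i = v}) - n * of_bool (v = 0)"
  note sumF = sum_pairs_add[of _ f, folded F_def]
  have "(\<Sum>v\<in>UNIV. of_int (?N v) * addchar v)
      = (\<Sum>v\<in>UNIV. of_int (int (card {i. F i = v})) * addchar v) - (\<Sum>v :: 'p mod_ring\<in>UNIV. of_bool (v = 0) * (of_int n * addchar v))"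
    unfolding sum_subtractf[symmetric] by (intro sum.cong refl) (auto simp: left_diff_distrib)
  also have "(\<Sum>v :: 'p mod_ring\<in>UNIV. of_bool (v = 0) * (of_int n * addchar v)) = of_int n * addchar (0 :: 'p mod_ring)"
    by (rule sum_of_bool_eq_mult)
  also have "(\<Sum>v\<in>UNIV. of_int (int (card {i. F i = v})) * addchar v) = (\<Sum>i\<in>UNIV. addchar (F i))"
    by (rule sum_compose_count[symmetric])
  also have "\<dots> = (exp_sum f)\<^sup>2"
    by (simp add: sumF exp_sum_addchar power2_eq_square sum_product addchar_add)
  finally have "(\<Sum>v\<in>UNIV. of_int (?N v) * v ^ (2 * j)) = (0 :: 'p mod_ring)"
    using sq j j0 by (intro addchar_independent_power_sum) simp_all
  moreover have "(\<Sum>v\<in>UNIV. of_int (?N v) * v ^ (2 * j))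
      = (\<Sum>v\<in>UNIV. of_int (int (card {i. F i = v})) * v ^ (2 * j) :: 'p mod_ring)"
    using j0 by (intro sum.cong refl) (auto simp: zero_power)
  moreover have "\<dots> = (\<Sum>i\<in>UNIV. F i ^ (2 * j))" by (rule sum_compose_count[symmetric])
  moreover have "\<dots> = (\<Sum>a\<in>UNIV. \<Sum>b\<in>UNIV. (f a + f b) ^ (2 * j))" by (rule sumF)
  ultimately have "0 = (\<Sum>a\<in>UNIV. \<Sum>b\<in>UNIV. (f a + f b) ^ (2 * j))" by simp
  also have "\<dots> = (\<Sum>a\<in>UNIV. \<Sum>b\<in>UNIV. \<Sum>i\<le>2 * j. of_nat (2 * j choose i) * (f a ^ i * f b ^ (2 * j - i)))"
    by (simp add: binomial_ring mult.assoc)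
  also have "\<dots> = (\<Sum>a\<in>UNIV. \<Sum>i\<le>2 * j. \<Sum>b\<in>UNIV. of_nat (2 * j choose i) * (f a ^ i * f b ^ (2 * j - i)))"
    by (rule sum.cong[OF refl], rule sum.swap)
  also have "\<dots> = (\<Sum>i\<le>2 * j. \<Sum>a\<in>UNIV. \<Sum>b\<in>UNIV. of_nat (2 * j choose i) * (f a ^ i * f b ^ (2 * j - i)))"
    by (rule sum.swap)
  also have "\<dots> = (\<Sum>i\<le>2 * j. of_nat (2 * j choose i) * (power_sum f i * power_sum f (2 * j - i)))"
    unfolding power_sum_def sum_product by (simp only: sum_distrib_left)
  also have "\<dots> = (\<Sum>i\<in>{j}. of_nat (2 * j choose i) * (power_sum f i * power_sum f (2 * j - i)))"
  proof (rule sum.mono_neutral_right)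
    show "\<forall>i\<in>{..2 * j} - {j}. of_nat (2 * j choose i) * (power_sum f i * power_sum f (2 * j - i)) = 0"
    proof
      fix i assume "i \<in> {..2 * j} - {j}"
      then have "i < j \<or> 2 * j - i < j" by auto
      \<comment> \<open>The index 0 is included, because the power sum of order 0 is p, hence zero
        in the field.\<close>
      then have "power_sum f i = 0 \<or> power_sum f (2 * j - i) = 0"
        using low power_sum_0 by (metis gr0I)
      then show "of_nat (2 * j choose i) * (power_sum f i * power_sum f (2 * j - i)) = 0" by auto
    qed
  qed auto
  also have "\<dots> = of_nat (2 * j choose j) * (power_sum f j)\<^sup>2" by (simp add: power2_eq_square)
  finally have "(of_nat (2 * j choose j) :: 'p mod_ring) = 0" using nz by simp
  moreover have "(of_nat (2 * j choose j) :: 'p mod_ring) \<noteq> 0"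
    by (rule of_nat_choose_nonzero) (use j in auto)
  ultimately show False by blast
qed

text \<open>Binomial expansion produces the monomials \<open>t ^ (j + 2 * i)\<close>; summation over
  the field keeps those whose exponent, positive because j is, is a multiple of p - 1, each with the
  sign - 1.\<close>

lemma power_sum_cubic:
  fixes a b :: "'p::prime_card mod_ring"
  assumes "0 < j"
  shows "power_sum (\<lambda>t. a * t ^ 3 + b * t) j
    = - (\<Sum>i | i \<le> j \<and> CARD('p) - 1 dvd j + 2 * i. of_nat (j choose i) * a ^ i * b ^ (j - i))"
proof -
  have "(a * t ^ 3 + b * t) ^ j = (\<Sum>i\<le>j. of_nat (j choose i) * a ^ i * b ^ (j - i) * t ^ (j + 2 * i))" for t
    unfolding binomial_ring
  proof (intro sum.cong refl)
    fix i assume "i \<in> {..j}"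
    then have "j + 2 * i = 3 * i + (j - i)" by simp
    then have e: "t ^ (j + 2 * i) = (t ^ 3) ^ i * t ^ (j - i)" by (simp only: power_mult power_add)
    show "of_nat (j choose i) * (a * t ^ 3) ^ i * (b * t) ^ (j - i)
       = of_nat (j choose i) * a ^ i * b ^ (j - i) * t ^ (j + 2 * i)"
      unfolding e power_mult_distrib by (simp only: mult_ac)
  qed
  then have "power_sum (\<lambda>t. a * t ^ 3 + b * t) j
     = (\<Sum>t\<in>UNIV. \<Sum>i\<le>j. of_nat (j choose i) * a ^ i * b ^ (j - i) * t ^ (j + 2 * i))"
    by (simp add: power_sum_def)
  also have "\<dots> = (\<Sum>i\<le>j. \<Sum>t\<in>UNIV. of_nat (j choose i) * a ^ i * b ^ (j - i) * t ^ (j + 2 * i))"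
    by (rule sum.swap)
  also have "\<dots> = (\<Sum>i\<le>j. of_nat (j choose i) * a ^ i * b ^ (j - i) * (\<Sum>t\<in>UNIV. t ^ (j + 2 * i)))"
    by (simp only: sum_distrib_left)
  also have "\<dots> = (\<Sum>i\<le>j. if CARD('p) - 1 dvd j + 2 * i then - (of_nat (j choose i) * a ^ i * b ^ (j - i)) else 0)"
    using assms by (intro sum.cong refl) (simp add: sum_power_mod_ring)
  also have "\<dots> = - (\<Sum>i | i \<le> j \<and> CARD('p) - 1 dvd j + 2 * i. of_nat (j choose i) * a ^ i * b ^ (j - i))"
    by (simp add: sum.If_cases sum_negf Int_def)
  finally show ?thesis .
qed

lemma power_sum_cubic_eq_0:
  fixes a b :: "'p::prime_card mod_ring"
  assumes "0 < j" "3 * j < CARD('p) - 1"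
  shows "power_sum (\<lambda>t. a * t ^ 3 + b * t) j = 0"
proof -
  have none: "{i. i \<le> j \<and> CARD('p) - 1 dvd j + 2 * i} = {}" using assms by (auto dest: dvd_imp_le)
  show ?thesis unfolding power_sum_cubic[OF assms(1)] none by simp
qed

text \<open>The exponents \<open>j + 2 * i\<close> are positive and at most 3 j, so p - 1 is the
  only multiple of p - 1 among them.\<close>

lemma power_sum_cubic_single:
  fixes a b :: "'p::prime_card mod_ring"
  assumes "0 < j" "3 * j < 2 * (CARD('p) - 1)" "j + 2 * i = CARD('p) - 1" "i \<le> j"
  shows "power_sum (\<lambda>t. a * t ^ 3 + b * t) j = - (of_nat (j choose i) * a ^ i * b ^ (j - i))"
proof -
  have "{i. i \<le> j \<and> CARD('p) - 1 dvd j + 2 * i} = {i}"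
  proof -
    have "k = i" if k: "k \<le> j" "CARD('p) - 1 dvd j + 2 * k" for k
    proof -
      obtain q where q: "j + 2 * k = (CARD('p) - 1) * q" using k(2) by blast
      have "(CARD('p) - 1) * q < (CARD('p) - 1) * 2" using q k(1) assms(2) by linarith
      then have "q < 2" using nat_mult_less_cancel_disj by blast
      moreover have "q \<noteq> 0" 
      proof
        assume "q = 0"
        with q assms(1) show False by simp
      qed
      ultimately have "q = 1" by linarith
      then show ?thesis using q assms(3) by simp
    qed
    moreover have "CARD('p) - 1 dvd j + 2 * i" by (simp only: assms(3) dvd_refl)
    ultimately show ?thesis using assms(4) by blast
  qed
  then show ?thesis unfolding power_sum_cubic[OF assms(1)] by simp
qed

section \<open>Distinctness of the eigenvalues\<close>

text \<open>For \<open>p = 7\<close> and \<open>j = 4\<close> the exponent \<open>2 * (p - 1)\<close> also contributes, which is the second summand.\<close>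

lemma power_sum_cubic_1_mod_3:
  fixes a b :: "'p::prime_card mod_ring"
  assumes p: "CARD('p) = 6 * m + 1" and m: "0 < m"
  shows "power_sum (\<lambda>t. a * t ^ 3 + b * t) (2 * m) = - (a ^ (2 * m))"
    and "power_sum (\<lambda>t. a * t ^ 3 + b * t) (2 * m + 2)
      = - (of_nat (2 * m + 2 choose (2 * m - 1)) * (a ^ (2 * m - 1) * b ^ 3) + of_bool (m = 1) * (a ^ (2 * m)) ^ 2)"
proof -
  show "power_sum (\<lambda>t. a * t ^ 3 + b * t) (2 * m) = - (a ^ (2 * m))"
    using power_sum_cubic_single[of "2 * m" "2 * m" a b] p m by simp
  show "power_sum (\<lambda>t. a * t ^ 3 + b * t) (2 * m + 2)
      = - (of_nat (2 * m + 2 choose (2 * m - 1)) * (a ^ (2 * m - 1) * b ^ 3) + of_bool (m = 1) * (a ^ (2 * m)) ^ 2)"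
  proof (cases "m = 1")
    case False
    have "2 * m + 2 - (2 * m - 1) = 3" using m by linarith
    moreover have "2 * m + 2 + 2 * (2 * m - 1) = CARD('p) - 1" using p m by linarith
    ultimately show ?thesis
      using power_sum_cubic_single[of "2 * m + 2" "2 * m - 1" a b] p m False by (simp add: mult.assoc)
  next
    \<comment> \<open>The extra term is a^4. Written as \<open>(a ^ (2 * m)) ^ 2\<close>, it is a
      function of the power sum of order 2 m and cancels once those power sums agree.\<close>
    case True
    then have p7: "CARD('p) = 7" using p by simp
    have "{i. i \<le> 4 \<and> CARD('p) - 1 dvd 4 + 2 * i} = {1, 4 :: nat}"
    proof -
      have "i = 0 \<or> i = 1 \<or> i = 2 \<or> i = 3 \<or> i = 4" if "i \<le> 4" for i :: nat using that by linarith
      then show ?thesis unfolding p7 by force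
    qed
    then show ?thesis using power_sum_cubic[of 4 a b] True by (simp add: numeral_eq_Suc)
  qed
qed

text \<open>The order 2 m = (p - 1) / 3 is the first at which the degree 3 j reaches p - 1, and
  there only the leading term \<open>a ^ (2 * m)\<close> survives.\<close>

lemma exp_sum_cubic_not_integer_1_mod_3:
  fixes a b :: "'p::prime_card mod_ring"
  assumes p: "CARD('p) = 6 * m + 1" and m: "0 < m" and a: "a \<noteq> 0"
  shows "(exp_sum (\<lambda>t. a * t ^ 3 + b * t))\<^sup>2 \<noteq> of_int n"
proof (rule exp_sum_square_not_integer[of "2 * m"])
  show "power_sum (\<lambda>t. a * t ^ 3 + b * t) i = 0" if "0 < i" "i < 2 * m" for i
    by (rule power_sum_cubic_eq_0) (use that p in auto)
  show "power_sum (\<lambda>t. a * t ^ 3 + b * t) (2 * m) \<noteq> 0"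
    unfolding power_sum_cubic_1_mod_3(1)[OF p m] using a by simp
qed (use p m in simp)

text \<open>The sign is fixed because \<open>a ^ (2 * m)\<close> is a cube root of unity.\<close>

lemma exp_sum_cubic_square_eq_1_mod_3:
  fixes a b a' b' :: "'p::prime_card mod_ring"
  assumes p: "CARD('p) = 6 * m + 1" and m: "0 < m" and a: "a \<noteq> 0" "a' \<noteq> 0" and odd: "odd CARD('p)"
    and eq: "(exp_sum (\<lambda>t. a * t ^ 3 + b * t))\<^sup>2 = (exp_sum (\<lambda>t. a' * t ^ 3 + b' * t))\<^sup>2"
  shows "a ^ (2 * m) = a' ^ (2 * m)" and "a ^ (2 * m - 1) * b ^ 3 = a' ^ (2 * m - 1) * b' ^ 3"
proof -
  let ?f = "\<lambda>t. a * t ^ 3 + b * t" and ?g = "\<lambda>t. a' * t ^ 3 + b' * t"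
  have "exp_sum ?f \<noteq> - exp_sum ?g"
  proof
    assume "exp_sum ?f = - exp_sum ?g"
    then have "power_sum ?f (2 * m) = - power_sum ?g (2 * m)"
      by (rule exp_sum_eq_minus_imp_power_sum_eq_minus) (use p m in auto)
    then have neg: "a ^ (2 * m) = - (a' ^ (2 * m))"
      unfolding power_sum_cubic_1_mod_3(1)[OF p m] by (metis minus_minus)
    have "(c ^ (2 * m)) ^ 3 = 1" if "c \<noteq> 0" for c :: "'p mod_ring"
      using mod_ring_fermat[OF that] p by (simp add: mult.commute flip: power_mult)
    from this[OF a(1)] this[OF a(2)] have "(1 :: 'p mod_ring) = - 1" unfolding neg by simp
    then show False using eq_minus_iff_mod_ring[OF odd, of 1] by simp
  qed
  then have e: "exp_sum ?f = exp_sum ?g" using eq by (simp add: power2_eq_iff)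
  have "power_sum ?f (2 * m) = power_sum ?g (2 * m)"
    by (rule exp_sum_eq_imp_power_sum_eq[OF e]) (use p m in auto)
  then show 1: "a ^ (2 * m) = a' ^ (2 * m)"
    unfolding power_sum_cubic_1_mod_3(1)[OF p m] by simp
  have "power_sum ?f (2 * m + 2) = power_sum ?g (2 * m + 2)"
    by (rule exp_sum_eq_imp_power_sum_eq[OF e]) (use p m in auto)
  then have "(of_nat (2 * m + 2 choose (2 * m - 1)) :: 'p mod_ring) * (a ^ (2 * m - 1) * b ^ 3)
      = of_nat (2 * m + 2 choose (2 * m - 1)) * (a' ^ (2 * m - 1) * b' ^ 3)"
    unfolding power_sum_cubic_1_mod_3(2)[OF p m] 1 by simp
  moreover have nz: "(of_nat (2 * m + 2 choose (2 * m - 1)) :: 'p mod_ring) \<noteq> 0"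
    by (rule of_nat_choose_nonzero) (use p m in auto)
  ultimately show "a ^ (2 * m - 1) * b ^ 3 = a' ^ (2 * m - 1) * b' ^ 3"
    by (simp only: mult_left_cancel[OF nz])
qed

text \<open>Now p - 1 = 6 m + 4, which \<open>j + 2 * i\<close> attains at i = 2 m + 1 for j = 2 m +
  2 and at i = 2 m for j = 2 m + 4. For the larger order m > 0 keeps 2 (p - 1) out of reach.\<close>

lemma power_sum_cubic_2_mod_3:
  fixes c :: "'p::prime_card mod_ring"
  assumes p: "CARD('p) = 6 * m + 5" and m: "0 < m"
  shows "power_sum (\<lambda>t. t ^ 3 + c * t) (2 * m + 2) = - (of_nat (2 * m + 2) * c)"
    and "power_sum (\<lambda>t. t ^ 3 + c * t) (2 * m + 4) = - (of_nat (2 * m + 4 choose (2 * m)) * c ^ 4)"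
proof -
  have "2 * m + 2 choose (2 * m + 1) = 2 * m + 2" using binomial_Suc_n[of "2 * m + 1"] by simp
  then show "power_sum (\<lambda>t. t ^ 3 + c * t) (2 * m + 2) = - (of_nat (2 * m + 2) * c)"
    using power_sum_cubic_single[of "2 * m + 2" "2 * m + 1" 1 c] p m by simp
  show "power_sum (\<lambda>t. t ^ 3 + c * t) (2 * m + 4) = - (of_nat (2 * m + 4 choose (2 * m)) * c ^ 4)"
    using power_sum_cubic_single[of "2 * m + 4" "2 * m" 1 c] p m by simp
qed

text \<open>Orders up to 2 m + 1 have degree at most 6 m + 3 < p - 1, so 2 m + 2 is the first order
  that can survive; m > 0 keeps the doubled order 4 m + 4 below p - 1.\<close>

lemma exp_sum_cubic_not_integer_2_mod_3:
  fixes c :: "'p::prime_card mod_ring"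
  assumes p: "CARD('p) = 6 * m + 5" and m: "0 < m" and c: "c \<noteq> 0"
  shows "(exp_sum (\<lambda>t. t ^ 3 + c * t))\<^sup>2 \<noteq> of_int n"
proof (rule exp_sum_square_not_integer[of "2 * m + 2"])
  show "power_sum (\<lambda>t. t ^ 3 + c * t) i = 0" if "0 < i" "i < 2 * m + 2" for i
    using power_sum_cubic_eq_0[of i 1 c] that p by simp
  have "(of_nat (2 * m + 2) :: 'p mod_ring) \<noteq> 0" by (rule of_nat_mod_ring_nonzero) (use p in auto)
  then show "power_sum (\<lambda>t. t ^ 3 + c * t) (2 * m + 2) \<noteq> 0"
    unfolding power_sum_cubic_2_mod_3(1)[OF p m] using c by (simp only: neg_equal_0_iff_equal mult_eq_0_iff simp_thms)
qed (use p m in simp)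

text \<open>The power sum of order 2 m + 2 is linear in the coefficient, giving c = d if the
  exponential sums agree and c = - d if they are opposite. In the second case order 2 m + 4 involves
  only c^4 = d^4, so it equals its own negative and forces d = 0.\<close>

lemma exp_sum_cubic_square_inj_2_mod_3:
  fixes c d :: "'p::prime_card mod_ring"
  assumes p: "CARD('p) = 6 * m + 5" and m: "0 < m" and c: "c \<noteq> 0" and odd: "odd CARD('p)"
    and eq: "(exp_sum (\<lambda>t. t ^ 3 + c * t))\<^sup>2 = (exp_sum (\<lambda>t. t ^ 3 + d * t))\<^sup>2"
  shows "c = d"
proof -
  let ?f = "\<lambda>t. t ^ 3 + c * t" and ?g = "\<lambda>t. t ^ 3 + d * t"
  have nz: "(of_nat (2 * m + 2) :: 'p mod_ring) \<noteq> 0" by (rule of_nat_mod_ring_nonzero) (use p in auto)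
  have nz4: "(of_nat (2 * m + 4 choose (2 * m)) :: 'p mod_ring) \<noteq> 0"
    by (rule of_nat_choose_nonzero) (use p m in auto)
  have "exp_sum ?f \<noteq> - exp_sum ?g"
  proof
    assume e: "exp_sum ?f = - exp_sum ?g"
    have "power_sum ?f (2 * m + 2) = - power_sum ?g (2 * m + 2)"
      by (rule exp_sum_eq_minus_imp_power_sum_eq_minus[OF e]) (use p m in auto)
    then have "of_nat (2 * m + 2) * c = of_nat (2 * m + 2) * (- d)"
      unfolding power_sum_cubic_2_mod_3(1)[OF p m] by (simp only: minus_minus mult_minus_right) (metis minus_minus)
    then have "c = - d" by (simp only: mult_left_cancel[OF nz])
    then have cd: "c ^ 4 = d ^ 4" by simp
    have "power_sum ?f (2 * m + 4) = - power_sum ?g (2 * m + 4)"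
      by (rule exp_sum_eq_minus_imp_power_sum_eq_minus[OF e]) (use p m in auto)
    then have "power_sum ?g (2 * m + 4) = - power_sum ?g (2 * m + 4)"
      unfolding power_sum_cubic_2_mod_3(2)[OF p m] cd .
    then have "power_sum ?g (2 * m + 4) = 0" using eq_minus_iff_mod_ring[OF odd] by blast
    then have "d = 0" unfolding power_sum_cubic_2_mod_3(2)[OF p m] using nz4 by simp
    with \<open>c = - d\<close> c show False by simp
  qed
  then have e: "exp_sum ?f = exp_sum ?g" using eq by (simp add: power2_eq_iff)
  have "power_sum ?f (2 * m + 2) = power_sum ?g (2 * m + 2)"
    by (rule exp_sum_eq_imp_power_sum_eq[OF e]) (use p m in auto)
  then have "of_nat (2 * m + 2) * c = of_nat (2 * m + 2) * d"
    unfolding power_sum_cubic_2_mod_3(1)[OF p m] by (simp only: neg_equal_iff_equal)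
  then show ?thesis by (simp only: mult_left_cancel[OF nz])
qed

section \<open>Roots and multiplicities of products of linear factors\<close>

lemma order_prod_linear:
  fixes r :: "'i \<Rightarrow> 'a::field"
  assumes I: "finite I" and i: "i \<in> I" and inj: "inj_on r I"
  shows "Polynomial.order (r i) (\<Prod>j\<in>I. [:- r j, 1:] ^ e j) = e i"
proof -
  define g where "g = (\<Prod>j\<in>I - {i}. [:- r j, 1:] ^ e j)"
  have "poly g (r i) \<noteq> 0"
    using I i inj by (auto simp: g_def poly_prod dest!: inj_onD)
  then have g: "Polynomial.order (r i) g = 0" "g \<noteq> 0" by (auto simp: order_0I)
  have "(\<Prod>j\<in>I. [:- r j, 1:] ^ e j) = [:- r i, 1:] ^ e i * g"
    unfolding g_def by (rule prod.remove[OF I i])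
  then show ?thesis using g by (simp add: order_mult order_power_n_n)
qed

lemma roots_prod_linear:
  fixes r :: "'i \<Rightarrow> 'a::field"
  assumes "finite I" "\<And>j. j \<in> I \<Longrightarrow> e j > 0"
  shows "{x. poly (\<Prod>j\<in>I. [:- r j, 1:] ^ e j) x = 0} = r ` I"
proof -
  have "poly (\<Prod>j\<in>I. [:- r j, 1:] ^ e j) x = 0 \<longleftrightarrow> (\<exists>j\<in>I. x = r j)" for x
    using assms by (auto simp: poly_prod)
  then show ?thesis by auto
qed

section \<open>The primes 5 and 3\<close>

lemma exp_sum_of_nat:
  assumes "\<And>i. f (of_nat i) = of_nat (g i)"
  shows "exp_sum (f :: 'p::prime_card mod_ring \<Rightarrow> 'p mod_ring) = (\<Sum>i<CARD('p). cis (2 * pi / real CARD('p)) ^ g i)"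
  using sum.reindex_bij_betw[OF bij_betw_of_nat_mod_ring, of "\<lambda>a. addchar (f a)"]
  by (simp add: exp_sum_addchar assms addchar_of_nat)

lemma power_mod_order:
  fixes z :: "'a::monoid_mult"
  assumes "z ^ m = 1"
  shows "z ^ n = z ^ (n mod m)"
proof -
  have "z ^ n = z ^ (m * (n div m) + n mod m)" by (simp only: mult_div_mod_eq)
  also have "\<dots> = z ^ (n mod m)" by (simp only: power_add power_mult assms power_one mult_1_left)
  finally show ?thesis .
qed

text \<open>The sums are linear in the periods u = z + z^4 and w = z^2 + z^3, which satisfy u + w =
  - 1 and w^2 = 1 - w. For c = 2, 3 the square is 5 and gives the factor x; the squares for c = 1, 4
  are conjugate and give the quadratic factor.\<close>

lemma prod_cubics_5:
  assumes p: "CARD('p::prime_card) = 5"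
  shows "(\<Prod>c = 1..CARD('p) - 1. [:5 - (exp_sum (\<lambda>t :: 'p mod_ring. t ^ 3 + of_nat c * t))\<^sup>2, 1:])
    = [:0, 1:]\<^sup>2 * ([:0, 1:]\<^sup>2 - 5 * [:0, 1:] - 25 :: complex poly)"
proof -
  define z where "z = cis (2 * pi / 5)"
  have z5: "z ^ 5 = 1" using addchar_of_nat[of 5, where 'p='p] of_nat_mod_ring_eq_0_iff[of 5, where 'p='p]
    by (simp add: p z_def)
  have "(\<Sum>i<5. z ^ i) = 0"
    using exp_sum_of_nat[of "\<lambda>t :: 'p mod_ring. t" "\<lambda>i. i"] exp_sum_bij[of "\<lambda>t :: 'p mod_ring. t"]
    by (simp add: p z_def bij_id[unfolded id_def])
  then have s: "1 + z + z\<^sup>2 + z ^ 3 + z ^ 4 = 0" by (simp add: numeral_eq_Suc)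
  define w where "w = z\<^sup>2 + z ^ 3"
  define u where "u = z + z ^ 4"
  have uw: "u = - 1 - w" using s by (simp add: u_def w_def algebra_simps add_eq_0_iff)
  have "w * w = z ^ 4 + 2 * z ^ 5 + z ^ 5 * z" unfolding w_def by (simp add: numeral_eq_Suc algebra_simps)
  then have "w * w = u + 2" by (simp add: z5 u_def)
  then have ww: "w * w = 1 - w" using uw by simp
  note red = power_mod_order[OF z5]
  have E: "exp_sum (\<lambda>t :: 'p mod_ring. t ^ 3 + of_nat c * t) = (\<Sum>i<5. z ^ ((i ^ 3 + c * i) mod 5))" for c
    using exp_sum_of_nat[of "\<lambda>t :: 'p mod_ring. t ^ 3 + of_nat c * t" "\<lambda>i. i ^ 3 + c * i"]
    by (simp add: p z_def[symmetric] red[symmetric])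
  have l5: "{..<5} = {0, 1, 2, 3, 4 :: nat}" by auto
  have "exp_sum (\<lambda>t :: 'p mod_ring. t ^ 3 + of_nat 1 * t) = 3 + w"
       "exp_sum (\<lambda>t :: 'p mod_ring. t ^ 3 + of_nat 2 * t) = 1 + 2 * w"
       "exp_sum (\<lambda>t :: 'p mod_ring. t ^ 3 + of_nat 3 * t) = 1 + 2 * u"
       "exp_sum (\<lambda>t :: 'p mod_ring. t ^ 3 + of_nat 4 * t) = 3 + u"
    unfolding E l5 by (simp_all add: w_def u_def power2_eq_square)
  note Es = this
  have sq: "(3 + w)\<^sup>2 = 10 + 5 * w" "(1 + 2 * w)\<^sup>2 = 5" "(1 + 2 * u)\<^sup>2 = 5" "(3 + u)\<^sup>2 = 5 - 5 * w"
  proof -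
    have "(3 + w)\<^sup>2 = 9 + 6 * w + w * w" "(1 + 2 * w)\<^sup>2 = 1 + 4 * w + 4 * (w * w)"
      "(1 + 2 * u)\<^sup>2 = 1 + 4 * w + 4 * (w * w)" "(3 + u)\<^sup>2 = 4 - 4 * w + w * w"
      by (simp_all add: uw power2_eq_square algebra_simps)
    then show "(3 + w)\<^sup>2 = 10 + 5 * w" "(1 + 2 * w)\<^sup>2 = 5" "(1 + 2 * u)\<^sup>2 = 5" "(3 + u)\<^sup>2 = 5 - 5 * w"
      unfolding ww by simp_all
  qed
  define F where "F c = [:5 - (exp_sum (\<lambda>t :: 'p mod_ring. t ^ 3 + of_nat c * t))\<^sup>2, 1:]" for c
  have "{1..CARD('p) - 1} = {1, 2, 3, 4}" by (auto simp: p)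
  then have "(\<Prod>c = 1..CARD('p) - 1. F c) = F 1 * F 2 * F 3 * F 4" by (simp add: mult.assoc)
  then have "(\<Prod>c = 1..CARD('p) - 1. [:5 - (exp_sum (\<lambda>t :: 'p mod_ring. t ^ 3 + of_nat c * t))\<^sup>2, 1:])
    = [:5 - (3 + w)\<^sup>2, 1:] * [:5 - (1 + 2 * w)\<^sup>2, 1:] * [:5 - (1 + 2 * u)\<^sup>2, 1:] * [:5 - (3 + u)\<^sup>2, 1:]"
    by (simp only: F_def Es)
  also have "\<dots> = [:0, 1:]\<^sup>2 * ([:- 5 - 5 * w, 1:] * [:5 * w, 1:])"
    unfolding sq by (simp add: power2_eq_square mult_ac)
  also have "[:- 5 - 5 * w, 1:] * [:5 * w, 1:] = [:- 25, - 5, 1:]"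
  proof -
    have "w * 25 + w * (w * 25) = 25 * (w + w * w)" by (simp add: algebra_simps)
    then have "w * 25 + w * (w * 25) = 25" by (simp add: ww)
    then show ?thesis by (simp add: algebra_simps)
  qed
  also have "[:- 25, - 5, 1:] = [:0, 1:]\<^sup>2 - 5 * [:0, 1:] - (25 :: complex poly)"
    by (simp add: power2_eq_square numeral_poly)
  finally show ?thesis .
qed

text \<open>In characteristic 3 the cubic form \<open>x\<^sup>2 y + x y\<^sup>2 = ((x + y)\<^sup>3 - x\<^sup>3 - y\<^sup>3) / 3\<close> is still a coboundary once the
  cubes are taken modulo 9.\<close>

definition ninth_root_char :: "'p::prime_card mod_ring \<Rightarrow> 'p mod_ring \<Rightarrow> complex" where
  "ninth_root_char c x = cis (2 * pi * of_int (to_int_mod_ring c * to_int_mod_ring x ^ 3) / 9)"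

section \<open>The prime 3: the cubic phase with values in ninth roots of unity\<close>

lemma cis_ninth_cong:
  assumes "[m = n] (mod 9)"
  shows "cis (2 * pi * of_int m / 9) = cis (2 * pi * of_int n / 9)"
proof -
  obtain k where "m - n = 9 * k" using assms by (auto simp: cong_iff_dvd_diff)
  then have k: "m = n + 9 * k" by simp
  have "cis (2 * pi * of_int m / 9) = cis (2 * pi * of_int n / 9) * cis (2 * pi * of_int k)"
    unfolding cis_mult k by (simp add: field_simps)
  then show ?thesis using cis_multiple_2pi[of "of_int k"] by (simp add: mult_ac)
qed

text \<open>The representative of x + y is a + b + 3 k, and adding a multiple of 3 changes a cube by
  a multiple of 9. The mixed term 3 (a^2 b + a b^2) over 9 becomes a third, which is the exponent of
  the additive character.\<close>

lemma ninth_root_char_add: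
  fixes c :: "'p::prime_card mod_ring"
  assumes p: "CARD('p) = 3"
  shows "ninth_root_char c (x + y)
    = addchar (c * (x\<^sup>2 * y + x * y\<^sup>2)) * ninth_root_char c x * ninth_root_char c y"
proof -
  define n where "n = to_int_mod_ring c"
  define a where "a = to_int_mod_ring x"
  define b where "b = to_int_mod_ring y"
  define s where "s = to_int_mod_ring (x + y)"
  have cxy: "c = of_int n" "x = of_int a" "y = of_int b"
    by (simp_all add: n_def a_def b_def of_int_mod_ring_surj)
  have "(of_int s :: 'p mod_ring) = of_int (a + b)"
    by (simp add: s_def a_def b_def of_int_mod_ring_surj)
  then have "3 dvd s - (a + b)" by (simp only: of_int_mod_ring_eq_iff) (simp add: p)
  then obtain k where "s - (a + b) = 3 * k" by blast
  then have k: "s = a + b + 3 * k" by simp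
  have e: "n * s ^ 3 - (3 * (n * (a\<^sup>2 * b + a * b\<^sup>2)) + n * a ^ 3 + n * b ^ 3) = 9 * (n * ((a + b)\<^sup>2 * k + 3 * (a + b) * k\<^sup>2 + 3 * k ^ 3))"
    unfolding k by (simp add: power2_eq_square power3_eq_cube algebra_simps)
  have "[n * s ^ 3 = 3 * (n * (a\<^sup>2 * b + a * b\<^sup>2)) + n * a ^ 3 + n * b ^ 3] (mod 9)"
    unfolding cong_iff_dvd_diff e by simp
  then have "ninth_root_char c (x + y) = cis (2 * pi * of_int (3 * (n * (a\<^sup>2 * b + a * b\<^sup>2)) + n * a ^ 3 + n * b ^ 3) / 9)"
    unfolding ninth_root_char_def s_def[symmetric] n_def[symmetric] by (rule cis_ninth_cong)
  also have "\<dots> = cis (2 * pi * of_int (n * (a\<^sup>2 * b + a * b\<^sup>2)) / 3) * cis (2 * pi * of_int (n * a ^ 3) / 9) * cis (2 * pi * of_int (n * b ^ 3) / 9)"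
    unfolding cis_mult by (rule arg_cong[of _ _ cis]) (simp add: field_simps)
  also have "cis (2 * pi * of_int (n * (a\<^sup>2 * b + a * b\<^sup>2)) / 3) = addchar (c * (x\<^sup>2 * y + x * y\<^sup>2))"
    using addchar_of_int[of "n * (a\<^sup>2 * b + a * b\<^sup>2)", where 'p='p] by (simp add: p cxy)
  finally show ?thesis by (simp only: ninth_root_char_def n_def a_def b_def)
qed

lemma to_int_mod_ring_of_nat: "n < CARD('p) \<Longrightarrow> to_int_mod_ring (of_nat n :: 'p::prime_card mod_ring) = int n"
  by (simp add: of_nat_of_int_mod_ring)

lemma ninth_root_char_sum:
  assumes p: "CARD('p::prime_card) = 3" and n: "n < 3" and b: "b < 3"
  defines "q \<equiv> cis (2 * pi / 9)"
  shows "(\<Sum>z\<in>UNIV. ninth_root_char (of_nat n) z * addchar (of_nat b * z :: 'p mod_ring))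
    = 1 + q ^ (n + 3 * b) + q ^ (8 * n + 6 * b)"
proof -
  have q: "q ^ m = cis (2 * pi * of_int (int m) / 9)" for m
    by (simp add: q_def DeMoivre mult_ac)
  have summand: "ninth_root_char (of_nat n) (of_nat i :: 'p mod_ring) * addchar (of_nat b * of_nat i :: 'p mod_ring) = q ^ (n * i ^ 3 + 3 * (b * i))"
    if "i < 3" for i
  proof -
    have "ninth_root_char (of_nat n) (of_nat i :: 'p mod_ring) = q ^ (n * i ^ 3)"
      using that n unfolding ninth_root_char_def q by (subst (1 2) to_int_mod_ring_of_nat) (simp_all add: p)
    moreover have "addchar (of_nat b * of_nat i :: 'p mod_ring) = q ^ (3 * (b * i))"
      using addchar_of_int[of "int (b * i)", where 'p='p] unfolding q by (simp add: p mult_ac)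
    ultimately show ?thesis by (simp only: power_add)
  qed
  have "(\<Sum>z\<in>UNIV. ninth_root_char (of_nat n) z * addchar (of_nat b * z :: 'p mod_ring))
    = (\<Sum>i<CARD('p). ninth_root_char (of_nat n) (of_nat i :: 'p mod_ring) * addchar (of_nat b * of_nat i :: 'p mod_ring))"
    by (rule sum.reindex_bij_betw[OF bij_betw_of_nat_mod_ring, symmetric])
  also have "\<dots> = (\<Sum>i<3. q ^ (n * i ^ 3 + 3 * (b * i)))"
    unfolding p by (intro sum.cong refl) (simp add: summand)
  also have "{..<3} = {0, 1, 2 :: nat}" by auto
  also have "(\<Sum>i\<in>\<dots>. q ^ (n * i ^ 3 + 3 * (b * i))) = 1 + q ^ (n + 3 * b) + q ^ (8 * n + 6 * b)"
    by (simp add: mult.commute)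
  finally show ?thesis .
qed

text \<open>Each inner sum is \<open>E k\<close>, that is 1 + q^k + q^(- k) with k = n + 3 b, and k
  runs through the residues prime to 9. Since E (9 - k) = E k, three values occur twice each, which
  yields the square of a cubic.\<close>

lemma prod_ninth_root:
  assumes p: "CARD('p::prime_card) = 3"
  shows "(\<Prod>c\<in>UNIV - {0 :: 'p mod_ring}. \<Prod>b\<in>UNIV.
      [:3 - of_real ((cmod (\<Sum>z\<in>UNIV. ninth_root_char c z * addchar (b * z)))\<^sup>2), 1:])
    = ([:0, 1:] ^ 3 - 9 * [:0, 1:] - 9 :: complex poly)\<^sup>2"
proof -
  define q where "q = cis (2 * pi / 9)"
  have q: "q ^ m = cis (2 * pi * of_int (int m) / 9)" for m
    by (simp add: q_def DeMoivre mult_ac)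
  have q9: "q ^ 9 = 1" unfolding q by simp
  have "q ^ 3 \<noteq> 1"
  proof
    assume "q ^ 3 = 1"
    then have "addchar (1 :: 'p mod_ring) = 1" using addchar_of_int[of 1, where 'p='p] unfolding q by (simp add: p)
    then show False by (simp add: addchar_eq_1_iff)
  qed
  moreover have "(q ^ 3 - 1) * (1 + q ^ 3 + q ^ 6) = q ^ 9 - 1" by (simp add: algebra_simps flip: power_add)
  ultimately have s: "1 + q ^ 3 + q ^ 6 = 0" using q9 by simp
  define E where "E k = 1 + q ^ k + q ^ (8 * k)" for k
  have red: "q ^ k = q ^ (k mod 9)" for k by (rule power_mod_order[OF q9])
  have E_sum: "(\<Sum>z\<in>UNIV. ninth_root_char (of_nat n) z * addchar (of_nat b * z :: 'p mod_ring)) = E (n + 3 * b)"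
    if "n < 3" "b < 3" for n b
  proof -
    have e: "8 * (n + 3 * b) = (8 * n + 6 * b) + 9 * (2 * b)" by simp
    have "q ^ (8 * (n + 3 * b)) = q ^ (8 * n + 6 * b)"
      unfolding e power_add[of q _ "9 * (2 * b)"] power_mult[of q 9] q9 by simp
    then show ?thesis using ninth_root_char_sum[OF p that] by (simp add: E_def q_def)
  qed
  have real: "of_real ((cmod (E k))\<^sup>2) = (E k)\<^sup>2" for k
  proof -
    have "q ^ (8 * k) = cnj (q ^ k)"
    proof -
      have "q ^ (8 * k) = cis (2 * pi * of_int (- int k) / 9)"
        unfolding q by (rule cis_ninth_cong) (simp add: cong_iff_dvd_diff)
      then show ?thesis unfolding q by (simp add: cis_cnj)
    qed
    then have "cnj (E k) = E k" by (simp add: E_def)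
    moreover have "of_real ((cmod (E k))\<^sup>2) = E k * cnj (E k)" by (simp add: complex_norm_square del: of_real_power)
    ultimately show ?thesis by (simp add: power2_eq_square)
  qed
  define f where "f \<mu> = [:3 - \<mu>, 1 :: complex:]" for \<mu>
  have "(\<Prod>c\<in>UNIV - {0 :: 'p mod_ring}. \<Prod>b\<in>UNIV. f (of_real ((cmod (\<Sum>z\<in>UNIV. ninth_root_char c z * addchar (b * z)))\<^sup>2)))
    = (\<Prod>n = 1..2. \<Prod>b<3. f (of_real ((cmod (\<Sum>z\<in>UNIV. ninth_root_char (of_nat n) z * addchar (of_nat b * z :: 'p mod_ring)))\<^sup>2)))"
  proof -
    define G where "G c b = f (of_real ((cmod (\<Sum>z\<in>UNIV. ninth_root_char c z * addchar (b * z)))\<^sup>2))" for c b :: "'p mod_ring"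
    have "(\<Prod>c\<in>UNIV - {0}. \<Prod>b\<in>UNIV. G c b) = (\<Prod>n = 1..CARD('p) - 1. \<Prod>b\<in>UNIV. G (of_nat n) b)"
      by (rule prod_of_nat_nonzero[symmetric])
    also have "\<dots> = (\<Prod>n = 1..CARD('p) - 1. \<Prod>b<CARD('p). G (of_nat n) (of_nat b))"
      by (intro prod.cong refl) (rule prod.reindex_bij_betw[OF bij_betw_of_nat_mod_ring, symmetric])
    finally show ?thesis by (simp add: G_def p)
  qed
  also have "\<dots> = (\<Prod>n = 1..2. \<Prod>b<3. f ((E (n + 3 * b))\<^sup>2))"
  proof (intro prod.cong refl)
    fix n b :: nat assume "n \<in> {1..2}" "b \<in> {..<3}"
    then have "n < 3" "b < 3" by auto
    then show "f (of_real ((cmod (\<Sum>z\<in>UNIV. ninth_root_char (of_nat n) z * addchar (of_nat b * z :: 'p mod_ring)))\<^sup>2))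
      = f ((E (n + 3 * b))\<^sup>2)" by (simp only: E_sum real)
  qed
  also have "\<dots> = (f ((E 1)\<^sup>2) * f ((E 4)\<^sup>2) * f ((E 7)\<^sup>2)) * (f ((E 2)\<^sup>2) * f ((E 5)\<^sup>2) * f ((E 8)\<^sup>2))"
    by (simp add: numeral_eq_Suc)
  also have "\<dots> = (f ((E 1)\<^sup>2) * f ((E 4)\<^sup>2) * f ((E 2)\<^sup>2)) * (f ((E 1)\<^sup>2) * f ((E 4)\<^sup>2) * f ((E 2)\<^sup>2))"
  proof -
    have "E 7 = E 2" "E 5 = E 4" "E 8 = E 1"
    using red[of 56] red[of 16] red[of 40] red[of 32] red[of 64] by (simp_all add: E_def)
    then show ?thesis by (simp only: mult_ac)
  qed
  also have "f ((E 1)\<^sup>2) * f ((E 4)\<^sup>2) * f ((E 2)\<^sup>2) = [:0, 1:] ^ 3 - 9 * [:0, 1:] - 9"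
  proof -
    \<comment> \<open>This is 2 cos (2 pi / 9), a root of x^3 - 3 x + 1; all three values are
      polynomials in it.\<close>
    define t where "t = q + q ^ 8"
    have "t ^ 3 = q ^ 3 + 3 * (q ^ 9 * q) + 3 * (q ^ 9 * q ^ 8) + (q ^ 9) ^ 2 * q ^ 6"
      unfolding t_def by (simp add: numeral_eq_Suc algebra_simps)
    also have "\<dots> = 3 * t + (q ^ 3 + q ^ 6)" by (simp add: q9 t_def)
    also have "q ^ 3 + q ^ 6 = - 1" using s by (simp add: add_eq_0_iff add.assoc)
    finally have t3: "t ^ 3 = 3 * t - 1" by simp
    have E1: "E 1 = 1 + t" by (simp add: E_def t_def)
    have "t\<^sup>2 = q ^ 2 + 2 * q ^ 9 + q ^ 16" unfolding t_def by (simp add: numeral_eq_Suc algebra_simps)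
    then have E2: "E 2 = t\<^sup>2 - 1" by (simp add: E_def q9)
    have "(q ^ 2 + q ^ 16)\<^sup>2 = q ^ 4 + 2 * (q ^ 9)\<^sup>2 + q ^ 32" by (simp add: numeral_eq_Suc algebra_simps)
    then have "E 4 = (E 2 - 1)\<^sup>2 - 1" by (simp add: E_def q9)
    then have E4: "E 4 = (t\<^sup>2 - 2)\<^sup>2 - 1" by (simp add: E2)
    define a where "a = 3 - (E 1)\<^sup>2"
    define b where "b = 3 - (E 4)\<^sup>2"
    define c where "c = 3 - (E 2)\<^sup>2"
    \<comment> \<open>The elementary symmetric functions of a, b, c are the coefficients of (x + a)
      (x + b) (x + c). They are evaluated by reducing every power of t from the third on with the
      cubic relation.\<close>
    have abc: "a + b + c = 0" "a * b + a * c + b * c = - 9" "a * b * c = - 9"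
    proof -
      have t4: "t ^ 4 = 3 * t\<^sup>2 - t"
      proof -
        have "t ^ 4 = t * t ^ 3" by (simp add: power_eq_if)
        then show ?thesis unfolding t3 by (simp add: power2_eq_square algebra_simps)
      qed
      have a: "a = 2 - 2 * t - t\<^sup>2" unfolding a_def E1 by (simp add: power2_eq_square algebra_simps)
      have c: "c = 2 + t - t\<^sup>2"
      proof -
        have "c = 2 + 2 * t\<^sup>2 - t ^ 4"
          unfolding c_def E2 by (simp add: power2_eq_square power4_eq_xxxx algebra_simps)
        then show ?thesis by (simp add: t4)
      qed
      have "E 4 = t ^ 4 - 4 * t\<^sup>2 + 3"
        by (simp add: E4 power2_eq_square power4_eq_xxxx algebra_simps)
      then have e4: "E 4 = 3 - t - t\<^sup>2" by (simp add: t4)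
      have "b = - 6 + 6 * t + 5 * t\<^sup>2 - 2 * t ^ 3 - t ^ 4"
        unfolding b_def e4 by (simp add: power2_eq_square power3_eq_cube power4_eq_xxxx algebra_simps)
      then have b: "b = - 4 + t + 2 * t\<^sup>2" by (simp add: t3 t4)
      have sum: "b = - (a + c)" and "a * c = 4 - 2 * t - 6 * t\<^sup>2 + t ^ 3 + t ^ 4"
        by (simp_all add: a b c power2_eq_square power3_eq_cube power4_eq_xxxx algebra_simps)
      then have ac: "a * c = 3 - 3 * t\<^sup>2" by (simp add: t3 t4)
      have "b * b = 16 - 8 * t - 15 * t\<^sup>2 + 4 * t ^ 3 + 4 * t ^ 4"
        by (simp add: b power2_eq_square power3_eq_cube power4_eq_xxxx algebra_simps)
      then have bb: "b * b = 12 - 3 * t\<^sup>2" by (simp add: t3 t4)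
      have "b * (a * c) = - 12 + 3 * t + 18 * t\<^sup>2 - 3 * t ^ 3 - 6 * t ^ 4"
        by (simp add: b ac power2_eq_square power3_eq_cube power4_eq_xxxx algebra_simps)
      then have bac: "b * (a * c) = - 9" by (simp add: t3 t4)
      show "a + b + c = 0" by (simp add: sum)
      have "a * b + a * c + b * c = a * c - b * b" unfolding sum by (simp add: algebra_simps)
      then show "a * b + a * c + b * c = - 9" by (simp add: ac bb)
      show "a * b * c = - 9" using bac by (simp add: mult_ac)
    qed
    have "f ((E 1)\<^sup>2) * f ((E 4)\<^sup>2) * f ((E 2)\<^sup>2) = [:a * b * c, a * b + a * c + b * c, a + b + c, 1:]"
      by (simp add: f_def a_def b_def c_def algebra_simps)
    also have "\<dots> = [:0, 1:] ^ 3 - 9 * [:0, 1:] - 9"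
      unfolding abc by (simp add: power3_eq_cube numeral_poly)
    finally show ?thesis .
  qed
  finally show ?thesis by (simp only: f_def power2_eq_square)
qed

section \<open>The spectrum\<close>

lemma inj_on_case_sum:
  assumes "inj_on r A" "inj_on s B" "\<And>a b. a \<in> A \<Longrightarrow> b \<in> B \<Longrightarrow> r a \<noteq> s b"
  shows "inj_on (case_sum r s) (A <+> B)"
proof (rule inj_onI)
  fix x y assume "x \<in> A <+> B" "y \<in> A <+> B" "case_sum r s x = case_sum r s y"
  then show "x = y"
    using assms(3)[of "projl x" "projr y"] assms(3)[of "projl y" "projr x"] inj_onD[OF assms(1)] inj_onD[OF assms(2)]
    by (cases x; cases y) auto
qed

lemma char_poly_Gamma4_3:
  fixes vs :: "'p::prime_card point list"
  assumes p: "CARD('p) = 3" and vs: "distinct vs" "set vs = UNIV"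
  defines "X \<equiv> [:0, 1 :: complex:]"
  shows "char_poly (adjacency_matrix vs Gamma4_adj) = X ^ 18 * (X - 6) * (X - 3) ^ 12 * (X + 3) ^ 14 * (X ^ 3 - 9 * X - 9) ^ 12"
proof -
  define f where "f \<mu> = [:3 - \<mu>, 1 :: complex:]" for \<mu>
  have odd: "odd CARD('p)" by (simp add: p)
  have cubic: "(\<Prod>c\<in>UNIV - {0 :: 'p mod_ring}. \<Prod>b\<in>UNIV.
      f (of_real ((cmod (\<Sum>z\<in>UNIV. ninth_root_char c z * addchar (b * z)))\<^sup>2))) = (X ^ 3 - 9 * X - 9)\<^sup>2"
    unfolding f_def X_def by (rule prod_ninth_root[OF p])
  have nr: "norm (ninth_root_char c x) = 1" for c x :: "'p mod_ring" by (simp add: ninth_root_char_def)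
  have "char_poly (adjacency_matrix vs Gamma4_adj) = (\<Prod>i :: 'p point\<in>UNIV. f (line_eigenvalue ninth_root_char i))"
    using char_poly_collinearity[OF odd ninth_root_char_add[OF p] nr vs] by (simp only: f_def p of_nat_numeral)
  also have "\<dots> = f 9 * f 0 ^ 14 * f 3 ^ 18 * f 6 ^ 12 * ((X ^ 3 - 9 * X - 9)\<^sup>2) ^ 6"
    unfolding prod_line_eigenvalues[OF odd] cubic by (simp add: p)
  also have "\<dots> = (X - 6) * (X + 3) ^ 14 * X ^ 18 * (X - 3) ^ 12 * (X ^ 3 - 9 * X - 9) ^ 12"
  proof -
    have "f 9 = X - 6" "f 0 = X + 3" "f 3 = X" "f 6 = X - 3"
      by (simp_all add: f_def X_def numeral_poly)
    then show ?thesis by (simp flip: power_mult)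
  qed
  finally show ?thesis by (simp only: mult_ac)
qed

text \<open>The vanishing sums of the pure cubes join the factor \<open>f 0\<close>, whose exponent
  becomes p - 1 + 2 p (p - 1)^2 = (p - 1) (2 p^2 - 2 p + 1).\<close>

lemma char_poly_Gamma4_2_mod_3:
  fixes vs :: "'p::prime_card point list"
  assumes odd: "odd CARD('p)" and p2: "[CARD('p) = 2] (mod 3)" and vs: "distinct vs" "set vs = UNIV"
  defines "p \<equiv> CARD('p)"
  defines "f \<equiv> \<lambda>\<mu> :: complex. [:of_nat p - \<mu>, 1:]"
  shows "char_poly (adjacency_matrix vs Gamma4_adj)
    = f (of_nat p) ^ (3 * p * (p - 1)) * f (of_nat (p * p)) * f (of_nat (2 * p)) ^ (p * (p - 1)\<^sup>2)
      * f 0 ^ ((p - 1) * (2 * p\<^sup>2 - 2 * p + 1))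
      * (\<Prod>c = 1..p - 1. f ((exp_sum (\<lambda>t :: 'p mod_ring. t ^ 3 + of_nat c * t))\<^sup>2)) ^ (p * (p - 1)\<^sup>2)"
proof -
  let ?P = "\<Prod>c = 1..p - 1. f ((exp_sum (\<lambda>t :: 'p mod_ring. t ^ 3 + of_nat c * t))\<^sup>2)"
  have "CARD('p) \<noteq> 3" using p2 by (auto simp: cong_def)
  then have main: "char_poly (adjacency_matrix vs Gamma4_adj)
    = f (of_nat (p * p)) * f 0 ^ (p - 1 + p * (p - 1)\<^sup>2) * f (of_nat p) ^ (3 * p * (p - 1))
      * f (of_nat (2 * p)) ^ (p * (p - 1)\<^sup>2)
      * (\<Prod>a\<in>UNIV - {0 :: 'p mod_ring}. \<Prod>b\<in>UNIV. f ((exp_sum (\<lambda>t. a * t ^ 3 + b * t))\<^sup>2)) ^ (p * (p - 1))"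
    unfolding f_def p_def by (rule char_poly_Gamma4[OF odd _ vs])
  have "(\<Prod>a\<in>UNIV - {0 :: 'p mod_ring}. \<Prod>b\<in>UNIV. f ((exp_sum (\<lambda>t. a * t ^ 3 + b * t))\<^sup>2)) = (f 0 * ?P) ^ (p - 1)"
    using prod_cubics_2_mod_3[OF p2, of "\<lambda>e. f (e\<^sup>2)"] by (simp add: p_def)
  then have cub: "(\<Prod>a\<in>UNIV - {0 :: 'p mod_ring}. \<Prod>b\<in>UNIV. f ((exp_sum (\<lambda>t. a * t ^ 3 + b * t))\<^sup>2)) ^ (p * (p - 1))
      = f 0 ^ (p * (p - 1)\<^sup>2) * ?P ^ (p * (p - 1)\<^sup>2)"
    by (simp only: power_mult[symmetric] power_mult_distrib) (simp add: power2_eq_square mult_ac)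
  obtain q where q: "p = Suc q" using odd by (cases "CARD('p)") (auto simp: p_def)
  have "2 * p\<^sup>2 - 2 * p = 2 * (q * q + q)" by (simp add: q power2_eq_square)
  then have "p - 1 + p * (p - 1)\<^sup>2 + p * (p - 1)\<^sup>2 = (p - 1) * (2 * p\<^sup>2 - 2 * p + 1)"
    by (simp add: q power2_eq_square algebra_simps)
  then have f0: "f 0 ^ (p - 1 + p * (p - 1)\<^sup>2) * f 0 ^ (p * (p - 1)\<^sup>2) = f 0 ^ ((p - 1) * (2 * p\<^sup>2 - 2 * p + 1))"
    by (simp only: power_add[symmetric])
  show ?thesis unfolding main cub f0[symmetric] by (simp only: mult_ac)
qed

text \<open>The pure cubes stay apart from \<open>f 0\<close> here, whose exponent is p - 1 + p (p -
  1)^2 = (p - 1) (p^2 - p + 1). The division by 3 is exact because 3 divides p - 1.\<close>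

lemma char_poly_Gamma4_1_mod_3:
  fixes vs :: "'p::prime_card point list" and w :: "'p mod_ring"
  assumes odd: "odd CARD('p)" and p1: "[CARD('p) = 1] (mod 3)" and vs: "distinct vs" "set vs = UNIV"
    and w: "primitive_element w"
  defines "p \<equiv> CARD('p)"
  defines "f \<equiv> \<lambda>\<mu> :: complex. [:of_nat p - \<mu>, 1:]"
  shows "char_poly (adjacency_matrix vs Gamma4_adj)
    = f (of_nat p) ^ (3 * p * (p - 1)) * f (of_nat (p * p)) * f (of_nat (2 * p)) ^ (p * (p - 1)\<^sup>2)
      * f 0 ^ ((p - 1) * (p\<^sup>2 - p + 1))
      * (f ((exp_sum (\<lambda>t. t ^ 3 :: 'p mod_ring))\<^sup>2) * f ((exp_sum (\<lambda>t. w * t ^ 3))\<^sup>2)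
          * f ((exp_sum (\<lambda>t. w\<^sup>2 * t ^ 3))\<^sup>2)) ^ (p * (p - 1)\<^sup>2 div 3)
      * (\<Prod>a = 1..p - 1. f ((exp_sum (\<lambda>t :: 'p mod_ring. of_nat a * t ^ 3 + t))\<^sup>2)) ^ (p * (p - 1)\<^sup>2)"
proof -
  let ?P = "\<Prod>a = 1..p - 1. f ((exp_sum (\<lambda>t :: 'p mod_ring. of_nat a * t ^ 3 + t))\<^sup>2)"
  let ?Q = "f ((exp_sum (\<lambda>t. t ^ 3 :: 'p mod_ring))\<^sup>2) * f ((exp_sum (\<lambda>t. w * t ^ 3))\<^sup>2)
          * f ((exp_sum (\<lambda>t. w\<^sup>2 * t ^ 3))\<^sup>2)"
  have "CARD('p) \<noteq> 3" using p1 by (auto simp: cong_def)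
  then have main: "char_poly (adjacency_matrix vs Gamma4_adj)
    = f (of_nat (p * p)) * f 0 ^ (p - 1 + p * (p - 1)\<^sup>2) * f (of_nat p) ^ (3 * p * (p - 1))
      * f (of_nat (2 * p)) ^ (p * (p - 1)\<^sup>2)
      * (\<Prod>a\<in>UNIV - {0 :: 'p mod_ring}. \<Prod>b\<in>UNIV. f ((exp_sum (\<lambda>t. a * t ^ 3 + b * t))\<^sup>2)) ^ (p * (p - 1))"
    unfolding f_def p_def by (rule char_poly_Gamma4[OF odd _ vs])
  have "p mod 3 = 1" using p1 by (simp add: p_def cong_def)
  then obtain n where "p = 3 * n + 1" using div_mult_mod_eq[of p 3] by (metis mult.commute)
  then have n: "p - 1 = 3 * n" by simp
  have "(\<Prod>a\<in>UNIV - {0 :: 'p mod_ring}. \<Prod>b\<in>UNIV. f ((exp_sum (\<lambda>t. a * t ^ 3 + b * t))\<^sup>2)) = ?Q ^ n * ?P ^ (p - 1)"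
    using prod_cubics_1_mod_3[OF p1 w, of "\<lambda>e. f (e\<^sup>2)", folded p_def] by (simp only: n) simp
  moreover have "n * (p * (p - 1)) = p * (p - 1)\<^sup>2 div 3"
  proof -
    have "p * (p - 1)\<^sup>2 = 3 * (n * (p * (p - 1)))" unfolding n by (simp add: power2_eq_square)
    then show ?thesis by (simp only: nonzero_mult_div_cancel_left)
  qed
  moreover have "(p - 1) * (p * (p - 1)) = p * (p - 1)\<^sup>2" by (simp add: power2_eq_square)
  ultimately have cub: "(\<Prod>a\<in>UNIV - {0 :: 'p mod_ring}. \<Prod>b\<in>UNIV. f ((exp_sum (\<lambda>t. a * t ^ 3 + b * t))\<^sup>2)) ^ (p * (p - 1))
      = ?Q ^ (p * (p - 1)\<^sup>2 div 3) * ?P ^ (p * (p - 1)\<^sup>2)"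
    by (simp only: power_mult_distrib[of "_ ^ _"] power_mult[symmetric])
  obtain q where q: "p = Suc q" using odd by (cases "CARD('p)") (auto simp: p_def)
  have "p\<^sup>2 - p = q * q + q" by (simp add: q power2_eq_square)
  then have f0: "p - 1 + p * (p - 1)\<^sup>2 = (p - 1) * (p\<^sup>2 - p + 1)"
    by (simp add: q power2_eq_square algebra_simps)
  show ?thesis unfolding main cub f0 by (simp only: mult_ac)
qed

text \<open>Two of the cubic sums square to p = 5, so their roots coincide with 0 and raise its
  exponent from 60 to 60 + 160.\<close>

lemma char_poly_Gamma4_5:
  fixes vs :: "'p::prime_card point list"
  assumes p: "CARD('p) = 5" and vs: "distinct vs" "set vs = UNIV"
  defines "X \<equiv> [:0, 1 :: complex:]"
  shows "char_poly (adjacency_matrix vs Gamma4_adj) = X ^ 220 * (X - 20) * (X - 5) ^ 80 * (X + 5) ^ 164 * (X ^ 2 - 5 * X - 25) ^ 80"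
proof -
  define f where "f \<mu> = [:5 - \<mu>, 1 :: complex:]" for \<mu>
  have p2: "odd CARD('p)" "[CARD('p) = 2] (mod 3)" by (simp_all add: p cong_def)
  have "char_poly (adjacency_matrix vs Gamma4_adj)
      = f 5 ^ 60 * f 25 * f 10 ^ 80 * f 0 ^ 164 * (X\<^sup>2 * (X\<^sup>2 - 5 * X - 25)) ^ 80"
  proof -
    have "(\<Prod>c = 1..CARD('p) - 1. f ((exp_sum (\<lambda>t :: 'p mod_ring. t ^ 3 + of_nat c * t))\<^sup>2)) = X\<^sup>2 * (X\<^sup>2 - 5 * X - 25)"
      unfolding f_def X_def by (rule prod_cubics_5[OF p])
    moreover have "[:of_nat CARD('p) - \<mu>, 1:] = f \<mu>" for \<mu> by (simp add: f_def p)
    ultimately show ?thesis using char_poly_Gamma4_2_mod_3[OF p2 vs] by (simp only:) (simp add: p)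
  qed
  also have "(X\<^sup>2 * (X\<^sup>2 - 5 * X - 25)) ^ 80 = X ^ 160 * (X\<^sup>2 - 5 * X - 25) ^ 80"
    by (simp add: power_mult_distrib flip: power_mult)
  also have "f 5 ^ 60 * f 25 * f 10 ^ 80 * f 0 ^ 164 * (X ^ 160 * (X\<^sup>2 - 5 * X - 25) ^ 80)
      = X ^ (60 + 160) * (X - 20) * (X - 5) ^ 80 * (X + 5) ^ 164 * (X\<^sup>2 - 5 * X - 25) ^ 80"
  proof -
    have e: "f 25 = X - 20" "f 0 = X + 5" "f 5 = X" "f 10 = X - 5"
      by (simp_all add: f_def X_def numeral_poly)
    show ?thesis unfolding e power_add by (simp only: mult_ac)
  qed
  finally show ?thesis by simp
qed

section \<open>Distinct roots and their multiplicities\<close>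

lemma integer_eigenvalues_distinct:
  assumes "p > 2"
  shows "distinct [0, int (p * (p - 1)), int p, - int p]"
proof -
  have "p * 2 \<le> p * (p - 1)" using assms by (intro mult_le_mono) auto
  then have "int p < int (p * (p - 1))" using assms by linarith
  moreover define u where "u = int (p * (p - 1))"
  ultimately show ?thesis using assms unfolding u_def[symmetric] by auto
qed

text \<open>Non-integrality separates the roots \<open>s j\<close> from the four integer ones. A
  disjoint sum of index sets then presents the polynomial as a single product over pairwise distinct
  roots.\<close>

lemma roots_with_integer_part:
  fixes s :: "'j \<Rightarrow> complex" and \<phi> :: "complex poly"
  assumes p: "p > 2" and J: "finite J" "inj_on s J" "\<And>j n. j \<in> J \<Longrightarrow> s j \<noteq> of_int n" "\<And>j. j \<in> J \<Longrightarrow> e j > 0"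
    and pos: "e0 > 0" "e2 > 0" "e3 > 0"
    and \<phi>: "\<phi> = [:0, 1:] ^ e0 * [:- of_nat (p * (p - 1)), 1:] * [:- of_nat p, 1:] ^ e2 * [:of_nat p, 1:] ^ e3
        * (\<Prod>j\<in>J. [:- s j, 1:] ^ e j)"
  shows "card {x. poly \<phi> x = 0} = 4 + card J"
    and "Polynomial.order 0 \<phi> = e0" "Polynomial.order (of_nat (p * (p - 1))) \<phi> = 1"
    and "Polynomial.order (of_nat p) \<phi> = e2" "Polynomial.order (- of_nat p) \<phi> = e3"
    and "\<And>j. j \<in> J \<Longrightarrow> Polynomial.order (s j) \<phi> = e j"
proof -
  define zs where "zs = [0, int (p * (p - 1)), int p, - int p]"
  define r where "r = case_sum (\<lambda>i. complex_of_int (zs ! i)) s"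
  define d where "d = case_sum (\<lambda>i. [e0, 1, e2, e3] ! i) e"
  define I where "I = ({..<4 :: nat} <+> J)"
  have l4: "{..<4} = {0, 1, 2, 3 :: nat}" by auto
  have fin: "finite I" using J by (simp add: I_def)
  have inj: "inj_on r I" unfolding r_def I_def
  proof (rule inj_on_case_sum)
    show "inj_on (\<lambda>i. complex_of_int (zs ! i)) {..<4}"
    proof (rule inj_onI)
      fix i j :: nat assume ij: "i \<in> {..<4}" "j \<in> {..<4}" and "complex_of_int (zs ! i) = complex_of_int (zs ! j)"
      then have "zs ! i = zs ! j" by (simp only: of_int_eq_iff)
      moreover have "distinct zs" using integer_eigenvalues_distinct[OF p] by (simp only: zs_def)
      moreover have "length zs = 4" by (simp add: zs_def)
      ultimately show "i = j" using ij by (simp add: nth_eq_iff_index_eq)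
    qed
    show "complex_of_int (zs ! a) \<noteq> s b" if "b \<in> J" for a b using J(3)[OF that] by metis
  qed (rule J)
  have \<phi>': "\<phi> = (\<Prod>i\<in>I. [:- r i, 1:] ^ d i)"
  proof -
    define L where "L \<mu> = [:- \<mu>, 1 :: complex:]" for \<mu>
    have "\<phi> = L 0 ^ e0 * L (of_nat (p * (p - 1))) * L (of_nat p) ^ e2 * L (- of_nat p) ^ e3 * (\<Prod>j\<in>J. L (s j) ^ e j)"
      by (simp only: L_def \<phi> minus_zero minus_minus)
    also have "\<dots> = (\<Prod>i\<in>I. L (r i) ^ d i)"
      unfolding I_def using J(1) by (simp add: prod.Plus l4 r_def d_def zs_def mult.assoc)
    finally show ?thesis by (simp only: L_def)
  qed
  have "d i > 0" if "i \<in> I" for i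
    using that J(4) pos by (cases i) (auto simp: d_def I_def l4)
  then have "{x. poly \<phi> x = 0} = r ` I" unfolding \<phi>' by (intro roots_prod_linear fin)
  then show "card {x. poly \<phi> x = 0} = 4 + card J"
    using inj J by (simp add: card_image I_def card_Plus)
  have ord: "Polynomial.order (r i) \<phi> = d i" if "i \<in> I" for i
    unfolding \<phi>' by (rule order_prod_linear[OF fin that inj])
  have mem: "Inl i \<in> I" if "i < 4" for i using that by (auto simp: I_def)
  show "Polynomial.order 0 \<phi> = e0" "Polynomial.order (of_nat (p * (p - 1))) \<phi> = 1"
    "Polynomial.order (of_nat p) \<phi> = e2" "Polynomial.order (- of_nat p) \<phi> = e3"
    using ord[OF mem[of 0]] ord[OF mem[of 1]] ord[OF mem[of 2]] ord[OF mem[of 3]]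
    by (simp_all add: r_def d_def zs_def)
  show "Polynomial.order (s j) \<phi> = e j" if "j \<in> J" for j
    using ord[of "Inr j"] that by (auto simp: r_def d_def I_def)
qed

text \<open>Translations between three shapes of a linear factor: shifted by p as in the eigenvalue
  product, with the root visible for counting multiplicities, and as an expression in the
  indeterminate.\<close>

lemma linear_factor_forms:
  assumes "p > 0"
  shows "[:of_nat p - of_nat p, 1:] = [:0, 1 :: complex:]"
    and "[:of_nat p - of_nat (p * p), 1:] = [:- of_nat (p * (p - 1)), 1 :: complex:]"
    and "[:of_nat p - of_nat (2 * p), 1:] = [:- of_nat p, 1 :: complex:]"
    and "[:of_nat p - 0, 1:] = [:of_nat p, 1 :: complex:]"
    and "[:of_nat p - \<mu>, 1:] = [:- (\<mu> - of_nat p), 1 :: complex:]"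
    and "[:0, 1:] - of_nat n = [:- of_nat n, 1 :: complex:]"
    and "[:0, 1:] + of_nat p = [:of_nat p, 1 :: complex:]"
    and "[:of_nat p, 1:] - [:\<mu>:] = [:- (\<mu> - of_nat p), 1 :: complex:]"
  using assms by (simp_all add: of_nat_poly of_nat_diff algebra_simps)

lemma spectrum_Gamma4_2_mod_3:
  fixes vs :: "'p::prime_card point list" and p :: nat and X :: "complex poly"
  defines "p \<equiv> CARD('p)" and "X \<equiv> [:0, 1:]" and "e \<equiv> \<lambda>c. exp_sum (\<lambda>t :: 'p mod_ring. t ^ 3 + of_nat c * t)"
  assumes odd: "odd p" and p5: "p > 5" and p2: "[p = 2] (mod 3)" and vs: "distinct vs" "set vs = UNIV"
    and \<phi>: "\<phi> = char_poly (adjacency_matrix vs Gamma4_adj)"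
  shows "\<phi> = X ^ (3 * p * (p - 1)) * (X - of_nat (p * (p - 1)))
            * (X - of_nat p) ^ (p * (p - 1)\<^sup>2)
            * (X + of_nat p) ^ ((p - 1) * (2 * p\<^sup>2 - 2 * p + 1))
            * (\<Prod>c = 1..p - 1. (X + of_nat p - [:(e c)\<^sup>2:]) ^ (p * (p - 1)\<^sup>2))"
    and "card {x. poly \<phi> x = 0} = p + 3"
    and "Polynomial.order 0 \<phi> = 3 * p * (p - 1)" "Polynomial.order (of_nat (p * (p - 1))) \<phi> = 1"
    and "Polynomial.order (of_nat p) \<phi> = p * (p - 1)\<^sup>2"
    and "Polynomial.order (- of_nat p) \<phi> = (p - 1) * (2 * p\<^sup>2 - 2 * p + 1)"
    and "\<And>c. c \<in> {1..p - 1} \<Longrightarrow> Polynomial.order ((e c)\<^sup>2 - of_nat p) \<phi> = p * (p - 1)\<^sup>2"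
proof -
  have p0: "p > 0" "p > 2" using p5 by simp_all
  have "p mod 6 = 5" using odd p2 unfolding cong_def by presburger
  \<comment> \<open>In the form p = 6 m + 5 the condition p > 5 becomes m > 0.\<close>
  define m where "m = p div 6"
  have m: "CARD('p) = 6 * m + 5" "0 < m"
    using \<open>p mod 6 = 5\<close> div_mult_mod_eq[of p 6] p5 unfolding m_def p_def[symmetric] by linarith+
  note forms = linear_factor_forms[OF p0(1)]
  have eq: "\<phi> = [:0, 1:] ^ (3 * p * (p - 1)) * [:- of_nat (p * (p - 1)), 1:] * [:- of_nat p, 1:] ^ (p * (p - 1)\<^sup>2)
      * [:of_nat p, 1:] ^ ((p - 1) * (2 * p\<^sup>2 - 2 * p + 1))
      * (\<Prod>c\<in>{1..p - 1}. [:- ((e c)\<^sup>2 - of_nat p), 1:] ^ (p * (p - 1)\<^sup>2))"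
    unfolding \<phi> char_poly_Gamma4_2_mod_3[OF odd[unfolded p_def] p2[unfolded p_def] vs, folded p_def]
      forms(1-4) forms(5)[of "_\<^sup>2"] prod_power_distrib e_def ..
  show "\<phi> = X ^ (3 * p * (p - 1)) * (X - of_nat (p * (p - 1)))
            * (X - of_nat p) ^ (p * (p - 1)\<^sup>2)
            * (X + of_nat p) ^ ((p - 1) * (2 * p\<^sup>2 - 2 * p + 1))
            * (\<Prod>c = 1..p - 1. (X + of_nat p - [:(e c)\<^sup>2:]) ^ (p * (p - 1)\<^sup>2))"
    unfolding eq X_def forms(6-8) ..
  have nz: "(of_nat c :: 'p mod_ring) \<noteq> 0" if "c \<in> {1..p - 1}" for c
    using that by (intro of_nat_mod_ring_nonzero) (auto simp: p_def)
  have inj: "inj_on (\<lambda>c. (e c)\<^sup>2 - of_nat p) {1..p - 1}"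
  proof (rule inj_onI)
    fix c d assume c: "c \<in> {1..p - 1}" and d: "d \<in> {1..p - 1}"
      and "(e c)\<^sup>2 - of_nat p = (e d)\<^sup>2 - of_nat p"
    then have "(e c)\<^sup>2 = (e d)\<^sup>2" by simp
    then have "(of_nat c :: 'p mod_ring) = of_nat d" unfolding e_def
      by (rule exp_sum_cubic_square_inj_2_mod_3[OF m nz[OF c] odd[unfolded p_def]])
    then show "c = d"
      using bij_betw_of_nat_nonzero[where 'p='p, folded p_def] c d by (auto simp: bij_betw_def dest: inj_onD)
  qed
  have nint: "(e c)\<^sup>2 - of_nat p \<noteq> of_int n" if c: "c \<in> {1..p - 1}" for c n
  proof
    assume "(e c)\<^sup>2 - of_nat p = of_int n"
    then have "(e c)\<^sup>2 = of_int (n + int p)" by (simp add: diff_eq_eq)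
    then show False using exp_sum_cubic_not_integer_2_mod_3[OF m nz[OF c]] by (simp only: e_def)
  qed
  have pos: "3 * p * (p - 1) > 0" "p * (p - 1)\<^sup>2 > 0" "(p - 1) * (2 * p\<^sup>2 - 2 * p + 1) > 0"
    using p0 by auto
  note roots = roots_with_integer_part[OF p0(2) _ inj nint _ pos(1,2,3) eq, simplified finite_atLeastAtMost pos(2) simp_thms]
  show "card {x. poly \<phi> x = 0} = p + 3"
    using roots(1) p0 by simp
  show "Polynomial.order 0 \<phi> = 3 * p * (p - 1)" "Polynomial.order (of_nat (p * (p - 1))) \<phi> = 1"
    "Polynomial.order (of_nat p) \<phi> = p * (p - 1)\<^sup>2"
    "Polynomial.order (- of_nat p) \<phi> = (p - 1) * (2 * p\<^sup>2 - 2 * p + 1)"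
    "\<And>c. c \<in> {1..p - 1} \<Longrightarrow> Polynomial.order ((e c)\<^sup>2 - of_nat p) \<phi> = p * (p - 1)\<^sup>2"
    using roots(2-6) by blast+
qed

lemma spectrum_Gamma4_1_mod_3:
  fixes vs :: "'p::prime_card point list" and p :: nat and X :: "complex poly" and w :: "'p mod_ring"
  defines "p \<equiv> CARD('p)" and "X \<equiv> [:0, 1:]" and "e \<equiv> \<lambda>a. exp_sum (\<lambda>t :: 'p mod_ring. of_nat a * t ^ 3 + t)"
    and "g \<equiv> \<lambda>i. exp_sum (\<lambda>t. w ^ i * t ^ 3)"
  assumes odd: "odd p" and p1: "[p = 1] (mod 3)" and vs: "distinct vs" "set vs = UNIV"
    and w: "primitive_element w" and \<phi>: "\<phi> = char_poly (adjacency_matrix vs Gamma4_adj)"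
  shows "\<phi> = X ^ (3 * p * (p - 1)) * (X - of_nat (p * (p - 1)))
            * (X - of_nat p) ^ (p * (p - 1)\<^sup>2)
            * (X + of_nat p) ^ ((p - 1) * (p\<^sup>2 - p + 1))
            * ((X + of_nat p - [:(g 0)\<^sup>2:]) * (X + of_nat p - [:(g 1)\<^sup>2:])
               * (X + of_nat p - [:(g 2)\<^sup>2:])) ^ (p * (p - 1)\<^sup>2 div 3)
            * (\<Prod>a = 1..p - 1. (X + of_nat p - [:(e a)\<^sup>2:]) ^ (p * (p - 1)\<^sup>2))"
    and "card {x. poly \<phi> x = 0} = p + 6"
    and "Polynomial.order 0 \<phi> = 3 * p * (p - 1)" "Polynomial.order (of_nat (p * (p - 1))) \<phi> = 1"
    and "Polynomial.order (of_nat p) \<phi> = p * (p - 1)\<^sup>2"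
    and "Polynomial.order (- of_nat p) \<phi> = (p - 1) * (p\<^sup>2 - p + 1)"
    and "\<And>i. i < 3 \<Longrightarrow> Polynomial.order ((g i)\<^sup>2 - of_nat p) \<phi> = p * (p - 1)\<^sup>2 div 3"
    and "\<And>a. a \<in> {1..p - 1} \<Longrightarrow> Polynomial.order ((e a)\<^sup>2 - of_nat p) \<phi> = p * (p - 1)\<^sup>2"
proof -
  have "p > 1" using prime_card[where 'a='p] unfolding p_def by (rule prime_gt_1_nat)
  moreover have "p \<noteq> 2" using odd by auto
  ultimately have p0: "p > 0" "p > 2" by simp_all
  have "p mod 6 = 1" using odd p1 unfolding cong_def by presburger
  define m where "m = p div 6"
  have m: "CARD('p) = 6 * m + 1" "0 < m"
    using \<open>p mod 6 = 1\<close> div_mult_mod_eq[of p 6] p0 unfolding m_def p_def[symmetric] by linarith+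
  have w0: "w \<noteq> 0" using w by (simp add: primitive_element_def)
  define L where "L \<mu> = [:- (\<mu> - of_nat p), 1 :: complex:]" for \<mu>
  define K where "K = p * (p - 1)\<^sup>2 div 3"
  define J where "J = ({..<3 :: nat} <+> {1..p - 1})"
  define s where "s = case_sum (\<lambda>i. (g i)\<^sup>2 - of_nat p) (\<lambda>a. (e a)\<^sup>2 - of_nat p)"
  define d where "d = case_sum (\<lambda>i :: nat. K) (\<lambda>a :: nat. p * (p - 1)\<^sup>2)"
  have gs: "exp_sum (\<lambda>t. t ^ 3 :: 'p mod_ring) = g 0" "exp_sum (\<lambda>t. w * t ^ 3) = g 1" "exp_sum (\<lambda>t. w\<^sup>2 * t ^ 3) = g 2"
    by (simp_all add: g_def)
  note forms = linear_factor_forms[OF p0(1)]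
  have eq: "\<phi> = [:0, 1:] ^ (3 * p * (p - 1)) * [:- of_nat (p * (p - 1)), 1:] * [:- of_nat p, 1:] ^ (p * (p - 1)\<^sup>2)
      * [:of_nat p, 1:] ^ ((p - 1) * (p\<^sup>2 - p + 1))
      * (L ((g 0)\<^sup>2) * L ((g 1)\<^sup>2) * L ((g 2)\<^sup>2)) ^ K * (\<Prod>a = 1..p - 1. L ((e a)\<^sup>2) ^ (p * (p - 1)\<^sup>2))"
    unfolding \<phi> char_poly_Gamma4_1_mod_3[OF odd[unfolded p_def] p1[unfolded p_def] vs w, folded p_def]
      forms(1-4) forms(5)[of "_\<^sup>2"] prod_power_distrib gs L_def K_def e_def ..
  show "\<phi> = X ^ (3 * p * (p - 1)) * (X - of_nat (p * (p - 1)))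
            * (X - of_nat p) ^ (p * (p - 1)\<^sup>2)
            * (X + of_nat p) ^ ((p - 1) * (p\<^sup>2 - p + 1))
            * ((X + of_nat p - [:(g 0)\<^sup>2:]) * (X + of_nat p - [:(g 1)\<^sup>2:])
               * (X + of_nat p - [:(g 2)\<^sup>2:])) ^ (p * (p - 1)\<^sup>2 div 3)
            * (\<Prod>a = 1..p - 1. (X + of_nat p - [:(e a)\<^sup>2:]) ^ (p * (p - 1)\<^sup>2))"
    unfolding eq X_def forms(6-8) L_def K_def ..
  have l3: "{..<3} = {0, 1, 2 :: nat}" by auto
  have "(\<Prod>j\<in>J. [:- s j, 1:] ^ d j) = (\<Prod>i<3. L ((g i)\<^sup>2) ^ K) * (\<Prod>a = 1..p - 1. L ((e a)\<^sup>2) ^ (p * (p - 1)\<^sup>2))"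
    unfolding J_def by (subst prod.Plus) (simp_all only: finite_lessThan finite_atLeastAtMost s_def d_def L_def o_def sum.case)
  also have "(\<Prod>i<3. L ((g i)\<^sup>2) ^ K) = (L ((g 0)\<^sup>2) * L ((g 1)\<^sup>2) * L ((g 2)\<^sup>2)) ^ K"
    unfolding l3 by (simp add: power_mult_distrib mult.assoc)
  finally have eqJ: "\<phi> = [:0, 1:] ^ (3 * p * (p - 1)) * [:- of_nat (p * (p - 1)), 1:] * [:- of_nat p, 1:] ^ (p * (p - 1)\<^sup>2)
      * [:of_nat p, 1:] ^ ((p - 1) * (p\<^sup>2 - p + 1)) * (\<Prod>j\<in>J. [:- s j, 1:] ^ d j)"
    unfolding eq by (simp only: mult.assoc)
  have nz: "(of_nat c :: 'p mod_ring) \<noteq> 0" if "c \<in> {1..p - 1}" for c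
    using that by (intro of_nat_mod_ring_nonzero) (auto simp: p_def)
  have nzw: "w ^ i \<noteq> 0" for i using w0 by simp
  note square_eq = exp_sum_cubic_square_eq_1_mod_3[OF m _ _ odd[unfolded p_def]]
  have g: "g i = exp_sum (\<lambda>t. w ^ i * t ^ 3 + 0 * t)" for i by (simp add: g_def)
  have e: "e a = exp_sum (\<lambda>t :: 'p mod_ring. of_nat a * t ^ 3 + 1 * t)" for a by (simp add: e_def)
  have inj: "inj_on s J" unfolding s_def J_def
  proof (rule inj_on_case_sum)
    show "inj_on (\<lambda>i. (g i)\<^sup>2 - of_nat p) {..<3}"
    proof (rule inj_onI)
      fix i k :: nat assume ik: "i \<in> {..<3}" "k \<in> {..<3}" and "(g i)\<^sup>2 - of_nat p = (g k)\<^sup>2 - of_nat p"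
      then have "(g i)\<^sup>2 = (g k)\<^sup>2" by simp
      then have "(w ^ i) ^ (2 * m) = (w ^ k) ^ (2 * m)" unfolding g by (rule square_eq(1)[OF nzw nzw])
      then have "w ^ (i * (2 * m)) = w ^ (k * (2 * m))" by (simp only: power_mult)
      \<comment> \<open>The exponents 0, 2 m, 4 m lie below p - 1 = 6 m, so the corresponding powers
        of \<open>w\<close> are different.\<close>
      moreover have "j * (2 * m) < CARD('p) - 1" if "j < 3" for j
        using that m by (cases "j = 0"; cases "j = 1"; cases "j = 2") auto
      ultimately have "i * (2 * m) = k * (2 * m)"
        using primitive_element_bij[OF w] ik by (auto simp: bij_betw_def dest!: inj_onD)
      then show "i = k" using m by simp
    qed
    show "inj_on (\<lambda>a. (e a)\<^sup>2 - of_nat p) {1..p - 1}"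
    proof (rule inj_onI)
      fix a b assume a: "a \<in> {1..p - 1}" and b: "b \<in> {1..p - 1}" and "(e a)\<^sup>2 - of_nat p = (e b)\<^sup>2 - of_nat p"
      then have "(e a)\<^sup>2 = (e b)\<^sup>2" by simp
      note sq = square_eq[OF nz[OF a] nz[OF b] this[unfolded e]]
      let ?a = "of_nat a :: 'p mod_ring" and ?b = "of_nat b :: 'p mod_ring"
      \<comment> \<open>With b = 1 the two invariants are the powers 2 m and 2 m - 1 of the leading
        coefficient, whose quotient is that coefficient.\<close>
      have "2 * m = Suc (2 * m - 1)" using m by simp
      then have "?a * ?a ^ (2 * m - 1) = ?b * ?b ^ (2 * m - 1)" using sq(1) by (metis power_Suc)
      moreover have "?a ^ (2 * m - 1) = ?b ^ (2 * m - 1)" using sq(2) by simp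
      moreover have "?b ^ (2 * m - 1) \<noteq> 0" using nz[OF b] by simp
      ultimately have "?a = ?b" by auto
      then show "a = b"
        using bij_betw_of_nat_nonzero[where 'p='p, folded p_def] a b by (auto simp: bij_betw_def dest: inj_onD)
    qed
    show "(g i)\<^sup>2 - of_nat p \<noteq> (e a)\<^sup>2 - of_nat p" if "a \<in> {1..p - 1}" for i a
    proof
      assume "(g i)\<^sup>2 - of_nat p = (e a)\<^sup>2 - of_nat p"
      then have "(g i)\<^sup>2 = (e a)\<^sup>2" by simp
      \<comment> \<open>The invariant \<open>a ^ (2 * m - 1) * b ^ 3\<close> is zero for the pure
        cubes (b = 0) and nonzero for b = 1.\<close>
      from square_eq(2)[OF nzw nz[OF that] this[unfolded e g]] show False using nz[OF that] by simp
    qed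
  qed
  have nint: "s j \<noteq> of_int n" if "j \<in> J" for j n
  proof -
    have "(exp_sum (\<lambda>t. a * t ^ 3 + b * t))\<^sup>2 - of_nat p \<noteq> of_int n" if "a \<noteq> 0" for a b :: "'p mod_ring"
    proof
      assume "(exp_sum (\<lambda>t. a * t ^ 3 + b * t))\<^sup>2 - of_nat p = of_int n"
      then have "(exp_sum (\<lambda>t. a * t ^ 3 + b * t))\<^sup>2 = of_int (n + int p)" by (simp add: diff_eq_eq)
      then show False using exp_sum_cubic_not_integer_1_mod_3[OF m that] by blast
    qed
    note ne = this
    show ?thesis
    proof (cases j)
      case (Inl i)
      then show ?thesis using ne[OF nzw] by (simp only: s_def sum.case g not_False_eq_True)
    next
      case (Inr a)
      then have "a \<in> {1..p - 1}" using that by (auto simp: J_def)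
      then show ?thesis using ne[OF nz] Inr by (simp only: s_def sum.case e not_False_eq_True)
    qed
  qed
  have pos: "3 * p * (p - 1) > 0" "p * (p - 1)\<^sup>2 > 0" "(p - 1) * (p\<^sup>2 - p + 1) > 0"
    using p0 by auto
  \<comment> \<open>Positivity of \<open>K\<close> requires p (p - 1)^2 to be at least 3, since
    \<open>div\<close> rounds down.\<close>
  have "2 ^ 2 \<le> (p - 1)\<^sup>2" using p0 by (intro power_mono) auto
  then have "1 * 3 \<le> p * (p - 1)\<^sup>2" using p0 by (intro mult_le_mono) auto
  then have "K > 0" by (simp add: K_def div_greater_zero_iff)
  then have dpos: "d j > 0" for j using pos(2) by (cases j) (simp_all only: d_def sum.case)
  have finJ: "finite J" and cJ: "card J = 3 + (p - 1)" by (simp_all add: J_def card_Plus)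
  note roots = roots_with_integer_part[OF p0(2) finJ inj nint dpos pos(1,2,3) eqJ]
  show "card {x. poly \<phi> x = 0} = p + 6" using roots(1) cJ p0 by simp
  show "Polynomial.order 0 \<phi> = 3 * p * (p - 1)" "Polynomial.order (of_nat (p * (p - 1))) \<phi> = 1"
    "Polynomial.order (of_nat p) \<phi> = p * (p - 1)\<^sup>2" "Polynomial.order (- of_nat p) \<phi> = (p - 1) * (p\<^sup>2 - p + 1)"
    using roots(2-5) by blast+
  show "Polynomial.order ((g i)\<^sup>2 - of_nat p) \<phi> = p * (p - 1)\<^sup>2 div 3" if "i < 3" for i
  proof -
    have "Inl i \<in> J" using that by (auto simp: J_def)
    from roots(6)[OF _ this] show ?thesis by (simp only: s_def d_def sum.case K_def)
  qed
  show "Polynomial.order ((e a)\<^sup>2 - of_nat p) \<phi> = p * (p - 1)\<^sup>2" if "a \<in> {1..p - 1}" for a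
  proof -
    have "Inr a \<in> J" using that by (auto simp: J_def)
    from roots(6)[OF _ this] show ?thesis by (simp only: s_def d_def sum.case)
  qed
qed

theorem theorem7p6:
  fixes p :: nat
    and vs :: "'p::prime_card point list"
    and A :: "complex mat"
    and \<phi> X :: "complex poly"
    and \<epsilon> :: "('p mod_ring \<Rightarrow> 'p mod_ring) \<Rightarrow> complex"
  assumes p: "p = CARD('p)" "odd p"
    and vs: "distinct vs" "set vs = UNIV"
    and A: "A = adjacency_matrix vs Gamma4_adj"
    and \<phi>: "\<phi> = char_poly A"
    and X: "X = [:0, 1:]"
    and \<epsilon>: "\<epsilon> = exp_sum"
  shows
    "(p = 3 \<longrightarrow>
        \<phi> = X^18 * (X - 6) * (X - 3)^12 * (X + 3)^14 * (X^3 - 9 * X - 9)^12)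
   \<and> (p = 5 \<longrightarrow>
        \<phi> = X^220 * (X - 20) * (X - 5)^80 * (X + 5)^164 * (X^2 - 5 * X - 25)^80)
   \<and> (p > 5 \<and> [p = 2] (mod 3) \<longrightarrow>
        \<phi> = X^(3 * p * (p - 1)) * (X - of_nat (p * (p - 1)))
            * (X - of_nat p)^(p * (p - 1)^2)
            * (X + of_nat p)^((p - 1) * (2 * p^2 - 2 * p + 1))
            * (\<Prod>c = 1..p - 1. (X + of_nat p - [:(\<epsilon> (\<lambda>t. t^3 + of_nat c * t))^2:])^(p * (p - 1)^2))
        \<and> card {x. poly \<phi> x = 0} = p + 3
        \<and> Polynomial.order 0 \<phi> = 3 * p * (p - 1)
        \<and> Polynomial.order (of_nat (p * (p - 1))) \<phi> = 1
        \<and> Polynomial.order (of_nat p) \<phi> = p * (p - 1)^2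
        \<and> Polynomial.order (- of_nat p) \<phi> = (p - 1) * (2 * p^2 - 2 * p + 1)
        \<and> (\<forall>c\<in>{1..p - 1}.
              Polynomial.order ((\<epsilon> (\<lambda>t. t^3 + of_nat c * t))^2 - of_nat p) \<phi> = p * (p - 1)^2))
   \<and> ([p = 1] (mod 3) \<longrightarrow> (\<forall>\<omega>::'p mod_ring. primitive_element \<omega> \<longrightarrow>
        \<phi> = X^(3 * p * (p - 1)) * (X - of_nat (p * (p - 1)))
            * (X - of_nat p)^(p * (p - 1)^2)
            * (X + of_nat p)^((p - 1) * (p^2 - p + 1))
            * ((X + of_nat p - [:(\<epsilon> (\<lambda>t. t^3))^2:])
               * (X + of_nat p - [:(\<epsilon> (\<lambda>t. \<omega> * t^3))^2:])
               * (X + of_nat p - [:(\<epsilon> (\<lambda>t. \<omega>^2 * t^3))^2:]))^(p * (p - 1)^2 div 3)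
            * (\<Prod>a = 1..p - 1. (X + of_nat p - [:(\<epsilon> (\<lambda>t. of_nat a * t^3 + t))^2:])^(p * (p - 1)^2))
        \<and> card {x. poly \<phi> x = 0} = p + 6
        \<and> Polynomial.order 0 \<phi> = 3 * p * (p - 1)
        \<and> Polynomial.order (of_nat (p * (p - 1))) \<phi> = 1
        \<and> Polynomial.order (of_nat p) \<phi> = p * (p - 1)^2
        \<and> Polynomial.order (- of_nat p) \<phi> = (p - 1) * (p^2 - p + 1)
        \<and> (\<forall>i\<in>{0, 1, 2::nat}.
              Polynomial.order ((\<epsilon> (\<lambda>t. \<omega>^i * t^3))^2 - of_nat p) \<phi> = p * (p - 1)^2 div 3)
        \<and> (\<forall>a\<in>{1..p - 1}.
              Polynomial.order ((\<epsilon> (\<lambda>t. of_nat a * t^3 + t))^2 - of_nat p) \<phi> = p * (p - 1)^2)))"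
proof -
  have \<phi>': "\<phi> = char_poly (adjacency_matrix vs Gamma4_adj)" by (simp only: \<phi> A)
  have three: "p = 3 \<Longrightarrow> \<phi> = X ^ 18 * (X - 6) * (X - 3) ^ 12 * (X + 3) ^ 14 * (X ^ 3 - 9 * X - 9) ^ 12"
    unfolding \<phi>' X by (rule char_poly_Gamma4_3[OF _ vs]) (simp only: flip: p(1))
  have five: "p = 5 \<Longrightarrow> \<phi> = X ^ 220 * (X - 20) * (X - 5) ^ 80 * (X + 5) ^ 164 * (X ^ 2 - 5 * X - 25) ^ 80"
    unfolding \<phi>' X by (rule char_poly_Gamma4_5[OF _ vs]) (simp only: flip: p(1))
  note two = spectrum_Gamma4_2_mod_3[where 'p='p, folded p(1), OF p(2) _ _ vs \<phi>', folded \<epsilon> X]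
  note one = spectrum_Gamma4_1_mod_3[where 'p='p, folded p(1), OF p(2) _ vs _ \<phi>', folded \<epsilon> X]
  note one_eq = one(1)[unfolded power_0 mult_1_left power_one_right]
  show ?thesis
    by (intro conjI impI allI ballI; (elim conjE)?;
        ((rule three five two one_eq one(2-6,8); assumption) | (rule one(7); (assumption | force))))
qed

end
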